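(* Let $\kappa$ be a regular uncountable cardinal. If $\mathrm{FA}_\kappa$ holds, then so does $\square^B_\kappa$.
   Context: A c.o.i. is an order-preserving injective continuous map $\pi$ from a set of ordinals $y$, closed in its supremum, into the ordinals. $\binom{\mu}{\theta}$ is the set of images of c.o.i.'s $\pi:\theta\to\mu$. $\mathrm{ssup}(x)=\sup\{\alpha+1\mid\alpha\in x\}$, $\mathrm{cl}(x)=x\cup\{\alpha<\mathrm{ssup}(x)\mid\sup(x\cap\alpha)=\alpha>0\}$. $\mathcal P_\kappa$ is the class of triples $(\mathbb P,\le,\mathbb Q)$, $(\mathbb P,\le)$ a forcing notion with top element $1$, $1\in\mathbb Q\subseteq\mathbb P$, such that: (1) each $p$ has $x_p\in[\kappa^+]^{<\kappa}$, $x_1=\emptyset$, $q\le p\Rightarrow x_q\supseteq x_p$, and for $x\in[\kappa^+]^{<\kappa}$ with $x\supseteq x_p$ there is $q\le p$ with $x_q=x$; (2) with $\mathbb P_y=\{p\mid x_p\subseteq y\}$, $\mathbb Q_y=\mathbb Q\cap\mathbb P_y$: $\mathbb P_\emptyset=\{1\}$, $\mathbb P_\kappa\subseteq H_\kappa$; (3) every c.o.i. $\pi:y\to\kappa^+$ ($y\subseteq\kappa^+$) acts on $\mathbb P_y$ by $p\mapsto\pi.p$ so that $\pi.p\in\mathbb P$, $x_{\pi.p}=\pi[x_p]$, $\mathbb Q$ is preserved, $\pi.q\le\pi.p\iff q\le p$, the identity acts trivially, $\pi'.(\pi.p)=(\pi'\circ\pi).p$ when $\mathrm{im}(\pi)\subseteq\mathrm{dom}(\pi')$,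 and $\pi.p=\pi'.p$ whenever $x_p\subseteq\mathrm{dom}(\pi')$ and $\pi\restriction x_p=\pi'\restriction x_p$; (4) for $p$ and $\alpha<\kappa^+$ there is a unique strongest $r$ with $x_r=x_p\cap\alpha$ and $p\le r$, written $p\restriction\alpha$, with $p\in\mathbb Q\Rightarrow p\restriction\alpha\in\mathbb Q$ and $q\le p\Rightarrow q\restriction\alpha\le p\restriction\alpha$; (5) if $\xi<\kappa$ and $p_\eta=p_{\eta'}\restriction\mathrm{ssup}(x_{p_\eta})$ for $\eta<\eta'<\xi$, there is a unique $p$ with $x_p=\bigcup_\eta x_{p_\eta}$ and $p_\eta=p\restriction\mathrm{ssup}(x_{p_\eta})$, lying in $\mathbb Q$ if all $p_\eta$ do; (6) $x_q$ is closed in its supremum for $q\in\mathbb Q$, and every $p$ has $q\le p$ in $\mathbb Q$ with $x_q=\mathrm{cl}(x_p)$; (7) if $\xi<\kappa$, $\langle q_\eta\mid\eta<\xi\rangle$ is decreasing in $\mathbb Q$, $x=\bigcup_\eta x_{q_\eta}$, $\alpha<\mathrm{ssup}(x)$, $r\in\mathbb Q_{\mathrm{ssup}(x\cap\alpha)}$ is a lower bound of $\langle q_\eta\restriction\alpha\rangle$, then some $q\in\mathbb Q$ is a lower bound of $\langle q_\eta\rangle$ with $q\restriction\mathrm{ssup}(x\cap\alpha)=r$ and $x_q=\mathrm{cl}(x_r\cup x)$; (8) if $p\in\mathbb Q$, $\alpha<\mathrm{ssup}(x_p)$, $q\in\mathbb P_\alpha$, $q\le p\restriction\alpha$, then $p,q$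 have a unique greatest lower bound $r$, with $x_r=x_q\cup x_p$ and $r\restriction\alpha=q$. A nonempty $D\subseteq\mathbb P$ is sharply dense if, with $x_D=\bigcap_{p\in D}x_p$, each $p$ has $q\in D$, $q\le p$, $x_q=\mathrm{cl}(x_p\cup x_D)$. A sharply dense system is $\{D_x\mid x\in\binom{\kappa^+}{\theta}\}$ for some $\theta<\kappa$ with each $D_x$ sharply dense, $x_{D_x}=x$, and $p\in D_x\iff\pi.p\in D_{\pi[x]}$ for every c.o.i. $\pi:y\to\kappa^+$ with $x\subseteq x_p\subseteq y$. $\mathrm{FA}_\kappa$: for every triple in $\mathcal P_\kappa$ and sharply dense systems $\{\mathcal D_i\mid i<\kappa\}$ there is a filter $G$ on $\mathbb P$ with $G\cap D\ne\emptyset$ for every $D\in\bigcup_i\mathcal D_i$. $\square^B_\kappa$: there is $\langle C_\beta\mid\beta\in\Gamma\rangle$ with $\{\beta<\kappa^+\mid\mathrm{cf}\beta=\kappa\}\subseteq\Gamma\subseteq$ limit ordinals below $\kappa^+$, $C_\beta$ club in $\beta$ with $\mathrm{otp}(C_\beta)\le\kappa$, and for every $\beta\in\Gamma$ and $\alpha\in C_\beta$ with $\sup(C_\beta\cap\alpha)=\alpha>0$: $\alpha\in\Gamma$ and $C_\alpha=C_\beta\cap\alpha$. *)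

theory Defs
  imports "HOL-Library.Countable_Set" "HOL-Library.Equipollence"
begin

section \<open>Sets over a type of ordinals\<close>

text \<open>
  Ordinals are the elements of an arbitrary well-ordered type \<open>'o\<close>; the ordinal \<open>\<alpha>\<close>, as
  a set of ordinals, is \<open>{..<\<alpha>}\<close>.

  The elements of a forcing notion are sets. They are taken from the type \<open>'o vset\<close> of all
  sets that are hereditarily of cardinality at most \<open>|'o|\<close>, obtained as well-founded trees
  modulo extensional equality. When \<open>\<kappa>\<^sup>+\<close> is an ordinal of \<open>'o\<close>, this type contains
  (a copy of) the sets hereditarily of size at most \<open>\<kappa>\<^sup>+\<close>. For the class of forcing notions
  defined below this is no restriction up to isomorphism over \<open>H\<^sub>\<kappa>\<close>: if \<open>\<pi>\<close> is the collapse
  of \<open>cl (x\<^sub>p)\<close>, then \<open>p = \<pi>\<^sup>-\<^sup>1.(\<pi>.p)\<close> is determined by \<open>x\<^sub>p\<close> and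
  \<open>\<pi>.p \<in> H\<^sub>\<kappa>\<close>, so that there are at most \<open>2\<^sup>\<kappa>\<close> conditions.
\<close>

text \<open>\<open>VEmpty\<close> denotes the empty set, \<open>VRange f\<close> the nonempty set \<open>{f i | i}\<close>.\<close>

datatype 'o vtree = VEmpty | VRange "'o \<Rightarrow> 'o vtree"

primrec vtree_eq :: "'o vtree \<Rightarrow> 'o vtree \<Rightarrow> bool" where
  "vtree_eq VEmpty t = (t = VEmpty)"
| "vtree_eq (VRange f) t = (case t of VEmpty \<Rightarrow> False | VRange g \<Rightarrow>
     (\<forall>i. \<exists>j. vtree_eq (f i) (g j)) \<and> (\<forall>j. \<exists>i. vtree_eq (f i) (g j)))"

lemma vtree_eq_refl: "vtree_eq t t"
  by (induction t) auto

lemma vtree_eq_sym: "vtree_eq s t \<Longrightarrow> vtree_eq t s"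
proof (induction s arbitrary: t)
  case VEmpty
  then show ?case by simp
next
  case (VRange f)
  obtain g where t: "t = VRange g" using VRange.prems by (cases t) auto
  have IH: "vtree_eq (g j) (f i)" if "vtree_eq (f i) (g j)" for i j
    using VRange.IH[OF rangeI that] .
  show ?case using VRange.prems IH unfolding t by simp blast
qed

lemma vtree_eq_trans: "vtree_eq s t \<Longrightarrow> vtree_eq t u \<Longrightarrow> vtree_eq s u"
proof (induction s arbitrary: t u)
  case VEmpty
  then show ?case by simp
next
  case (VRange f)
  obtain g where t: "t = VRange g" using VRange.prems by (cases t) auto
  obtain h where u: "u = VRange h" using VRange.prems t by (cases u) auto
  have IH: "vtree_eq (f i) (h k)" if "vtree_eq (f i) (g j)" "vtree_eq (g j) (h k)" for i j k
    using VRange.IH[OF rangeI that] .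
  show ?case using VRange.prems IH unfolding t u by simp meson
qed

quotient_type 'o vset = "'o vtree" / vtree_eq
  by (intro equivpI reflpI sympI transpI)
    (auto intro: vtree_eq_refl vtree_eq_sym vtree_eq_trans)

lift_definition vmem :: "'o vset \<Rightarrow> 'o vset \<Rightarrow> bool" is
  "\<lambda>s t. case t of VEmpty \<Rightarrow> False | VRange g \<Rightarrow> \<exists>j. vtree_eq s (g j)"
proof -
  fix s s' t t' :: "'o vtree"
  assume s: "vtree_eq s s'" and t: "vtree_eq t t'"
  show "(case t of VEmpty \<Rightarrow> False | VRange g \<Rightarrow> \<exists>j. vtree_eq s (g j)) \<longleftrightarrow>
    (case t' of VEmpty \<Rightarrow> False | VRange g \<Rightarrow> \<exists>j. vtree_eq s' (g j))"
    using t
    by (cases t; cases t') (auto, (meson s vtree_eq_sym vtree_eq_trans)+)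
qed

lemma vset_extensional: "(\<And>z. vmem z u \<longleftrightarrow> vmem z v) \<Longrightarrow> u = v"
proof (transfer)
  fix u v :: "'o vtree"
  assume a: "\<And>z. (case u of VEmpty \<Rightarrow> False | VRange g \<Rightarrow> \<exists>j. vtree_eq z (g j)) \<longleftrightarrow>
    (case v of VEmpty \<Rightarrow> False | VRange g \<Rightarrow> \<exists>j. vtree_eq z (g j))"
  show "vtree_eq u v"
  proof (cases u; cases v)
    fix f g assume u: "u = VRange f" and v: "v = VRange g"
    have "\<exists>j. vtree_eq (f i) (g j)" for i
      using a[of "f i"] vtree_eq_refl unfolding u v by auto
    moreover have "\<exists>i. vtree_eq (f i) (g j)" for j
      using a[of "g j"] vtree_eq_refl vtree_eq_sym unfolding u v by fastforce
    ultimately show ?thesis unfolding u v by simp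
  qed (use a vtree_eq_refl in fastforce)+
qed

lemma vset_abs_cases: obtains s where "v = abs_vset s"
  by (metis Quotient_abs_rep Quotient_vset)

lemma wfp_vmem: "wfp (vmem :: 'o vset \<Rightarrow> 'o vset \<Rightarrow> bool)"
proof (rule wfpUNIVI)
  fix R :: "'o vset \<Rightarrow> bool" and v
  assume step: "\<forall>u. (\<forall>w. vmem w u \<longrightarrow> R w) \<longrightarrow> R u"
  have "R (abs_vset t)" for t
  proof (induction t)
    case VEmpty
    show ?case using step vset_abs_cases by (metis vmem.abs_eq vtree.case(1))
  next
    case (VRange f)
    have "R w" if w_in: "vmem w (abs_vset (VRange f))" for w
    proof -
      obtain s where w: "w = abs_vset s" by (rule vset_abs_cases)
      obtain i where "vtree_eq s (f i)" using w_in unfolding w by (auto simp: vmem.abs_eq)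
      then have "w = abs_vset (f i)" unfolding w by (simp add: vset.abs_eq_iff)
      then show ?thesis using VRange.IH by blast
    qed
    then show ?case using step by blast
  qed
  then show "R v" using vset_abs_cases by metis
qed

lemma vset_exists:
  fixes A :: "'o vset set"
  assumes "A \<lesssim> (UNIV :: 'o set)"
  shows "\<exists>v. \<forall>u. vmem u v \<longleftrightarrow> u \<in> A"
proof (cases "A = {}")
  case True
  have "\<not> vmem u (abs_vset VEmpty)" for u :: "'o vset"
    by (cases u rule: vset_abs_cases) (simp add: vmem.abs_eq)
  then show ?thesis using True by blast
next
  case False
  obtain c :: "'o \<Rightarrow> 'o vset" where c: "range c = A"
    using assms False by (metis lepoll_iff subset_image_iff image_subset_iff inj_on_iff_surj lepoll_def)
  define v where "v = abs_vset (VRange (\<lambda>i. rep_vset (c i)))"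
  have "vmem u v \<longleftrightarrow> u \<in> A" for u
  proof -
    obtain s where u: "u = abs_vset s" by (rule vset_abs_cases)
    have "vtree_eq s (rep_vset w) \<longleftrightarrow> u = w" for w
      unfolding u by (metis Quotient_abs_rep Quotient_vset vset.abs_eq_iff)
    then show ?thesis unfolding v_def using u c by (auto simp: vmem.abs_eq)
  qed
  then show ?thesis by blast
qed


section \<open>Ordinals and cardinals\<close>

text \<open>
  The least elements below are only used where they exist, namely for sets of ordinals below
  \<open>\<kappa>\<^sup>+\<close>.
\<close>

definition osup :: "'o::wellorder set \<Rightarrow> 'o" where
  "osup A = (LEAST b. \<forall>a\<in>A. a \<le> b)"

definition ozero :: "'o::wellorder" where
  "ozero = osup {}"

definition osucc :: "'o::wellorder \<Rightarrow> 'o" where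
  "osucc a = (LEAST b. a < b)"

definition ssup :: "'o::wellorder set \<Rightarrow> 'o" where
  "ssup x = osup (osucc ` x)"

definition limit_pt :: "'o::wellorder set \<Rightarrow> 'o \<Rightarrow> bool" where
  "limit_pt x \<alpha> \<longleftrightarrow> osup (x \<inter> {..<\<alpha>}) = \<alpha> \<and> \<alpha> > ozero"

definition limit_ordinal :: "'o::wellorder \<Rightarrow> bool" where
  "limit_ordinal \<beta> \<longleftrightarrow> limit_pt {..<\<beta>} \<beta>"

definition cl :: "'o::wellorder set \<Rightarrow> 'o set" where
  "cl x = x \<union> {\<alpha>. \<alpha> < ssup x \<and> limit_pt x \<alpha>}"

definition closed_in_sup :: "'o::wellorder set \<Rightarrow> bool" where
  "closed_in_sup y \<longleftrightarrow> (\<forall>\<alpha> < osup y. limit_pt y \<alpha> \<longrightarrow> \<alpha> \<in> y)"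

definition otp :: "'o::wellorder set \<Rightarrow> 'o" where
  "otp x = (THE a. \<exists>f. strict_mono_on {..<a} f \<and> f ` {..<a} = x)"

definition cof :: "'o::wellorder \<Rightarrow> 'o" where
  "cof \<beta> = (LEAST a. \<exists>x \<subseteq> {..<\<beta>}. (\<forall>\<gamma> < \<beta>. \<exists>\<delta>\<in>x. \<gamma> \<le> \<delta>) \<and> otp x = a)"

definition is_cardinal :: "'o::wellorder \<Rightarrow> bool" where
  "is_cardinal \<kappa> \<longleftrightarrow> (\<forall>\<alpha> < \<kappa>. {..<\<alpha>} \<prec> {..<\<kappa>})"

definition regular_uncountable :: "'o::wellorder \<Rightarrow> bool" where
  "regular_uncountable \<kappa> \<longleftrightarrow> is_cardinal \<kappa> \<and> uncountable {..<\<kappa>} \<and> cof \<kappa> = \<kappa>"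

definition succ_card :: "'o::wellorder \<Rightarrow> 'o" where
  "succ_card \<kappa> = (LEAST \<mu>. {..<\<kappa>} \<prec> {..<\<mu>})"

definition small_subsets :: "'o::wellorder \<Rightarrow> 'o \<Rightarrow> 'o set set" where
  "small_subsets \<mu> \<kappa> = {x. x \<subseteq> {..<\<mu>} \<and> x \<prec> {..<\<kappa>}}"

definition Hset :: "'o::wellorder \<Rightarrow> 'o vset set" where
  "Hset \<kappa> = {v. {u. vmem\<^sup>+\<^sup>+ u v} \<prec> {..<\<kappa>}}"


section \<open>Continuous order-preserving injections\<close>

text \<open>
  A map \<open>\<pi>\<close> with domain \<open>y\<close> is represented by \<open>y\<close> together with a total function, of
  which only the values on \<open>y\<close> matter. \<open>coi y \<pi> \<mu>\<close> says that \<open>\<pi> : y \<rightarrow> \<mu>\<close> is a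
  c.o.i.
\<close>

definition coi :: "'o::wellorder set \<Rightarrow> ('o \<Rightarrow> 'o) \<Rightarrow> 'o \<Rightarrow> bool" where
  "coi y \<pi> \<mu> \<longleftrightarrow> closed_in_sup y \<and> strict_mono_on y \<pi> \<and>
     (\<forall>\<alpha>\<in>y. limit_pt y \<alpha> \<longrightarrow> \<pi> \<alpha> = osup (\<pi> ` (y \<inter> {..<\<alpha>}))) \<and> \<pi> ` y \<subseteq> {..<\<mu>}"

definition coi_images :: "'o::wellorder \<Rightarrow> 'o \<Rightarrow> 'o set set" where
  "coi_images \<mu> \<theta> = {\<pi> ` {..<\<theta>} | \<pi>. coi {..<\<theta>} \<pi> \<mu>}"


section \<open>The class of forcing notions\<close>

text \<open>
  The supports \<open>x\<^sub>p\<close> and the action \<open>p \<mapsto> \<pi>.p\<close> (for \<open>\<pi>\<close> with domain \<open>y\<close>, written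
  \<open>act y \<pi> p\<close>) are part of the structure, since sharp density refers to them. The order is
  only required to be a preorder; antisymmetry follows from the uniqueness of restrictions.
\<close>

locale forcing_data =
  fixes \<kappa> :: "'o::wellorder"
    and P :: "'o vset set"
    and le :: "'o vset \<Rightarrow> 'o vset \<Rightarrow> bool"  (infix \<open>\<preceq>\<close> 50)
    and one :: "'o vset"
    and Q :: "'o vset set"
    and supp :: "'o vset \<Rightarrow> 'o set"
    and act :: "'o set \<Rightarrow> ('o \<Rightarrow> 'o) \<Rightarrow> 'o vset \<Rightarrow> 'o vset"
begin

abbreviation \<kappa>p :: 'o where
  "\<kappa>p \<equiv> succ_card \<kappa>"

definition P_on :: "'o set \<Rightarrow> 'o vset set" where
  "P_on y = {p \<in> P. supp p \<subseteq> y}"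

definition Q_on :: "'o set \<Rightarrow> 'o vset set" where
  "Q_on y = Q \<inter> P_on y"

definition is_restr :: "'o vset \<Rightarrow> 'o \<Rightarrow> 'o vset \<Rightarrow> bool" where
  "is_restr p \<alpha> r \<longleftrightarrow> r \<in> P \<and> supp r = supp p \<inter> {..<\<alpha>} \<and> p \<preceq> r \<and>
     (\<forall>s\<in>P. supp s = supp p \<inter> {..<\<alpha>} \<and> p \<preceq> s \<longrightarrow> r \<preceq> s)"

definition restr :: "'o vset \<Rightarrow> 'o \<Rightarrow> 'o vset" where
  "restr p \<alpha> = (THE r. is_restr p \<alpha> r)"

definition is_glb :: "'o vset \<Rightarrow> 'o vset \<Rightarrow> 'o vset \<Rightarrow> bool" where
  "is_glb p q r \<longleftrightarrow> r \<in> P \<and> r \<preceq> p \<and> r \<preceq> q \<and> (\<forall>s\<in>P. s \<preceq> p \<and> s \<preceq> q \<longrightarrow> s \<preceq> r)"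

definition supp_of :: "'o vset set \<Rightarrow> 'o set" where
  "supp_of D = (\<Inter>p\<in>D. supp p)"

definition sharply_dense :: "'o vset set \<Rightarrow> bool" where
  "sharply_dense D \<longleftrightarrow> D \<noteq> {} \<and> D \<subseteq> P \<and>
     (\<forall>p\<in>P. \<exists>q\<in>D. q \<preceq> p \<and> supp q = cl (supp p \<union> supp_of D))"

definition sharply_dense_system :: "'o \<Rightarrow> ('o set \<Rightarrow> 'o vset set) \<Rightarrow> bool" where
  "sharply_dense_system \<theta> D \<longleftrightarrow> \<theta> < \<kappa> \<and>
     (\<forall>x \<in> coi_images \<kappa>p \<theta>. sharply_dense (D x) \<and> supp_of (D x) = x \<and>
        (\<forall>y \<pi> p. y \<subseteq> {..<\<kappa>p} \<and> coi y \<pi> \<kappa>p \<and> p \<in> P \<and> x \<subseteq> supp p \<and> supp p \<subseteq> y \<longrightarrow>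
           (p \<in> D x \<longleftrightarrow> act y \<pi> p \<in> D (\<pi> ` x))))"

definition is_filter :: "'o vset set \<Rightarrow> bool" where
  "is_filter G \<longleftrightarrow> G \<noteq> {} \<and> G \<subseteq> P \<and> (\<forall>p\<in>G. \<forall>q\<in>P. p \<preceq> q \<longrightarrow> q \<in> G) \<and>
     (\<forall>p\<in>G. \<forall>q\<in>G. \<exists>r\<in>G. r \<preceq> p \<and> r \<preceq> q)"

end

locale forcing_class = forcing_data +
  assumes refl: "p \<in> P \<Longrightarrow> p \<preceq> p"
    and trans: "p \<in> P \<Longrightarrow> q \<in> P \<Longrightarrow> r \<in> P \<Longrightarrow> p \<preceq> q \<Longrightarrow> q \<preceq> r \<Longrightarrow> p \<preceq> r"
    and top: "p \<in> P \<Longrightarrow> p \<preceq> one"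
    and one_in: "one \<in> Q"
    and Q_sub: "Q \<subseteq> P"
    and supp_small: "p \<in> P \<Longrightarrow> supp p \<in> small_subsets \<kappa>p \<kappa>"
    and supp_one: "supp one = {}"
    and supp_anti: "p \<in> P \<Longrightarrow> q \<in> P \<Longrightarrow> q \<preceq> p \<Longrightarrow> supp p \<subseteq> supp q"
    and supp_extend: "p \<in> P \<Longrightarrow> x \<in> small_subsets \<kappa>p \<kappa> \<Longrightarrow> supp p \<subseteq> x \<Longrightarrow>
      \<exists>q\<in>P. q \<preceq> p \<and> supp q = x"
    and P_on_empty: "P_on {} = {one}"
    and P_on_kappa: "P_on {..<\<kappa>} \<subseteq> Hset \<kappa>"
    and act_in: "y \<subseteq> {..<\<kappa>p} \<Longrightarrow> coi y \<pi> \<kappa>p \<Longrightarrow> p \<in> P_on y \<Longrightarrow> act y \<pi> p \<in> P"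
    and supp_act: "y \<subseteq> {..<\<kappa>p} \<Longrightarrow> coi y \<pi> \<kappa>p \<Longrightarrow> p \<in> P_on y \<Longrightarrow>
      supp (act y \<pi> p) = \<pi> ` supp p"
    and act_Q: "y \<subseteq> {..<\<kappa>p} \<Longrightarrow> coi y \<pi> \<kappa>p \<Longrightarrow> p \<in> Q_on y \<Longrightarrow> act y \<pi> p \<in> Q"
    and act_le: "y \<subseteq> {..<\<kappa>p} \<Longrightarrow> coi y \<pi> \<kappa>p \<Longrightarrow> p \<in> P_on y \<Longrightarrow> q \<in> P_on y \<Longrightarrow>
      act y \<pi> q \<preceq> act y \<pi> p \<longleftrightarrow> q \<preceq> p"
    and act_id: "y \<subseteq> {..<\<kappa>p} \<Longrightarrow> coi y id \<kappa>p \<Longrightarrow> p \<in> P_on y \<Longrightarrow> act y id p = p"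
    and act_comp: "y \<subseteq> {..<\<kappa>p} \<Longrightarrow> coi y \<pi> \<kappa>p \<Longrightarrow> y' \<subseteq> {..<\<kappa>p} \<Longrightarrow> coi y' \<pi>' \<kappa>p \<Longrightarrow>
      \<pi> ` y \<subseteq> y' \<Longrightarrow> p \<in> P_on y \<Longrightarrow> act y' \<pi>' (act y \<pi> p) = act y (\<pi>' \<circ> \<pi>) p"
    and act_local: "y \<subseteq> {..<\<kappa>p} \<Longrightarrow> coi y \<pi> \<kappa>p \<Longrightarrow> y' \<subseteq> {..<\<kappa>p} \<Longrightarrow> coi y' \<pi>' \<kappa>p \<Longrightarrow>
      p \<in> P_on y \<Longrightarrow> supp p \<subseteq> y' \<Longrightarrow> (\<And>\<alpha>. \<alpha> \<in> supp p \<Longrightarrow> \<pi> \<alpha> = \<pi>' \<alpha>) \<Longrightarrow>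
      act y \<pi> p = act y' \<pi>' p"
    and restr_unique: "p \<in> P \<Longrightarrow> \<alpha> < \<kappa>p \<Longrightarrow> \<exists>!r. is_restr p \<alpha> r"
    and restr_Q: "p \<in> Q \<Longrightarrow> \<alpha> < \<kappa>p \<Longrightarrow> restr p \<alpha> \<in> Q"
    and restr_mono: "p \<in> P \<Longrightarrow> q \<in> P \<Longrightarrow> \<alpha> < \<kappa>p \<Longrightarrow> q \<preceq> p \<Longrightarrow> restr q \<alpha> \<preceq> restr p \<alpha>"
    and amalg_unique: "\<xi> < \<kappa> \<Longrightarrow> (\<And>\<eta>. \<eta> < \<xi> \<Longrightarrow> ps \<eta> \<in> P) \<Longrightarrow>
      (\<And>\<eta> \<eta>'. \<eta> < \<eta>' \<Longrightarrow> \<eta>' < \<xi> \<Longrightarrow> ps \<eta> = restr (ps \<eta>') (ssup (supp (ps \<eta>)))) \<Longrightarrow>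
      \<exists>!p. p \<in> P \<and> supp p = (\<Union>\<eta>\<in>{..<\<xi>}. supp (ps \<eta>)) \<and>
        (\<forall>\<eta> < \<xi>. ps \<eta> = restr p (ssup (supp (ps \<eta>))))"
    and amalg_Q: "\<xi> < \<kappa> \<Longrightarrow> (\<And>\<eta>. \<eta> < \<xi> \<Longrightarrow> ps \<eta> \<in> Q) \<Longrightarrow>
      (\<And>\<eta> \<eta>'. \<eta> < \<eta>' \<Longrightarrow> \<eta>' < \<xi> \<Longrightarrow> ps \<eta> = restr (ps \<eta>') (ssup (supp (ps \<eta>)))) \<Longrightarrow>
      p \<in> P \<Longrightarrow> supp p = (\<Union>\<eta>\<in>{..<\<xi>}. supp (ps \<eta>)) \<Longrightarrow>
      (\<And>\<eta>. \<eta> < \<xi> \<Longrightarrow> ps \<eta> = restr p (ssup (supp (ps \<eta>)))) \<Longrightarrow> p \<in> Q"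
    and Q_closed: "q \<in> Q \<Longrightarrow> closed_in_sup (supp q)"
    and Q_dense: "p \<in> P \<Longrightarrow> \<exists>q\<in>Q. q \<preceq> p \<and> supp q = cl (supp p)"
    and Q_lower_bound: "\<xi> < \<kappa> \<Longrightarrow> (\<And>\<eta>. \<eta> < \<xi> \<Longrightarrow> qs \<eta> \<in> Q) \<Longrightarrow>
      (\<And>\<eta> \<eta>'. \<eta> < \<eta>' \<Longrightarrow> \<eta>' < \<xi> \<Longrightarrow> qs \<eta>' \<preceq> qs \<eta>) \<Longrightarrow>
      x = (\<Union>\<eta>\<in>{..<\<xi>}. supp (qs \<eta>)) \<Longrightarrow> \<alpha> < ssup x \<Longrightarrow>
      r \<in> Q_on {..<ssup (x \<inter> {..<\<alpha>})} \<Longrightarrow> (\<And>\<eta>. \<eta> < \<xi> \<Longrightarrow> r \<preceq> restr (qs \<eta>) \<alpha>) \<Longrightarrow>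
      \<exists>q\<in>Q. (\<forall>\<eta> < \<xi>. q \<preceq> qs \<eta>) \<and> restr q (ssup (x \<inter> {..<\<alpha>})) = r \<and>
        supp q = cl (supp r \<union> x)"
    and glb: "p \<in> Q \<Longrightarrow> \<alpha> < ssup (supp p) \<Longrightarrow> q \<in> P_on {..<\<alpha>} \<Longrightarrow> q \<preceq> restr p \<alpha> \<Longrightarrow>
      \<exists>r. is_glb p q r \<and> (\<forall>r'. is_glb p q r' \<longrightarrow> r' = r) \<and>
        supp r = supp q \<union> supp p \<and> restr r \<alpha> = q"


section \<open>The forcing axiom and the square principle\<close>

definition FA :: "'o::wellorder \<Rightarrow> bool" where
  "FA \<kappa> \<longleftrightarrow> (\<forall>P le one Q supp act. forcing_class \<kappa> P le one Q supp act \<longrightarrow>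
     (\<forall>\<theta> D. (\<forall>i < \<kappa>. forcing_data.sharply_dense_system \<kappa> P le supp act (\<theta> i) (D i)) \<longrightarrow>
       (\<exists>G. forcing_data.is_filter P le G \<and>
          (\<forall>i < \<kappa>. \<forall>x \<in> coi_images (succ_card \<kappa>) (\<theta> i). G \<inter> D i x \<noteq> {}))))"

definition club_in :: "'o::wellorder set \<Rightarrow> 'o \<Rightarrow> bool" where
  "club_in C \<beta> \<longleftrightarrow> C \<subseteq> {..<\<beta>} \<and> (\<forall>\<gamma> < \<beta>. \<exists>\<delta>\<in>C. \<gamma> < \<delta>) \<and>
     (\<forall>\<alpha> < \<beta>. limit_pt C \<alpha> \<longrightarrow> \<alpha> \<in> C)"

definition square_B :: "'o::wellorder \<Rightarrow> bool" where
  "square_B \<kappa> \<longleftrightarrow> (\<exists>\<Gamma> C.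
     {\<beta>. \<beta> < succ_card \<kappa> \<and> cof \<beta> = \<kappa>} \<subseteq> \<Gamma> \<and>
     \<Gamma> \<subseteq> {\<beta>. \<beta> < succ_card \<kappa> \<and> limit_ordinal \<beta>} \<and>
     (\<forall>\<beta>\<in>\<Gamma>. club_in (C \<beta>) \<beta> \<and> otp (C \<beta>) \<le> \<kappa>) \<and>
     (\<forall>\<beta>\<in>\<Gamma>. \<forall>\<alpha>\<in>C \<beta>. limit_pt (C \<beta>) \<alpha> \<longrightarrow> \<alpha> \<in> \<Gamma> \<and> C \<alpha> = C \<beta> \<inter> {..<\<alpha>}))"

end

theory Submission
  imports Defs
begin

text \<open>
  The principle is forced by bounded approximations: a condition consists of a support
  \<open>x \<in> [\<kappa>\<^sup>+]\<^bsup><\<kappa>\<^esup>\<close> and of sets \<open>c\<^sub>b \<subseteq> x \<inter> (b + 1)\<close> for \<open>b \<in> x\<close>, closed in \<open>b + 1\<close>, such that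
  \<open>c\<^sub>d = c\<^sub>b \<inter> (d + 1)\<close> at every limit point \<open>d\<close> of \<open>c\<^sub>b\<close>. Stronger conditions have larger supports and
  end-extend the \<open>c\<^sub>b\<close>. The subset \<open>Q\<close> consists of the conditions with closed support for which
  \<open>c\<^sub>b\<close> contains the supremum of \<open>x \<inter> b\<close>. The conditions reaching \<open>g\<close> at \<open>b\<close>, for \<open>g < b\<close>,
  form a sharply dense system indexed by the pairs \<open>{g, b}\<close>, and a filter \<open>G\<close> meeting it gives
  \<open>C\<^sub>b\<close> as the union of the sets \<open>c\<^sub>b \<inter> b\<close> over \<open>G\<close>. Initial segments of \<open>C\<^sub>b\<close> have size less than
  \<open>\<kappa>\<close>, whence the bound on the order type. \<open>\<Gamma>\<close> consists of the ordinals of cofinality \<open>\<kappa>\<close> and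
  of the limit points of their \<open>C\<^sub>b\<close>.
\<close>

section \<open>Ordinals, limit points and small sets\<close>

text \<open>Two demands shape the conditions. The first is the action of c.o.i.'s, which preserve
  order and limit points but not cofinality. A condition therefore cannot mention which ordinals
  have cofinality \<open>\<kappa>\<close>. Instead \<open>b\<close> may enter its own set, closing
  it off, only when \<open>b\<close> is a limit point of the support; a support has fewer than
  \<open>\<kappa>\<close> elements, so this cannot happen at cofinality \<open>\<kappa>\<close>,
  where the set must remain cofinal. The second demand is the existence of lower bounds. In the
  limit of a decreasing sequence the set at an old point \<open>b\<close> may gain a limit point
  \<open>d\<close>, its supremum, and coherence then dictates the set at \<open>d\<close>. This
  could clash with a set already growing at an old \<open>d < b\<close>, or with the demand made by
  another old point. In \<open>Q\<close>, where each set reaches the supremum of the support below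
  its index, neither occurs: an old \<open>d < b\<close> was settled at some stage, and a new
  \<open>d\<close> is the supremum of the old points below exactly one old point. What has been
  settled stays so, because a set containing its own index is never extended again.\<close>

lemma osup_le_iff:
  assumes "A \<subseteq> {..b}"
  shows "osup A \<le> c \<longleftrightarrow> (\<forall>a\<in>A. a \<le> c)"
proof
  \<comment> \<open>The bound \<open>b\<close> guarantees that the \<open>LEAST\<close> in
    \<open>osup\<close> exists; on unbounded sets its value is unspecified.\<close>
  have *: "\<forall>a\<in>A. a \<le> osup A"
    unfolding osup_def by (rule LeastI[of _ b]) (use assms in auto)
  show "\<forall>a\<in>A. a \<le> c" if "osup A \<le> c"
    using * that order_trans by blast
  show "osup A \<le> c" if "\<forall>a\<in>A. a \<le> c"
    unfolding osup_def using that by (rule Least_le)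
qed

lemma less_osup_iff:
  assumes "A \<subseteq> {..b}"
  shows "c < osup A \<longleftrightarrow> (\<exists>a\<in>A. c < a)"
  using osup_le_iff[OF assms, of c] by (auto simp: not_le[symmetric])

lemma ozero_le: "ozero \<le> (a::'o::wellorder)"
  unfolding ozero_def osup_def by (rule Least_le) simp

text \<open>The form used from here on: free of suprema and visibly monotone in \<open>x\<close>.
  Its first conjunct replaces \<open>ozero < \<delta>\<close>.\<close>

lemma limit_pt_iff:
  "limit_pt x \<delta> \<longleftrightarrow> (\<exists>\<gamma>. \<gamma> < \<delta>) \<and> (\<forall>\<gamma><\<delta>. \<exists>a\<in>x. \<gamma> < a \<and> a < \<delta>)"
proof -
  have b: "x \<inter> {..<\<delta>} \<subseteq> {..\<delta>}" by auto
  have "osup (x \<inter> {..<\<delta>}) \<le> \<delta>" unfolding osup_le_iff[OF b] by auto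
  then have "osup (x \<inter> {..<\<delta>}) = \<delta> \<longleftrightarrow> (\<forall>\<gamma><\<delta>. \<gamma> < osup (x \<inter> {..<\<delta>}))"
    by (metis antisym_conv1 less_irrefl)
  also have "\<dots> \<longleftrightarrow> (\<forall>\<gamma><\<delta>. \<exists>a\<in>x. \<gamma> < a \<and> a < \<delta>)"
    unfolding less_osup_iff[OF b] by auto
  finally have "osup (x \<inter> {..<\<delta>}) = \<delta> \<longleftrightarrow> (\<forall>\<gamma><\<delta>. \<exists>a\<in>x. \<gamma> < a \<and> a < \<delta>)" .
  moreover have "ozero < \<delta> \<longleftrightarrow> (\<exists>\<gamma>. \<gamma> < \<delta>)" using ozero_le le_less_trans by blast
  ultimately show ?thesis unfolding limit_pt_def by blast
qed

lemma limit_ptD: "limit_pt x \<delta> \<Longrightarrow> \<gamma> < \<delta> \<Longrightarrow> \<exists>a\<in>x. \<gamma> < a \<and> a < \<delta>"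
  by (simp add: limit_pt_iff)

lemma limit_pt_mono:
  "limit_pt x \<delta> \<Longrightarrow> (\<And>a. a \<in> x \<Longrightarrow> a < \<delta> \<Longrightarrow> a \<in> y) \<Longrightarrow> limit_pt y \<delta>"
  unfolding limit_pt_iff by meson

lemma finite_no_limit_pt: "finite x \<Longrightarrow> \<not> limit_pt x \<delta>"
proof
  assume fin: "finite x" and lim: "limit_pt x \<delta>"
  define m where "m = Max (x \<inter> {..<\<delta>})"
  have "x \<inter> {..<\<delta>} \<noteq> {}" using lim unfolding limit_pt_iff by blast
  then have "m \<in> x \<inter> {..<\<delta>}" and "\<forall>a\<in>x \<inter> {..<\<delta>}. a \<le> m"
    using fin Max_in[of "x \<inter> {..<\<delta>}"] Max_ge[of "x \<inter> {..<\<delta>}"] unfolding m_def by auto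
  then show False using limit_ptD[OF lim, of m] by (metis Int_iff leD lessThan_iff)
qed

text \<open>The type may have a greatest element, whose \<open>osucc\<close> is unspecified; some
  \<open>\<mu>\<close> above \<open>b\<close> rules this out.\<close>

lemma less_osucc_iff:
  assumes "b < \<mu>"
  shows "a < osucc b \<longleftrightarrow> a \<le> b"
proof -
  have "b < osucc b" unfolding osucc_def by (rule LeastI) (rule assms)
  moreover have "osucc b \<le> a" if "b < a" unfolding osucc_def using that by (rule Least_le)
  ultimately show ?thesis by (meson leD leI le_less_trans)
qed

lemma osucc_le_iff: "b < \<mu> \<Longrightarrow> osucc b \<le> c \<longleftrightarrow> b < c"
  using less_osucc_iff[of b \<mu> c] by (simp add: not_less[symmetric])

lemma less_ssup_iff:
  assumes "x \<subseteq> {..<\<mu>}"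
  shows "a < ssup x \<longleftrightarrow> (\<exists>b\<in>x. a \<le> b)"
proof -
  have *: "b < \<mu>" if "b \<in> x" for b using assms that by auto
  have 1: "osucc ` x \<subseteq> {..\<mu>}" using osucc_le_iff[OF *] * by auto
  show ?thesis unfolding ssup_def less_osup_iff[OF 1] using less_osucc_iff[OF *] by auto
qed

text \<open>Clause \<open>Q_lower_bound\<close> restricts at \<open>\<alpha>\<close> on one side and
  at this strict supremum on the other; both cuts select the same points of
  \<open>x\<close>.\<close>

lemma ssup_Int_less:
  assumes "x \<subseteq> {..<\<mu>}"
  shows "x \<inter> {..<ssup (x \<inter> {..<\<alpha>})} = x \<inter> {..<\<alpha>}"
proof -
  have "x \<inter> {..<\<alpha>} \<subseteq> {..<\<mu>}" using assms by auto
  note * = less_ssup_iff[OF this]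
  show ?thesis by (auto simp: *)
qed

lemma cl_iff:
  assumes "x \<subseteq> {..<\<mu>}"
  shows "\<delta> \<in> cl x \<longleftrightarrow> \<delta> \<in> x \<or> limit_pt x \<delta> \<and> (\<exists>b\<in>x. \<delta> < b)"
  unfolding cl_def using less_ssup_iff[OF assms] by (auto simp: le_less)

lemma cl_subset: "x \<subseteq> {..<\<mu>} \<Longrightarrow> cl x \<subseteq> {..<\<mu>}"
  using cl_iff[of x \<mu>] by (meson lessThan_iff less_trans subset_iff)

text \<open>A point of \<open>cl x\<close> between \<open>\<gamma>\<close> and
  \<open>\<delta>\<close> is in \<open>x\<close> or is approached by points of \<open>x\<close>
  above \<open>\<gamma>\<close>, so closing off creates no further limit points.\<close>

lemma limit_pt_cl:
  assumes "x \<subseteq> {..<\<mu>}" "limit_pt (cl x) \<delta>"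
  shows "limit_pt x \<delta>"
  unfolding limit_pt_iff
proof (intro conjI allI impI)
  show "\<exists>\<gamma>. \<gamma> < \<delta>" using assms(2) by (simp add: limit_pt_iff)
  fix \<gamma> assume "\<gamma> < \<delta>"
  then obtain a where a: "a \<in> cl x" "\<gamma> < a" "a < \<delta>" using limit_ptD[OF assms(2)] by blast
  then show "\<exists>a\<in>x. \<gamma> < a \<and> a < \<delta>"
    unfolding cl_iff[OF assms(1)] using limit_ptD[of x a \<gamma>] by (metis less_trans)
qed

lemma closed_in_sup_iff:
  assumes "y \<subseteq> {..<\<mu>}"
  shows "closed_in_sup y \<longleftrightarrow> (\<forall>b\<in>y. \<forall>\<delta>\<le>b. limit_pt y \<delta> \<longrightarrow> \<delta> \<in> y)"
proof -
  have "y \<subseteq> {..\<mu>}" using assms by auto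
  from less_osup_iff[OF this] show ?thesis
    unfolding closed_in_sup_def by (auto simp: le_less)
qed

lemma cl_closed:
  assumes "x \<subseteq> {..<\<mu>}"
  shows "closed_in_sup (cl x)"
  unfolding closed_in_sup_iff[OF cl_subset[OF assms]]
proof (intro ballI allI impI)
  fix b \<delta> assume b: "b \<in> cl x" "\<delta> \<le> b" and lim: "limit_pt (cl x) \<delta>"
  have "limit_pt x \<delta>" using limit_pt_cl[OF assms lim] .
  then show "\<delta> \<in> cl x"
    using b unfolding cl_iff[OF assms] by (metis le_less le_less_trans)
qed

text \<open>Send an added limit point to the least element of \<open>x\<close> above it. Between two
  added points lies an element of \<open>x\<close>, so the images increase strictly.\<close>

lemma cl_new_lepoll: "x \<subseteq> {..<\<mu>} \<Longrightarrow> cl x - x \<lesssim> x"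
proof -
  assume x: "x \<subseteq> {..<\<mu>}"
  define f where "f \<delta> = (LEAST b. b \<in> x \<and> \<delta> < b)" for \<delta>
  have f: "f \<delta> \<in> x" "\<delta> < f \<delta>" if d: "\<delta> \<in> cl x - x" for \<delta>
  proof -
    have "\<exists>b. b \<in> x \<and> \<delta> < b" using d cl_iff[OF x, of \<delta>] by blast
    then have "f \<delta> \<in> x \<and> \<delta> < f \<delta>" unfolding f_def by (rule LeastI_ex)
    then show "f \<delta> \<in> x" "\<delta> < f \<delta>" by auto
  qed
  have less: "f \<delta> < f \<delta>'" if lt: "\<delta> < \<delta>'" and "\<delta> \<in> cl x - x" "\<delta>' \<in> cl x - x" for \<delta> \<delta>'
  proof -
    have "limit_pt x \<delta>'" using that(3) by (auto simp: cl_iff[OF x])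
    then obtain a where a: "a \<in> x" "\<delta> < a" "a < \<delta>'" using limit_ptD[of x \<delta>' \<delta>] lt by blast
    then have "f \<delta> \<le> a" unfolding f_def by (intro Least_le) simp
    then show ?thesis using f(2)[OF that(3)] a(3) by auto
  qed
  have "inj_on f (cl x - x)"
    by (rule linorder_inj_onI') (metis less less_irrefl)
  then show ?thesis unfolding lepoll_def using f(1) by blast
qed

section \<open>Order types and cofinality\<close>

lemma otp_witness:
  fixes x :: "'o::wellorder set"
  assumes x: "x \<subseteq> {..<\<beta>}"
  obtains f where "strict_mono_on {..<otp x} f" "f ` {..<otp x} = x" "otp x \<le> \<beta>"
proof -
  have inj_le: "a \<le> f a" if "strict_mono_on {..<b} f" "a < b" for a b and f :: "'o \<Rightarrow> 'o"
    using that(2)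
  proof (induction a rule: less_induct)
    case (less a)
    show ?case
    proof (rule ccontr)
      assume "\<not> a \<le> f a"
      then have "f a < a" by simp
      then have "f a \<le> f (f a)" "f (f a) < f a"
        using less strict_mono_onD[OF that(1)] by auto
      then show False by simp
    qed
  qed
  \<comment> \<open>Uniqueness of the order type: were \<open>b < a\<close>, then \<open>h\<close>
    would map \<open>{..<a}\<close> strictly increasingly into \<open>{..<b}\<close>, contradicting
    \<open>inj_le\<close> at \<open>b\<close>.\<close>
  have le: "a \<le> b" if f: "strict_mono_on {..<a} f" "f ` {..<a} = x"
    and g: "strict_mono_on {..<b} g" "g ` {..<b} = x" for a b :: 'o and f g
  proof (rule ccontr)
    assume "\<not> a \<le> b"
    then have "b < a" by simp
    define h where "h = inv_into {..<b} g \<circ> f"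
    have g': "bij_betw g {..<b} x"
      using g strict_mono_on_imp_inj_on[OF g(1)] by (auto simp: bij_betw_def)
    have h: "h c \<in> {..<b}" "g (h c) = f c" if "c < a" for c
    proof -
      have "f c \<in> g ` {..<b}" using that f(2) g(2) by auto
      then show "h c \<in> {..<b}" "g (h c) = f c"
        unfolding h_def comp_apply by (simp_all only: inv_into_into f_inv_into_f)
    qed
    have "strict_mono_on {..<a} h"
    proof (rule strict_mono_onI)
      fix c d assume "c \<in> {..<a}" "d \<in> {..<a}" "c < d"
      then have "g (h c) < g (h d)" using h f(1) by (simp add: strict_mono_onD)
      then show "h c < h d"
        using h g(1) \<open>c \<in> _\<close> \<open>d \<in> _\<close> by (metis strict_mono_on_less lessThan_iff)
    qed
    then have "b \<le> h b" using inj_le \<open>b < a\<close> by blast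
    then show False using h(1)[OF \<open>b < a\<close>] by simp
  qed
  \<comment> \<open>The collapse of \<open>x\<close> by recursion, defined at every
    \<open>z\<close>: \<open>c z\<close> is the order type of the part of \<open>x\<close> below
    \<open>z\<close>. So \<open>c \<beta>\<close> is the order type sought, and
    \<open>c z \<le> z\<close> gives the bound.\<close>
  define c where "c = wfrec {(w, z). w < z} (\<lambda>g z. LEAST b::'o. \<forall>w\<in>x. w < z \<longrightarrow> g w < b)"
  have c_eq: "c z = (LEAST b. \<forall>w\<in>x. w < z \<longrightarrow> c w < b)" for z
  proof -
    have "wf {(w, z::'o). w < z}" by (simp add: wf)
    from wfrec[OF this, of "\<lambda>g z. LEAST b::'o. \<forall>w\<in>x. w < z \<longrightarrow> g w < b" z]
    show ?thesis unfolding c_def[symmetric] by (simp add: cut_apply cong: conj_cong imp_cong)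
  qed
  have c_le: "c z \<le> z" for z
  proof (induction z rule: less_induct)
    case (less z)
    show ?case by (subst c_eq, rule Least_le) (use less in fastforce)
  qed
  have c_gt: "c w < c z" if "w \<in> x" "w < z" for w z
  proof -
    have "\<forall>w\<in>x. w < z \<longrightarrow> c w < z" using c_le by (meson le_less_trans)
    then have "\<forall>w\<in>x. w < z \<longrightarrow> c w < (LEAST b. \<forall>w\<in>x. w < z \<longrightarrow> c w < b)"
      by (rule LeastI)
    then show ?thesis using that by (simp only: c_eq[symmetric])
  qed
  have c_down: "\<exists>w\<in>x. w < z \<and> d \<le> c w" if "d < c z" for d z
  proof -
    have "\<not> (\<forall>w\<in>x. w < z \<longrightarrow> c w < d)"
      using not_less_Least that by (subst (asm) c_eq) blast
    then show ?thesis by auto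
  qed
  have c_img: "d \<in> c ` (x \<inter> {..<z})" if "d < c z" for d z
    using that
  proof (induction z rule: less_induct)
    case (less z)
    then obtain w where w: "w \<in> x" "w < z" "d \<le> c w" using c_down by blast
    show ?case
    proof (cases "d = c w")
      case True then show ?thesis using w by auto
    next
      case False
      then have "d \<in> c ` (x \<inter> {..<w})" using less w by auto
      then show ?thesis using w by auto
    qed
  qed
  have cimg: "c ` x = {..<c \<beta>}"
  proof
    show "c ` x \<subseteq> {..<c \<beta>}" using c_gt x by auto
    show "{..<c \<beta>} \<subseteq> c ` x" using c_img by fastforce
  qed
  have inj: "inj_on c x" by (rule linorder_inj_onI') (metis c_gt less_irrefl)
  define f where "f = inv_into x c"
  have fimg: "f ` {..<c \<beta>} = x"
    unfolding f_def cimg[symmetric] using inj by (simp add: inv_into_image_cancel)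
  have fmono: "strict_mono_on {..<c \<beta>} f"
  proof (rule strict_mono_onI)
    fix d e assume de: "d \<in> {..<c \<beta>}" "e \<in> {..<c \<beta>}" "d < e"
    then have "c (f d) = d" "c (f e) = e" "f d \<in> x" "f e \<in> x"
      unfolding cimg[symmetric] f_def by (auto intro: f_inv_into_f inv_into_into)
    then show "f d < f e" using de c_gt by (metis less_asym less_irrefl linorder_neqE)
  qed
  have "otp x = c \<beta>"
    unfolding otp_def
  proof (rule the_equality)
    show "\<exists>f. strict_mono_on {..<c \<beta>} f \<and> f ` {..<c \<beta>} = x" using fimg fmono by blast
    fix a :: 'o assume "\<exists>f. strict_mono_on {..<a} f \<and> f ` {..<a} = x"
    then show "a = c \<beta>" using le[OF _ _ fmono fimg] le[OF fmono fimg] by (auto intro: antisym)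
  qed
  then show ?thesis using that fimg fmono c_le by metis
qed

text \<open>\<open>cof\<close> minimizes order types of cofinal sets, so the increasing enumeration
  of \<open>x\<close> is defined on all of \<open>{..<cof \<beta>}\<close>.\<close>

lemma cofinal_lepoll:
  fixes x :: "'o::wellorder set"
  assumes x: "x \<subseteq> {..<\<beta>}" and "\<forall>\<gamma><\<beta>. \<exists>\<delta>\<in>x. \<gamma> \<le> \<delta>"
  shows "{..<cof \<beta>} \<lesssim> x"
proof -
  obtain f where f: "strict_mono_on {..<otp x} f" "f ` {..<otp x} = x"
    using otp_witness[OF x] .
  have "cof \<beta> \<le> otp x" unfolding cof_def by (rule Least_le) (use assms in blast)
  then have "{..<cof \<beta>} \<subseteq> {..<otp x}" by auto
  moreover have "inj_on f {..<otp x}" using f(1) by (rule strict_mono_on_imp_inj_on)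
  ultimately show ?thesis
    unfolding lepoll_def using f(2) by (metis image_mono inj_on_subset)
qed

section \<open>Sets of fewer than \<open>\<kappa>\<close> elements\<close>

locale regular_uncountable_cardinal =
  fixes \<kappa> :: "'o::wellorder"
  assumes reg: "regular_uncountable \<kappa>"
begin

lemma infinite_kappa: "infinite {..<\<kappa>}"
  using reg countable_finite unfolding regular_uncountable_def by blast

lemma infinite_UNIV: "infinite (UNIV :: 'o set)"
  by (rule infinite_super[OF subset_UNIV infinite_kappa])

lemma small_finite: "finite x \<Longrightarrow> x \<prec> {..<\<kappa>}"
  by (rule finite_lesspoll_infinite[OF infinite_kappa])

lemma lessThan_small: "\<alpha> < \<kappa> \<Longrightarrow> {..<\<alpha>} \<prec> {..<\<kappa>}"
  using reg unfolding regular_uncountable_def is_cardinal_def by blast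

lemma small_subset: "y \<prec> {..<\<kappa>} \<Longrightarrow> x \<subseteq> y \<Longrightarrow> x \<prec> {..<\<kappa>}"
  using lesspoll_trans1 subset_imp_lepoll by blast

lemma small_image: "x \<prec> {..<\<kappa>} \<Longrightarrow> f ` x \<prec> {..<\<kappa>}"
  using lesspoll_trans1 image_lepoll by blast

lemma small_Un: "x \<prec> {..<\<kappa>} \<Longrightarrow> y \<prec> {..<\<kappa>} \<Longrightarrow> x \<union> y \<prec> {..<\<kappa>}"
proof -
  \<comment> \<open>Passing to the cardinal order makes the theorem on unions of two sets below an
    infinite cardinal applicable.\<close>
  have eq: "z \<prec> w \<longleftrightarrow> ordLess2 (card_of z) (card_of w)" for z :: "'b set" and w :: "'c set"
    unfolding lesspoll_def lepoll_def eqpoll_iff_card_of_ordIso card_of_ordLeq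
    using ordLeq_iff_ordLess_or_ordIso not_ordLess_ordIso ordLess_imp_ordLeq by blast
  show "x \<prec> {..<\<kappa>} \<Longrightarrow> y \<prec> {..<\<kappa>} \<Longrightarrow> x \<union> y \<prec> {..<\<kappa>}"
    unfolding eq using infinite_kappa by (rule card_of_Un_ordLess_infinite)
qed

lemma small_cl: "x \<subseteq> {..<\<mu>} \<Longrightarrow> x \<prec> {..<\<kappa>} \<Longrightarrow> cl x \<prec> {..<\<kappa>}"
proof -
  assume x: "x \<subseteq> {..<\<mu>}" "x \<prec> {..<\<kappa>}"
  have "cl x - x \<prec> {..<\<kappa>}" using cl_new_lepoll[OF x(1)] x(2) by (rule lesspoll_trans1)
  then have "x \<union> (cl x - x) \<prec> {..<\<kappa>}" using x(2) small_Un by blast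
  then show ?thesis by (rule small_subset) auto
qed

text \<open>With \<open>\<beta> = \<kappa>\<close> this is the regularity of
  \<open>\<kappa>\<close>; for larger \<open>\<beta>\<close> of cofinality \<open>\<kappa>\<close>
  it shows that supports cannot accumulate at \<open>\<beta>\<close>.\<close>

lemma small_bounded:
  assumes "cof \<beta> = \<kappa>" "x \<subseteq> {..<\<beta>}" "x \<prec> {..<\<kappa>}"
  shows "\<exists>\<gamma><\<beta>. \<forall>\<delta>\<in>x. \<delta> < \<gamma>"
proof (rule ccontr)
  assume "\<not> ?thesis"
  then have "\<forall>\<gamma><\<beta>. \<exists>\<delta>\<in>x. \<gamma> \<le> \<delta>" by (meson not_less)
  then have "{..<\<kappa>} \<lesssim> x" using cofinal_lepoll[OF assms(2)] assms(1) by auto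
  then show False using assms(3) lesspoll_trans2 lesspoll_not_refl by blast
qed

lemma cof_kappa: "cof \<kappa> = \<kappa>"
  using reg unfolding regular_uncountable_def by blast

lemma small_bound_ordinal:
  fixes A :: "'a set"
  assumes "A \<prec> {..<\<kappa>}"
  shows "\<exists>\<gamma><\<kappa>. A \<lesssim> {..<\<gamma>}"
proof -
  obtain f where f: "inj_on f A" "f ` A \<subseteq> {..<\<kappa>}"
    using assms unfolding lesspoll_def lepoll_def by blast
  obtain \<gamma> where "\<gamma> < \<kappa>" "\<forall>\<delta>\<in>f ` A. \<delta> < \<gamma>"
    using small_bounded[OF cof_kappa f(2) small_image[OF assms]] by blast
  then show ?thesis unfolding lepoll_def using f(1) by (metis image_subsetI imageI lessThan_iff)
qed

text \<open>By regularity one \<open>m < \<kappa>\<close> bounds the number of sets and all their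
  sizes, so the union has size at most \<open>m\<close> times \<open>m\<close>.\<close>

lemma small_UN:
  fixes A :: "'i \<Rightarrow> 'a set"
  assumes I: "I \<prec> {..<\<kappa>}" and A: "\<And>i. i \<in> I \<Longrightarrow> A i \<prec> {..<\<kappa>}"
  shows "(\<Union>i\<in>I. A i) \<prec> {..<\<kappa>}"
proof -
  obtain l where l: "\<And>i. i \<in> I \<Longrightarrow> l i < \<kappa> \<and> A i \<lesssim> {..<l i}"
    using small_bound_ordinal[OF A] by metis
  obtain \<gamma> where \<gamma>: "\<gamma> < \<kappa>" "\<forall>\<delta>\<in>l ` I. \<delta> < \<gamma>"
    using small_bounded[OF cof_kappa _ small_image[OF I, of l]] l by blast
  obtain \<gamma>' where \<gamma>': "\<gamma>' < \<kappa>" "I \<lesssim> {..<\<gamma>'}" using small_bound_ordinal[OF I] by blast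
  define m where "m = max \<gamma> \<gamma>'"
  have m: "m < \<kappa>" using \<gamma> \<gamma>' unfolding m_def by simp
  have "{..<l i} \<subseteq> {..<m}" if "i \<in> I" for i
    using bspec[OF \<gamma>(2) imageI[OF that]] unfolding m_def by (simp add: less_imp_le le_max_iff_disj)
  then have Am: "A i \<lesssim> {..<m}" if "i \<in> I" for i
    using l[OF that] that lepoll_trans subset_imp_lepoll by blast
  have "{..<\<gamma>'} \<subseteq> {..<m}" unfolding m_def by auto
  then have Im: "I \<lesssim> {..<m}" using \<gamma>'(2) lepoll_trans subset_imp_lepoll by blast
  \<comment> \<open>The square of \<open>m\<close> is absorbed when \<open>m\<close> is infinite; a
    finite \<open>m\<close> makes the whole union finite.\<close>
  show ?thesis
  proof (cases "finite {..<m}")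
    case True
    then have "finite (A i)" if "i \<in> I" for i
      using Am[OF that] unfolding lepoll_def by (blast intro: inj_on_finite)
    moreover have "finite I" using Im True unfolding lepoll_def by (blast intro: inj_on_finite)
    ultimately have "finite (\<Union>i\<in>I. A i)" by blast
    then show ?thesis by (rule small_finite)
  next
    case False
    have "ordLeq3 (card_of (\<Union>i\<in>I. A i)) (card_of {..<m})"
      using False Am Im unfolding lepoll_def card_of_ordLeq
      by (intro card_of_UNION_ordLeq_infinite) blast+
    then have "(\<Union>i\<in>I. A i) \<lesssim> {..<m}" unfolding lepoll_def card_of_ordLeq .
    then show ?thesis using lessThan_small[OF m] by (rule lesspoll_trans1)
  qed
qed

lemma small_Times:
  assumes "A \<prec> {..<\<kappa>}" "B \<prec> {..<\<kappa>}"
  shows "A \<times> B \<prec> {..<\<kappa>}"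
proof -
  have "A \<times> B = (\<Union>a\<in>A. Pair a ` B)" by auto
  then show ?thesis using small_UN[OF assms(1)] small_image[OF assms(2)] by metis
qed

text \<open>Otherwise the enumeration of \<open>x\<close> has a value at position
  \<open>\<kappa>\<close>, and this element has \<open>\<kappa>\<close> many predecessors in
  \<open>x\<close>.\<close>

lemma otp_le_kappa:
  assumes x: "x \<subseteq> {..<\<beta>}" and small: "\<And>\<delta>. \<delta> \<in> x \<Longrightarrow> x \<inter> {..<\<delta>} \<prec> {..<\<kappa>}"
  shows "otp x \<le> \<kappa>"
proof (rule ccontr)
  assume "\<not> otp x \<le> \<kappa>"
  then have lt: "\<kappa> < otp x" by simp
  obtain f where f: "strict_mono_on {..<otp x} f" "f ` {..<otp x} = x"
    using otp_witness[OF x] .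
  have "f \<kappa> \<in> x" using f(2) lt by auto
  have sub: "{..<\<kappa>} \<subseteq> {..<otp x}" using lt by auto
  have "f ` {..<\<kappa>} \<subseteq> x \<inter> {..<f \<kappa>}"
    using f lt sub strict_mono_onD[OF f(1)] by fastforce
  moreover have "inj_on f {..<\<kappa>}" using strict_mono_on_imp_inj_on[OF f(1)] sub inj_on_subset by blast
  ultimately have "{..<\<kappa>} \<lesssim> x \<inter> {..<f \<kappa>}" unfolding lepoll_def by blast
  then show False using small[OF \<open>f \<kappa> \<in> x\<close>] lesspoll_trans1 lesspoll_not_refl by blast
qed

end

section \<open>Coding relations on ordinals as sets\<close>

definition vset_of :: "'o vset set \<Rightarrow> 'o vset" where
  "vset_of A = (THE v. \<forall>u. vmem u v \<longleftrightarrow> u \<in> A)"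

lemma vmem_vset_of:
  fixes A :: "'o vset set"
  assumes "A \<lesssim> (UNIV :: 'o set)"
  shows "vmem u (vset_of A) \<longleftrightarrow> u \<in> A"
proof -
  have "\<exists>!v. \<forall>u. vmem u v \<longleftrightarrow> u \<in> A"
    using vset_exists[OF assms] vset_extensional by (metis (no_types, lifting))
  from theI'[OF this] show ?thesis unfolding vset_of_def by blast
qed

lemma vset_of_eq_iff:
  fixes A B :: "'o vset set"
  assumes "A \<lesssim> (UNIV :: 'o set)" "B \<lesssim> (UNIV :: 'o set)"
  shows "vset_of A = vset_of B \<longleftrightarrow> A = B"
  using vmem_vset_of[OF assms(1)] vmem_vset_of[OF assms(2)] by auto

text \<open>The von Neumann ordinal.\<close>

function ordinal_vset :: "'o::wellorder \<Rightarrow> 'o vset" where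
  "ordinal_vset \<alpha> = vset_of (ordinal_vset ` {..<\<alpha>})"
  by auto
termination
  by (relation "{(x, y). x < y}") (auto simp: wf)

declare ordinal_vset.simps [simp del]

lemma vmem_ordinal_vset: "vmem u (ordinal_vset \<alpha>) \<longleftrightarrow> u \<in> ordinal_vset ` {..<\<alpha>}"
proof -
  have "ordinal_vset ` {..<\<alpha>} \<lesssim> (UNIV :: 'a set)"
    by (rule lepoll_trans[OF image_lepoll subset_imp_lepoll]) simp
  from vmem_vset_of[OF this] show ?thesis by (subst ordinal_vset.simps)
qed

lemma inj_ordinal_vset: "inj ordinal_vset"
proof (rule linorder_inj_onI')
  fix \<alpha> \<beta> :: 'a assume "\<alpha> < \<beta>"
  then have "vmem (ordinal_vset \<alpha>) (ordinal_vset \<beta>)" unfolding vmem_ordinal_vset by auto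
  then show "ordinal_vset \<alpha> \<noteq> ordinal_vset \<beta>"
    using wfp_vmem by (metis wfp_imp_irreflp irreflpD)
qed

text \<open>The Kuratowski pair.\<close>

definition opair :: "'o vset \<Rightarrow> 'o vset \<Rightarrow> 'o vset" where
  "opair u v = vset_of {vset_of {u}, vset_of {u, v}}"

text \<open>Turns a support and the relation "a belongs to c_b" into a set. Building it from von
  Neumann ordinals, rather than by an arbitrary injection, puts conditions with support inside
  \<open>\<kappa>\<close> into \<open>Hset \<kappa>\<close>.\<close>

definition code :: "'o::wellorder set \<times> ('o \<times> 'o) set \<Rightarrow> 'o vset" where
  "code p = opair (vset_of (ordinal_vset ` fst p))
    (vset_of ((\<lambda>(a, b). opair (ordinal_vset a) (ordinal_vset b)) ` snd p))"

context regular_uncountable_cardinal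
begin

lemma finite_lepoll_UNIV: "finite A \<Longrightarrow> A \<lesssim> (UNIV :: 'o set)"
  by (rule finite_lepoll_infinite[OF infinite_UNIV])

lemma opair_eq_iff:
  "opair u v = opair u' v' \<longleftrightarrow> u = u' \<and> v = v'" for u v :: "'o vset"
  unfolding opair_def by (auto simp: vset_of_eq_iff finite_lepoll_UNIV doubleton_eq_iff)

text \<open>The type is infinite, so pairs of ordinals are no more numerous than ordinals, and both
  components stay within the size allowed for \<open>vset_of\<close>.\<close>

lemma inj_code: "inj (code :: 'o set \<times> ('o \<times> 'o) set \<Rightarrow> 'o vset)"
proof (rule injI)
  fix p q :: "'o set \<times> ('o \<times> 'o) set"
  assume eq: "code p = code q"
  let ?h = "\<lambda>(a, b). opair (ordinal_vset a) (ordinal_vset b :: 'o vset)"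
  have 1: "ordinal_vset ` x \<lesssim> (UNIV :: 'o set)" for x :: "'o set"
    by (rule lepoll_trans[OF image_lepoll subset_imp_lepoll]) simp
  have "ordLeq3 (card_of (UNIV \<times> UNIV :: ('o \<times> 'o) set)) (card_of (UNIV :: 'o set))"
    using card_of_Times_same_infinite[OF infinite_UNIV] ordIso_imp_ordLeq by blast
  then have *: "(UNIV \<times> UNIV :: ('o \<times> 'o) set) \<lesssim> (UNIV :: 'o set)"
    unfolding lepoll_def card_of_ordLeq .
  have 2: "?h ` K \<lesssim> (UNIV :: 'o set)" for K :: "('o \<times> 'o) set"
    by (rule lepoll_trans[OF lepoll_trans[OF image_lepoll subset_imp_lepoll] *]) simp
  have inj: "inj ?h"
    by (rule injI) (auto simp: opair_eq_iff dest: injD[OF inj_ordinal_vset])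
  have "ordinal_vset ` fst p = ordinal_vset ` fst q" "?h ` snd p = ?h ` snd q"
    using eq unfolding code_def opair_eq_iff vset_of_eq_iff[OF 1 1] vset_of_eq_iff[OF 2 2] by blast+
  then show "p = q"
    unfolding inj_image_eq_iff[OF inj] inj_image_eq_iff[OF inj_ordinal_vset] by (rule prod_eqI)
qed

lemma small_lepoll_UNIV: "A \<prec> {..<\<kappa>} \<Longrightarrow> A \<lesssim> (UNIV :: 'o set)"
  using lesspoll_imp_lepoll lepoll_trans subset_imp_lepoll by (metis subset_UNIV)

text \<open>Below \<open>vset_of A\<close> lie the members of \<open>A\<close> and what lies below
  them: a union of fewer than \<open>\<kappa>\<close> sets, each of size less than
  \<open>\<kappa>\<close>.\<close>

lemma vset_of_in_Hset:
  fixes A :: "'o vset set"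
  assumes A: "A \<prec> {..<\<kappa>}" "A \<subseteq> Hset \<kappa>"
  shows "vset_of A \<in> Hset \<kappa>"
proof -
  have "{u. vmem\<^sup>+\<^sup>+ u (vset_of A)} \<subseteq> A \<union> (\<Union>a\<in>A. {u. vmem\<^sup>+\<^sup>+ u a})"
    by (auto elim: tranclp.cases simp: vmem_vset_of[OF small_lepoll_UNIV[OF A(1)]])
  moreover have "\<dots> \<prec> {..<\<kappa>}"
    using A unfolding Hset_def by (intro small_Un small_UN) auto
  ultimately show ?thesis unfolding Hset_def using small_subset by blast
qed

lemma ordinal_in_Hset: "\<alpha> < \<kappa> \<Longrightarrow> ordinal_vset \<alpha> \<in> Hset \<kappa>"
proof (induction \<alpha> rule: less_induct)
  case (less \<alpha>)
  show ?case
    by (subst ordinal_vset.simps, rule vset_of_in_Hset)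
      (use less small_image lessThan_small in auto)
qed

lemma opair_in_Hset: "u \<in> Hset \<kappa> \<Longrightarrow> v \<in> Hset \<kappa> \<Longrightarrow> opair u v \<in> Hset \<kappa>"
  unfolding opair_def by (intro vset_of_in_Hset small_finite) (auto intro!: vset_of_in_Hset small_finite)

lemma code_in_Hset:
  assumes "x \<prec> {..<\<kappa>}" "x \<subseteq> {..<\<kappa>}" "K \<subseteq> x \<times> x"
  shows "code (x, K) \<in> Hset \<kappa>"
proof -
  have "K \<prec> {..<\<kappa>}" using small_Times[OF assms(1,1)] assms(3) by (rule small_subset)
  then show ?thesis unfolding code_def
    using assms by (auto intro!: opair_in_Hset vset_of_in_Hset small_image ordinal_in_Hset)
qed

end

section \<open>Approximations to a square sequence\<close>

definition sec :: "('o \<times> 'o) set \<Rightarrow> 'o \<Rightarrow> 'o set" where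
  "sec K b = {a. (a, b) \<in> K}"

lemma mem_sec [simp]: "a \<in> sec K b \<longleftrightarrow> (a, b) \<in> K"
  by (simp add: sec_def)

text \<open>Cuts by the index \<open>b\<close> only and keeps each remaining c_b whole. In a
  condition the elements of c_b are at most \<open>b\<close>, so they survive the corresponding cut
  of the support.\<close>

definition below :: "('o \<times> 'o::ord) set \<Rightarrow> 'o \<Rightarrow> ('o \<times> 'o) set" where
  "below K \<alpha> = {(a, b) \<in> K. b < \<alpha>}"

lemma mem_below [simp]: "(a, b) \<in> below K \<alpha> \<longleftrightarrow> (a, b) \<in> K \<and> b < \<alpha>"
  by (simp add: below_def)

text \<open>The last conjunct is end-extension of c_b: nothing new enters at or below an old
  element. An empty c_b imposes no restriction.\<close>

definition extends ::
  "'o::wellorder set \<Rightarrow> ('o \<times> 'o) set \<Rightarrow> 'o set \<Rightarrow> ('o \<times> 'o) set \<Rightarrow> bool" where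
  "extends y L x K \<longleftrightarrow> x \<subseteq> y \<and> K \<subseteq> L \<and>
     (\<forall>a a' b. b \<in> x \<longrightarrow> (a, b) \<in> L \<longrightarrow> (a', b) \<in> K \<longrightarrow> a \<le> a' \<longrightarrow> (a, b) \<in> K)"

lemma extendsD:
  assumes "extends y L x K"
  shows "x \<subseteq> y" "K \<subseteq> L"
    "b \<in> x \<Longrightarrow> (a, b) \<in> L \<Longrightarrow> (a', b) \<in> K \<Longrightarrow> a \<le> a' \<Longrightarrow> (a, b) \<in> K"
proof -
  show "x \<subseteq> y" "K \<subseteq> L" using assms unfolding extends_def by simp_all
  have "\<forall>a a' b. b \<in> x \<longrightarrow> (a, b) \<in> L \<longrightarrow> (a', b) \<in> K \<longrightarrow> a \<le> a' \<longrightarrow> (a, b) \<in> K"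
    using assms unfolding extends_def by simp
  then show "b \<in> x \<Longrightarrow> (a, b) \<in> L \<Longrightarrow> (a', b) \<in> K \<Longrightarrow> a \<le> a' \<Longrightarrow> (a, b) \<in> K" by simp
qed

lemma extends_refl: "extends x K x K"
  unfolding extends_def by blast

lemma extends_trans: "extends z M y L \<Longrightarrow> extends y L x K \<Longrightarrow> extends z M x K"
proof -
  assume 1: "extends z M y L" and 2: "extends y L x K"
  note * = extendsD[OF 1] and ** = extendsD[OF 2]
  show ?thesis
    unfolding extends_def
  proof (intro conjI allI impI)
    show "x \<subseteq> z" "K \<subseteq> M" using *(1,2) **(1,2) by auto
    fix a a' b assume a: "b \<in> x" "(a, b) \<in> M" "(a', b) \<in> K" "a \<le> a'"
    have "(a, b) \<in> L" using *(3)[OF _ a(2) _ a(4)] **(1,2) a(1,3) by blast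
    then show "(a, b) \<in> K" using **(3) a by blast
  qed
qed

lemma extends_antisym: "extends y L x K \<Longrightarrow> extends x K y L \<Longrightarrow> x = y \<and> K = L"
  using extendsD(1,2) by (metis subset_antisym)

text \<open>
  When \<open>x\<close> is the support of a condition, \<open>m\<close> is the supremum of the points of \<open>x\<close> below \<open>b\<close>.
  In the limit of a decreasing sequence, distinct approximations \<open>c\<^sub>b\<close> therefore have distinct
  suprema unless they already cohere.
\<close>

definition tight :: "'o::wellorder set \<Rightarrow> ('o \<times> 'o) set \<Rightarrow> bool" where
  "tight x K \<longleftrightarrow> closed_in_sup x \<and>
     (\<forall>b\<in>x. (\<exists>a\<in>x. a < b) \<longrightarrow> (\<exists>m. (m, b) \<in> K \<and> (\<forall>a\<in>x. a < b \<longrightarrow> a \<le> m)))"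

text \<open>In a condition, the only element that can serve as \<open>m\<close> in
  \<open>tight\<close>. With no point of \<open>x\<close> below \<open>b\<close> the value is
  \<open>ozero\<close>, hence the recurring premise that there is such a point.\<close>

definition sup_below :: "'o::wellorder set \<Rightarrow> 'o \<Rightarrow> 'o" where
  "sup_below x b = osup (x \<inter> {..<b})"

lemma sup_below_le_iff: "sup_below x b \<le> c \<longleftrightarrow> (\<forall>a\<in>x. a < b \<longrightarrow> a \<le> c)"
proof -
  have "x \<inter> {..<b} \<subseteq> {..b}" by auto
  from osup_le_iff[OF this] show ?thesis unfolding sup_below_def by auto
qed

lemma sup_below_le: "sup_below x b \<le> b"
  by (simp add: sup_below_le_iff less_imp_le)

lemma le_sup_below: "a \<in> x \<Longrightarrow> a < b \<Longrightarrow> a \<le> sup_below x b"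
  using sup_below_le_iff[of x b "sup_below x b"] by blast

lemma less_sup_below: "c < sup_below x b \<Longrightarrow> \<exists>a\<in>x. a < b \<and> c < a"
  using sup_below_le_iff[of x b c] by (meson not_less)

text \<open>A supremum that is not attained is approached from below. Either way it belongs to every
  closed support \<open>x\<close> that contains \<open>b\<close>.\<close>

lemma sup_below_cases:
  assumes "\<exists>a\<in>x. a < b"
  shows "sup_below x b \<in> x \<and> sup_below x b < b \<or> limit_pt x (sup_below x b)"
proof (rule disjCI)
  assume n: "\<not> limit_pt x (sup_below x b)"
  show "sup_below x b \<in> x \<and> sup_below x b < b"
  proof (rule ccontr)
    assume *: "\<not> ?thesis"
    have lt: "a < sup_below x b" if "a \<in> x" "a < b" for a
      using le_sup_below[OF that] that * by (auto simp: le_less)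
    have "limit_pt x (sup_below x b)"
      unfolding limit_pt_iff using assms lt less_sup_below by metis
    then show False using n by simp
  qed
qed

lemma limit_pt_sup_below: "limit_pt x b \<Longrightarrow> sup_below x b = b"
  using limit_ptD le_sup_below sup_below_le by (metis leD order_le_less)

section \<open>c.o.i.'s and limit points\<close>

lemma coiD:
  assumes "coi y \<pi> \<mu>"
  shows "closed_in_sup y" "a \<in> y \<Longrightarrow> b \<in> y \<Longrightarrow> a < b \<Longrightarrow> \<pi> a < \<pi> b"
    "a \<in> y \<Longrightarrow> b \<in> y \<Longrightarrow> \<pi> a < \<pi> b \<longleftrightarrow> a < b"
    "a \<in> y \<Longrightarrow> b \<in> y \<Longrightarrow> \<pi> a \<le> \<pi> b \<longleftrightarrow> a \<le> b"
    "a \<in> y \<Longrightarrow> b \<in> y \<Longrightarrow> \<pi> a = \<pi> b \<longleftrightarrow> a = b"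
    "inj_on \<pi> y" "\<pi> ` y \<subseteq> {..<\<mu>}"
proof -
  have m: "strict_mono_on y \<pi>" using assms unfolding coi_def by blast
  show "a \<in> y \<Longrightarrow> b \<in> y \<Longrightarrow> a < b \<Longrightarrow> \<pi> a < \<pi> b" using m by (simp add: strict_mono_onD)
  show "a \<in> y \<Longrightarrow> b \<in> y \<Longrightarrow> \<pi> a < \<pi> b \<longleftrightarrow> a < b" using m by (simp add: strict_mono_on_less)
  show "a \<in> y \<Longrightarrow> b \<in> y \<Longrightarrow> \<pi> a \<le> \<pi> b \<longleftrightarrow> a \<le> b" using m by (simp add: strict_mono_on_less_eq)
  show "a \<in> y \<Longrightarrow> b \<in> y \<Longrightarrow> \<pi> a = \<pi> b \<longleftrightarrow> a = b" using m by (simp add: strict_mono_on_eq)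
  show "inj_on \<pi> y" using m by (rule strict_mono_on_imp_inj_on)
qed (use assms in \<open>auto simp: coi_def\<close>)

text \<open>Continuity is stated for limit points of the domain \<open>y\<close>. It transfers to
  \<open>x\<close> because the points of \<open>x\<close> are cofinal among those of
  \<open>y\<close> below \<open>\<delta>\<close>.\<close>

lemma coi_limit_pt:
  assumes c: "coi y \<pi> \<mu>" and x: "x \<subseteq> y" and \<delta>: "\<delta> \<in> y" and lim: "limit_pt x \<delta>"
  shows "limit_pt (\<pi> ` x) (\<pi> \<delta>)"
proof -
  have "limit_pt y \<delta>" using lim x limit_pt_mono by blast
  then have eq: "\<pi> \<delta> = osup (\<pi> ` (y \<inter> {..<\<delta>}))" using c \<delta> unfolding coi_def by blast
  have sub: "\<pi> ` (y \<inter> {..<\<delta>}) \<subseteq> {..\<pi> \<delta>}" using coiD(4)[OF c _ \<delta>] by auto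
  show ?thesis unfolding limit_pt_iff
  proof (intro conjI allI impI)
    obtain a where "a \<in> x" "a < \<delta>" using lim unfolding limit_pt_iff by blast
    then show "\<exists>\<gamma>. \<gamma> < \<pi> \<delta>" using coiD(2)[OF c _ \<delta>] x by blast
    fix \<gamma> assume "\<gamma> < \<pi> \<delta>"
    then have "\<gamma> < osup (\<pi> ` (y \<inter> {..<\<delta>}))" using eq by simp
    then obtain a where a: "a \<in> y" "a < \<delta>" "\<gamma> < \<pi> a" using less_osup_iff[OF sub] by auto
    obtain a' where a': "a' \<in> x" "a < a'" "a' < \<delta>" using limit_ptD[OF lim a(2)] by blast
    have "\<gamma> < \<pi> a'" using a(3) coiD(2)[OF c a(1) _ a'(2)] a'(1) x by (meson less_trans subsetD)
    moreover have "\<pi> a' < \<pi> \<delta>" using coiD(2)[OF c _ \<delta> a'(3)] a'(1) x by blast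
    ultimately show "\<exists>a\<in>\<pi> ` x. \<gamma> < a \<and> a < \<pi> \<delta>" using a'(1) by blast
  qed
qed

text \<open>The preimage is the supremum of the points of \<open>x\<close> mapped below
  \<open>\<gamma>\<close>. Values of \<open>\<pi>\<close> outside \<open>y\<close> mean nothing,
  hence the implication; where the lemma is applied, closedness of c_b or of the support puts
  \<open>\<delta>\<close> into \<open>y\<close>.\<close>

lemma coi_limit_pt_image:
  assumes c: "coi y \<pi> \<mu>" and x: "x \<subseteq> y" and b: "b \<in> y" "\<gamma> \<le> \<pi> b"
    and lim: "limit_pt (\<pi> ` x) \<gamma>"
  shows "\<exists>\<delta>\<le>b. limit_pt x \<delta> \<and> (\<delta> \<in> y \<longrightarrow> \<pi> \<delta> = \<gamma>)"
proof -
  define A where "A = {a \<in> x. \<pi> a < \<gamma>}"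
  define \<delta> where "\<delta> = osup A"
  have "a < b" if "a \<in> A" for a
    using that b x coiD(3)[OF c, of a b] unfolding A_def by (auto dest: less_le_trans)
  then have Ab: "A \<subseteq> {..b}" by (auto simp: less_imp_le)
  have above: "\<exists>a'\<in>A. a < a' \<and> g < \<pi> a'" if "a \<in> A" "g < \<gamma>" for a g
  proof -
    have "max g (\<pi> a) < \<gamma>" using that unfolding A_def by simp
    from limit_ptD[OF lim this] obtain a' where "a' \<in> x" "g < \<pi> a'" "\<pi> a < \<pi> a'" "\<pi> a' < \<gamma>"
      by auto
    then show ?thesis using that x coiD(3)[OF c, of a a'] unfolding A_def by auto
  qed
  have lt: "a < \<delta>" if aA: "a \<in> A" for a
  proof -
    obtain a' where "a' \<in> A" "a < a'"
      using above[OF aA, of "\<pi> a"] aA unfolding A_def by blast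
    then show ?thesis unfolding \<delta>_def less_osup_iff[OF Ab] by blast
  qed
  have ne: "\<exists>a. a \<in> A" using lim unfolding limit_pt_iff A_def by blast
  have down: "\<exists>a\<in>A. e < a" if "e < \<delta>" for e using that unfolding \<delta>_def less_osup_iff[OF Ab] .
  have lim': "limit_pt x \<delta>" unfolding limit_pt_iff
    using ne lt down unfolding A_def by blast
  have "\<delta> \<le> b" unfolding \<delta>_def osup_le_iff[OF Ab] using Ab by auto
  moreover have "\<pi> \<delta> = \<gamma>" if \<delta>: "\<delta> \<in> y"
  proof (rule antisym)
    show "\<pi> \<delta> \<le> \<gamma>"
    proof (rule leI, rule notI)
      assume "\<gamma> < \<pi> \<delta>"
      from limit_ptD[OF coi_limit_pt[OF c x \<delta> lim'] this]
      obtain a where a: "a \<in> x" "\<gamma> < \<pi> a" "\<pi> a < \<pi> \<delta>" by blast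
      then have "a < \<delta>" using coiD(3)[OF c, of a \<delta>] \<delta> x by blast
      then obtain a' where "a' \<in> A" "a < a'" using down by blast
      then have "\<pi> a < \<pi> a'" "\<pi> a' < \<gamma>" using coiD(2)[OF c, of a a'] a(1) x unfolding A_def by auto
      then show False using a(2) by auto
    qed
    show "\<gamma> \<le> \<pi> \<delta>"
    proof (rule leI, rule notI)
      assume "\<pi> \<delta> < \<gamma>"
      then obtain a where a: "a \<in> A" "\<pi> \<delta> < \<pi> a" using ne above by blast
      then have "\<pi> a < \<pi> \<delta>" using coiD(2)[OF c _ \<delta> lt[OF a(1)]] x unfolding A_def by blast
      then show False using a(2) by auto
    qed
  qed
  ultimately show ?thesis using lim' by blast
qed

section \<open>Conditions, restrictions, amalgams and greatest lower bounds\<close>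

context regular_uncountable_cardinal
begin

text \<open>
  \<open>sec K b\<close> is the approximation \<open>c\<^sub>b\<close>. That \<open>b\<close> itself belongs to \<open>c\<^sub>b\<close> marks \<open>c\<^sub>b\<close> as complete,
  since extensions only add elements at the top. Completion is allowed only when \<open>b\<close> is a limit
  point of the support, so never at ordinals of cofinality \<open>\<kappa>\<close>.
\<close>

definition cond :: "'o set \<Rightarrow> ('o \<times> 'o) set \<Rightarrow> bool" where
  "cond x K \<longleftrightarrow> x \<in> small_subsets (succ_card \<kappa>) \<kappa> \<and> K \<subseteq> x \<times> x \<and>
     (\<forall>a b. (a, b) \<in> K \<longrightarrow> a \<le> b) \<and> (\<forall>b. (b, b) \<in> K \<longrightarrow> limit_pt x b) \<and>
     (\<forall>b \<delta>. \<delta> \<le> b \<longrightarrow> limit_pt (sec K b) \<delta> \<longrightarrow> (\<delta>, b) \<in> K \<and> sec K \<delta> = sec K b \<inter> {..\<delta>})"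

lemma condI:
  assumes "x \<subseteq> {..<succ_card \<kappa>}" "x \<prec> {..<\<kappa>}"
    and "\<And>a b. (a, b) \<in> K \<Longrightarrow> a \<in> x \<and> b \<in> x \<and> a \<le> b"
    and "\<And>b. (b, b) \<in> K \<Longrightarrow> limit_pt x b"
    and "\<And>b \<delta>. b \<in> x \<Longrightarrow> \<delta> \<le> b \<Longrightarrow> limit_pt (sec K b) \<delta> \<Longrightarrow>
      (\<delta>, b) \<in> K \<and> sec K \<delta> = sec K b \<inter> {..\<delta>}"
  shows "cond x K"
proof -
  have "(\<delta>, b) \<in> K \<and> sec K \<delta> = sec K b \<inter> {..\<delta>}" if "\<delta> \<le> b" "limit_pt (sec K b) \<delta>" for b \<delta>
  proof -
    have "b \<in> x" using that(2) assms(3) unfolding limit_pt_iff by auto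
    then show ?thesis using assms(5) that by blast
  qed
  then show ?thesis unfolding cond_def small_subsets_def using assms(1-4) by auto
qed

text \<open>By closedness and coherence, a limit point \<open>\<delta>\<close> of c_b lies in its
  own set. This last rule, together with \<open>complete_sec\<close>, keeps coherence stable under
  extension.\<close>

lemma condD:
  assumes "cond x K"
  shows "x \<subseteq> {..<succ_card \<kappa>}" "x \<prec> {..<\<kappa>}" "(a, b) \<in> K \<Longrightarrow> a \<in> x"
    "(a, b) \<in> K \<Longrightarrow> b \<in> x" "(a, b) \<in> K \<Longrightarrow> a \<le> b" "(b, b) \<in> K \<Longrightarrow> limit_pt x b"
    "\<delta> \<le> b \<Longrightarrow> limit_pt (sec K b) \<delta> \<Longrightarrow> (\<delta>, b) \<in> K"
    "\<delta> \<le> b \<Longrightarrow> limit_pt (sec K b) \<delta> \<Longrightarrow> sec K \<delta> = sec K b \<inter> {..\<delta>}"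
    "\<delta> \<le> b \<Longrightarrow> limit_pt (sec K b) \<delta> \<Longrightarrow> (\<delta>, \<delta>) \<in> K"
proof -
  show 1: "\<delta> \<le> b \<Longrightarrow> limit_pt (sec K b) \<delta> \<Longrightarrow> (\<delta>, b) \<in> K"
    and 2: "\<delta> \<le> b \<Longrightarrow> limit_pt (sec K b) \<delta> \<Longrightarrow> sec K \<delta> = sec K b \<inter> {..\<delta>}"
    using assms unfolding cond_def by blast+
  show "\<delta> \<le> b \<Longrightarrow> limit_pt (sec K b) \<delta> \<Longrightarrow> (\<delta>, \<delta>) \<in> K"
    using 1 2 by (metis IntI atMost_iff mem_sec order_refl)
qed (use assms in \<open>auto simp: cond_def small_subsets_def\<close>)

lemma tight_closed:
  assumes "tight x K" "cond x K" "b \<in> x" "\<delta> \<le> b" "limit_pt x \<delta>"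
  shows "\<delta> \<in> x"
  using assms closed_in_sup_iff[OF condD(1)[OF assms(2)]] unfolding tight_def by blast

text \<open>A set containing its own index is final: end-extension admits only larger elements, and
  there is no room above \<open>\<delta>\<close>.\<close>

lemma complete_sec:
  assumes "extends y L x K" "(\<delta>, \<delta>) \<in> K" "\<delta> \<in> x" "\<And>a. (a, \<delta>) \<in> L \<Longrightarrow> a \<le> \<delta>"
  shows "sec L \<delta> = sec K \<delta>"
proof (intro subset_antisym subsetI)
  show "a \<in> sec K \<delta>" if "a \<in> sec L \<delta>" for a
    using extendsD(3)[OF assms(1,3) _ assms(2)] assms(4) that by simp
  show "a \<in> sec L \<delta>" if "a \<in> sec K \<delta>" for a
    using extendsD(2)[OF assms(1)] that by auto
qed

lemma cond_empty: "cond {} K \<longleftrightarrow> K = {}"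
  by (auto simp: cond_def small_subsets_def small_finite finite_no_limit_pt sec_def)

text \<open>New points receive the empty approximation, and limit points of the support remain limit
  points.\<close>

lemma cond_weaken:
  assumes "cond x K" "x \<subseteq> y" "y \<in> small_subsets (succ_card \<kappa>) \<kappa>"
  shows "cond y K"
proof (rule condI)
  show "limit_pt y b" if "(b, b) \<in> K" for b
    using condD(6)[OF assms(1) that] assms(2) limit_pt_mono by blast
qed (use assms condD[OF assms(1)] in \<open>auto simp: small_subsets_def\<close>)

lemma sec_below: "sec (below K \<alpha>) b = (if b < \<alpha> then sec K b else {})"
  by auto

lemma cond_below:
  assumes "cond x K"
  shows "cond (x \<inter> {..<\<alpha>}) (below K \<alpha>)"
proof (rule condI)
  show "x \<inter> {..<\<alpha>} \<subseteq> {..<succ_card \<kappa>}" using condD(1)[OF assms] by auto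
  show "x \<inter> {..<\<alpha>} \<prec> {..<\<kappa>}" using condD(2)[OF assms] by (rule small_subset) auto
  show "a \<in> x \<inter> {..<\<alpha>} \<and> b \<in> x \<inter> {..<\<alpha>} \<and> a \<le> b" if "(a, b) \<in> below K \<alpha>" for a b
    using that condD(3-5)[OF assms, of a b] by auto
  show "limit_pt (x \<inter> {..<\<alpha>}) b" if "(b, b) \<in> below K \<alpha>" for b
    using that condD(6)[OF assms, of b] by (auto elim: limit_pt_mono)
  show "(\<delta>, b) \<in> below K \<alpha> \<and> sec (below K \<alpha>) \<delta> = sec (below K \<alpha>) b \<inter> {..\<delta>}"
    if "b \<in> x \<inter> {..<\<alpha>}" "\<delta> \<le> b" "limit_pt (sec (below K \<alpha>) b) \<delta>" for b \<delta>
    using that condD(7,8)[OF assms, of \<delta> b] by (auto simp: sec_below)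
qed

lemma extends_below: "extends x K (x \<inter> {..<\<alpha>}) (below K \<alpha>)"
  unfolding extends_def by auto

lemma below_strongest:
  assumes "extends x K (x \<inter> {..<\<alpha>}) L" "cond (x \<inter> {..<\<alpha>}) L"
  shows "extends (x \<inter> {..<\<alpha>}) (below K \<alpha>) (x \<inter> {..<\<alpha>}) L"
  unfolding extends_def
proof (intro conjI allI impI subset_refl)
  show "L \<subseteq> below K \<alpha>" using extendsD(2)[OF assms(1)] condD(4)[OF assms(2)] by auto
qed (use extendsD(3)[OF assms(1)] in auto)

lemma extends_below_mono:
  "extends y L x K \<Longrightarrow> extends (y \<inter> {..<\<alpha>}) (below L \<alpha>) (x \<inter> {..<\<alpha>}) (below K \<alpha>)"
  unfolding extends_def by auto

lemma tight_below:
  assumes c: "cond x K" and t: "tight x K"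
  shows "tight (x \<inter> {..<\<alpha>}) (below K \<alpha>)"
  unfolding tight_def closed_in_sup_iff[OF condD(1)[OF cond_below[OF c]]]
proof (intro conjI ballI allI impI)
  fix b \<delta> assume b: "b \<in> x \<inter> {..<\<alpha>}" "\<delta> \<le> b" "limit_pt (x \<inter> {..<\<alpha>}) \<delta>"
  then have "limit_pt x \<delta>" by (auto elim: limit_pt_mono)
  then have "\<delta> \<in> x" using tight_closed[OF t c _ b(2)] b(1) by blast
  then show "\<delta> \<in> x \<inter> {..<\<alpha>}" using b by auto
next
  fix b assume b: "b \<in> x \<inter> {..<\<alpha>}" "\<exists>a\<in>x \<inter> {..<\<alpha>}. a < b"
  then have "\<exists>m. (m, b) \<in> K \<and> (\<forall>a\<in>x. a < b \<longrightarrow> a \<le> m)" using t unfolding tight_def by blast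
  then show "\<exists>m. (m, b) \<in> below K \<alpha> \<and> (\<forall>a\<in>x \<inter> {..<\<alpha>}. a < b \<longrightarrow> a \<le> m)" using b by auto
qed

text \<open>Whether c_b is admissible depends only on points up to \<open>b\<close>, so it can be
  checked in an initial segment containing \<open>b\<close>; only the size bound is global.\<close>

lemma cond_local:
  assumes x: "x \<subseteq> {..<succ_card \<kappa>}" "x \<prec> {..<\<kappa>}" and K: "K \<subseteq> x \<times> x"
    and loc: "\<And>b. b \<in> x \<Longrightarrow> \<exists>\<alpha>>b. cond (x \<inter> {..<\<alpha>}) (below K \<alpha>)"
  shows "cond x K"
proof (rule condI[OF x])
  show "a \<in> x \<and> b \<in> x \<and> a \<le> b" if "(a, b) \<in> K" for a b
  proof -
    have ab: "a \<in> x" "b \<in> x" using K that by auto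
    then obtain \<alpha> where \<alpha>: "b < \<alpha>" "cond (x \<inter> {..<\<alpha>}) (below K \<alpha>)" using loc by blast
    show ?thesis using condD(5)[OF \<alpha>(2), of a b] that ab \<alpha>(1) by simp
  qed
  show "limit_pt x b" if "(b, b) \<in> K" for b
  proof -
    have "b \<in> x" using K that by auto
    then obtain \<alpha> where \<alpha>: "b < \<alpha>" "cond (x \<inter> {..<\<alpha>}) (below K \<alpha>)" using loc by blast
    have "limit_pt (x \<inter> {..<\<alpha>}) b" using condD(6)[OF \<alpha>(2), of b] that \<alpha>(1) by simp
    then show ?thesis by (rule limit_pt_mono) simp
  qed
  show "(\<delta>, b) \<in> K \<and> sec K \<delta> = sec K b \<inter> {..\<delta>}"
    if b: "b \<in> x" "\<delta> \<le> b" "limit_pt (sec K b) \<delta>" for b \<delta>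
  proof -
    obtain \<alpha> where \<alpha>: "b < \<alpha>" "cond (x \<inter> {..<\<alpha>}) (below K \<alpha>)" using loc b(1) by blast
    have "\<delta> < \<alpha>" using b(2) \<alpha>(1) by auto
    then show ?thesis
      using condD(7,8)[OF \<alpha>(2), of \<delta> b] b \<alpha>(1) by (simp add: sec_below)
  qed
qed

lemma tight_local:
  assumes x: "x \<subseteq> {..<succ_card \<kappa>}"
    and loc: "\<And>b. b \<in> x \<Longrightarrow>
      \<exists>\<alpha>>b. cond (x \<inter> {..<\<alpha>}) (below K \<alpha>) \<and> tight (x \<inter> {..<\<alpha>}) (below K \<alpha>)"
  shows "tight x K"
  unfolding tight_def closed_in_sup_iff[OF x]
proof (intro conjI ballI allI impI)
  fix b \<delta> assume b: "b \<in> x" "\<delta> \<le> b" "limit_pt x \<delta>"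
  obtain \<alpha> where \<alpha>: "b < \<alpha>" "cond (x \<inter> {..<\<alpha>}) (below K \<alpha>)" "tight (x \<inter> {..<\<alpha>}) (below K \<alpha>)"
    using loc[OF b(1)] by blast
  have "limit_pt (x \<inter> {..<\<alpha>}) \<delta>" using b(3) by (rule limit_pt_mono) (use b(2) \<alpha>(1) in auto)
  then show "\<delta> \<in> x" using tight_closed[OF \<alpha>(3,2) _ b(2)] b(1) \<alpha>(1) by auto
next
  fix b assume b: "b \<in> x" "\<exists>a\<in>x. a < b"
  obtain \<alpha> where \<alpha>: "b < \<alpha>" "tight (x \<inter> {..<\<alpha>}) (below K \<alpha>)"
    using loc[OF b(1)] by blast
  have "\<exists>a\<in>x \<inter> {..<\<alpha>}. a < b" using b(2) \<alpha>(1) by fastforce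
  then have "\<exists>m. (m, b) \<in> below K \<alpha> \<and> (\<forall>a\<in>x \<inter> {..<\<alpha>}. a < b \<longrightarrow> a \<le> m)"
    using \<alpha> b(1) unfolding tight_def by blast
  then show "\<exists>m. (m, b) \<in> K \<and> (\<forall>a\<in>x. a < b \<longrightarrow> a \<le> m)"
    using \<alpha>(1) by (metis IntI lessThan_iff less_trans mem_below)
qed

text \<open>Serves \<open>amalg_unique\<close> and \<open>amalg_Q\<close>. Every stage is an initial
  segment of the union, so the local criteria apply.\<close>

lemma amalgam:
  fixes X :: "'o \<Rightarrow> 'o set"
  assumes c: "\<And>i. i \<in> I \<Longrightarrow> cond (X i) (L i)" and I: "I \<prec> {..<\<kappa>}"
    and coh: "\<And>i j. i \<in> I \<Longrightarrow> j \<in> I \<Longrightarrow> i < j \<Longrightarrow>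
      X i = X j \<inter> {..<ssup (X i)} \<and> L i = below (L j) (ssup (X i))"
  defines "x \<equiv> \<Union>i\<in>I. X i" and "K \<equiv> \<Union>i\<in>I. L i"
  shows "cond x K" and "i \<in> I \<Longrightarrow> x \<inter> {..<ssup (X i)} = X i \<and> below K (ssup (X i)) = L i"
    and "(\<And>i. i \<in> I \<Longrightarrow> tight (X i) (L i)) \<Longrightarrow> tight x K"
proof -
  have lt: "b < ssup (X i)" if "i \<in> I" "b \<in> X i" for i b
    using less_ssup_iff[OF condD(1)[OF c[OF that(1)]]] that(2) by blast
  have 1: "X j \<inter> {..<ssup (X i)} \<subseteq> X i \<and> below (L j) (ssup (X i)) \<subseteq> L i"
    if "i \<in> I" "j \<in> I" for i j
  proof (cases i j rule: linorder_cases)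
    case less then show ?thesis using coh[OF that] by blast
  next
    case equal then show ?thesis by auto
  next
    case greater
    from coh[OF that(2,1) this] have "X j \<subseteq> X i" "L j \<subseteq> L i" by (auto simp: below_def)
    then show ?thesis by auto
  qed
  show 2: "x \<inter> {..<ssup (X i)} = X i \<and> below K (ssup (X i)) = L i" if "i \<in> I" for i
  proof (intro conjI subset_antisym)
    show "x \<inter> {..<ssup (X i)} \<subseteq> X i" unfolding x_def using 1[OF that] by blast
    show "X i \<subseteq> x \<inter> {..<ssup (X i)}" unfolding x_def using lt that by blast
    show "below K (ssup (X i)) \<subseteq> L i" unfolding K_def using 1[OF that] by (auto simp: below_def subset_iff)
    show "L i \<subseteq> below K (ssup (X i))"
      unfolding K_def using lt[OF that] condD(4)[OF c[OF that]] that by auto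
  qed
  have xsub: "x \<subseteq> {..<succ_card \<kappa>}" unfolding x_def using condD(1)[OF c] by blast
  have loc: "\<exists>i\<in>I. b < ssup (X i)" if "b \<in> x" for b
    using that lt unfolding x_def by blast
  have "x \<prec> {..<\<kappa>}" unfolding x_def using I condD(2)[OF c] by (rule small_UN)
  moreover have "K \<subseteq> x \<times> x" unfolding K_def x_def using condD(3,4)[OF c] by fast
  ultimately show "cond x K" using xsub loc 2 c by (metis cond_local)
  show "tight x K" if "\<And>i. i \<in> I \<Longrightarrow> tight (X i) (L i)"
    using tight_local[OF xsub, of K] loc 2 c that by metis
qed

text \<open>Take the sets of \<open>q\<close> below \<open>\<alpha>\<close> and those of
  \<open>p\<close> from \<open>\<alpha>\<close> on. The danger is a limit point
  \<open>\<delta> < \<alpha>\<close> of some c_b with \<open>\<alpha> \<le> b\<close>, where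
  coherence compares sets from both sources. But \<open>\<delta>\<close> is complete in
  \<open>p\<close>, so \<open>q\<close> has the same set there.\<close>

lemma glb_below:
  assumes p: "cond x K" and q: "cond y L" and y: "y \<subseteq> {..<\<alpha>}"
    and le: "extends y L (x \<inter> {..<\<alpha>}) (below K \<alpha>)"
  defines "M \<equiv> L \<union> {(a, b) \<in> K. \<alpha> \<le> b}"
  shows "cond (x \<union> y) M" "extends (x \<union> y) M x K" "extends (x \<union> y) M y L"
    "\<And>z N. extends z N x K \<Longrightarrow> extends z N y L \<Longrightarrow> extends z N (x \<union> y) M"
    "(x \<union> y) \<inter> {..<\<alpha>} = y" "below M \<alpha> = L"
proof -
  note le' = extendsD[OF le]
  have Ly: "a \<in> y \<and> b \<in> y \<and> a < \<alpha> \<and> b < \<alpha>" if "(a, b) \<in> L" for a b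
    using condD(3,4)[OF q that] y by auto
  have M1: "(a, b) \<in> M \<longleftrightarrow> (a, b) \<in> L" if "b < \<alpha>" for a b using that unfolding M_def by auto
  have M2: "(a, b) \<in> M \<longleftrightarrow> (a, b) \<in> K" if "\<alpha> \<le> b" for a b
    using that Ly unfolding M_def by (auto simp: not_less[symmetric])
  have sec1: "sec M b = sec L b" if "b < \<alpha>" for b using M1[OF that] by auto
  have sec2: "sec M b = sec K b" if "\<alpha> \<le> b" for b using M2[OF that] by auto
  have KL: "sec L \<delta> = sec K \<delta>" if "(\<delta>, \<delta>) \<in> K" "\<delta> < \<alpha>" for \<delta>
    using complete_sec[OF le, of \<delta>] that condD(3)[OF p that(1)] condD(5)[OF q]
    by (auto simp: sec_below)
  show "cond (x \<union> y) M"
  proof (rule condI)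
    show "x \<union> y \<subseteq> {..<succ_card \<kappa>}" using condD(1)[OF p] condD(1)[OF q] by auto
    show "x \<union> y \<prec> {..<\<kappa>}" using condD(2)[OF p] condD(2)[OF q] by (rule small_Un)
    show "a \<in> x \<union> y \<and> b \<in> x \<union> y \<and> a \<le> b" if "(a, b) \<in> M" for a b
      using that condD(3-5)[OF p, of a b] condD(3-5)[OF q, of a b] unfolding M_def by auto
    show "limit_pt (x \<union> y) b" if "(b, b) \<in> M" for b
    proof -
      have "limit_pt x b \<or> limit_pt y b"
        using that condD(6)[OF p, of b] condD(6)[OF q, of b] unfolding M_def by auto
      then show ?thesis by (auto elim: limit_pt_mono)
    qed
    show "(\<delta>, b) \<in> M \<and> sec M \<delta> = sec M b \<inter> {..\<delta>}"
      if b: "b \<in> x \<union> y" "\<delta> \<le> b" "limit_pt (sec M b) \<delta>" for b \<delta>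
    proof (cases "b < \<alpha>")
      case True
      then have "\<delta> < \<alpha>" using b(2) by auto
      then show ?thesis using condD(7,8)[OF q b(2)] b(3) by (simp add: sec1 M1 True)
    next
      case False
      then have lim: "limit_pt (sec K b) \<delta>" using b(3) sec2 by simp
      note c = condD(7-9)[OF p b(2) lim]
      have "sec M \<delta> = sec K \<delta>"
        using KL[OF c(3)] sec1[of \<delta>] sec2[of \<delta>] by (cases "\<delta> < \<alpha>") auto
      then show ?thesis using c False by (simp add: sec2 M2)
    qed
  qed
  show "extends (x \<union> y) M y L"
    unfolding extends_def using y M1 unfolding M_def by blast
  show "extends (x \<union> y) M x K"
    unfolding extends_def
  proof (intro conjI allI impI)
    show "K \<subseteq> M" unfolding M_def using le'(2) by (force simp: below_def)
    fix a a' b assume *: "b \<in> x" "(a, b) \<in> M" "(a', b) \<in> K" "a \<le> a'"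
    show "(a, b) \<in> K"
    proof (cases "b < \<alpha>")
      case True
      then show ?thesis using le'(3)[of b a a'] * M1 by simp
    next
      case False
      then show ?thesis using * M2 by simp
    qed
  qed simp
  show "extends z N (x \<union> y) M" if zx: "extends z N x K" and zy: "extends z N y L" for z N
    unfolding extends_def
  proof (intro conjI allI impI)
    show "x \<union> y \<subseteq> z" "M \<subseteq> N"
      using extendsD(1,2)[OF zx] extendsD(1,2)[OF zy] unfolding M_def by auto
    fix a a' b assume *: "b \<in> x \<union> y" "(a, b) \<in> N" "(a', b) \<in> M" "a \<le> a'"
    show "(a, b) \<in> M"
    proof (cases "b < \<alpha>")
      case True
      then have "b \<in> y" "(a', b) \<in> L" using * le'(1) M1 by auto
      then show ?thesis using extendsD(3)[OF zy _ *(2) _ *(4)] M1 True by simp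
    next
      case False
      then have "b \<in> x" "(a', b) \<in> K" using * y M2 by auto
      then show ?thesis using extendsD(3)[OF zx _ *(2) _ *(4)] M2 False by simp
    qed
  qed
  show "(x \<union> y) \<inter> {..<\<alpha>} = y" using y le'(1) by auto
  show "below M \<alpha> = L" using Ly unfolding M_def below_def by auto
qed

text \<open>Close the support and add to each c_b one element at the top, the supremum of the new
  support below \<open>b\<close>. A single top element creates no limit point, so coherence has to
  be checked only at limit points of the old sets.\<close>

lemma tight_extension:
  assumes c: "cond x K"
  shows "\<exists>L. cond (cl x) L \<and> tight (cl x) L \<and> extends (cl x) L x K"
proof -
  note x = condD(1)[OF c]
  note clx = cl_subset[OF x]
  define y where "y = cl x"
  define L where "L = K \<union> {(sup_below y b, b) |b. b \<in> y \<and> (\<exists>a\<in>y. a < b)}"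
  have xy: "x \<subseteq> y" unfolding y_def using cl_iff[OF x] by auto
  have closed: "\<delta> \<in> y" if "b \<in> y" "\<delta> \<le> b" "limit_pt y \<delta>" for b \<delta>
    using cl_closed[OF x] that unfolding closed_in_sup_iff[OF clx] y_def by blast
  have lim_x: "limit_pt x \<delta>" if "limit_pt y \<delta>" for \<delta>
    using limit_pt_cl[OF x] that unfolding y_def by blast
  \<comment> \<open>The added element is really on top: elements of c_b other than \<open>b\<close>
    lie in the support below \<open>b\<close>, and \<open>b\<close> itself occurs only when the
    supremum is \<open>b\<close>.\<close>
  have K_le: "a \<le> sup_below y b \<and> (\<exists>a\<in>y. a < b)" if ab: "(a, b) \<in> K" for a b
  proof (cases "a = b")
    case True
    then have "limit_pt x b" using condD(6)[OF c] ab by simp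
    then have "limit_pt y b" by (rule limit_pt_mono) (use xy in blast)
    then have "sup_below y b = b" "\<exists>a\<in>y. a < b"
      using limit_pt_sup_below unfolding limit_pt_iff by blast+
    then show ?thesis using True by simp
  next
    case False
    then have "a < b" "a \<in> y" using condD(3,5)[OF c ab] xy by auto
    then show ?thesis using le_sup_below by blast
  qed
  have L_le: "a \<le> sup_below y b \<and> b \<in> y \<and> (\<exists>a\<in>y. a < b)" if "(a, b) \<in> L" for a b
    using that K_le[of a b] condD(4)[OF c, of a b] xy unfolding L_def by auto
  have below_K: "(a, b) \<in> K" if "(a, b) \<in> L" "a < sup_below y b" for a b
    using that unfolding L_def by auto
  have lim_K: "limit_pt (sec K b) \<delta>" "\<delta> \<le> sup_below y b" if lim: "limit_pt (sec L b) \<delta>" for b \<delta>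
  proof -
    show *: "\<delta> \<le> sup_below y b"
    proof (rule leI, rule notI)
      assume "sup_below y b < \<delta>"
      from limit_ptD[OF lim this] show False using L_le by (auto simp: not_less[symmetric])
    qed
    show "limit_pt (sec K b) \<delta>"
      using lim by (rule limit_pt_mono) (use * below_K in auto)
  qed
  have "cond y L"
  proof (rule condI)
    show "y \<subseteq> {..<succ_card \<kappa>}" unfolding y_def by (rule clx)
    show "y \<prec> {..<\<kappa>}" unfolding y_def using x condD(2)[OF c] by (rule small_cl)
    show "a \<in> y \<and> b \<in> y \<and> a \<le> b" if ab: "(a, b) \<in> L" for a b
    proof (cases "(a, b) \<in> K")
      case True then show ?thesis using condD(3-5)[OF c True] xy by auto
    next
      case False
      then have *: "a = sup_below y b" "b \<in> y" "\<exists>a\<in>y. a < b" using ab unfolding L_def by auto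
      then show ?thesis
        using sup_below_cases[OF *(3)] closed[OF *(2) sup_below_le] sup_below_le by blast
    qed
    show "limit_pt y b" if "(b, b) \<in> L" for b
    proof -
      from L_le[OF that] have "b = sup_below y b" "\<exists>a\<in>y. a < b"
        using sup_below_le by (auto intro: antisym)
      then show ?thesis using sup_below_cases[of y b] by auto
    qed
    show "(\<delta>, b) \<in> L \<and> sec L \<delta> = sec L b \<inter> {..\<delta>}"
      if b: "b \<in> y" "\<delta> \<le> b" "limit_pt (sec L b) \<delta>" for b \<delta>
    proof -
      note lim = lim_K[OF b(3)]
      note d = condD(7-9)[OF c b(2) lim(1)]
      have 1: "limit_pt y \<delta>" using condD(6)[OF c d(3)] by (rule limit_pt_mono) (use xy in blast)
      \<comment> \<open>The element added at \<open>\<delta>\<close> is \<open>\<delta>\<close>,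
        already present by completeness.\<close>
      have 2: "sec L \<delta> = sec K \<delta>"
        using d(3) limit_pt_sup_below[OF 1] unfolding L_def by auto
      have 3: "sec L b \<inter> {..\<delta>} = sec K b \<inter> {..\<delta>}"
        using lim(2) d(1) unfolding L_def by auto
      show ?thesis using d 2 3 unfolding L_def by simp
    qed
  qed
  moreover have "tight y L"
    unfolding tight_def
  proof (intro conjI ballI impI)
    show "closed_in_sup y" unfolding y_def by (rule cl_closed[OF x])
    fix b assume "b \<in> y" "\<exists>a\<in>y. a < b"
    then show "\<exists>m. (m, b) \<in> L \<and> (\<forall>a\<in>y. a < b \<longrightarrow> a \<le> m)"
      unfolding L_def using le_sup_below by blast
  qed
  moreover have "extends y L x K"
    unfolding extends_def
  proof (intro conjI allI impI)
    fix a a' b assume *: "b \<in> x" "(a, b) \<in> L" "(a', b) \<in> K" "a \<le> a'"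
    show "(a, b) \<in> K"
      using below_K[OF *(2)] K_le[OF *(3)] L_le[OF *(2)] *(3,4)
      by (metis le_less_trans leI le_less order_antisym)
  qed (use xy in \<open>auto simp: L_def\<close>)
  ultimately show ?thesis unfolding y_def by blast
qed

section \<open>Images of conditions under c.o.i.'s\<close>

lemma sec_image:
  assumes "inj_on \<pi> y" "K \<subseteq> y \<times> y" "b \<in> y"
  shows "sec (map_prod \<pi> \<pi> ` K) (\<pi> b) = \<pi> ` sec K b"
  using assms by (force simp: inj_on_eq_iff)

text \<open>Besides the size bound, a condition is restricted only through order and limit points. A
  limit point of the image of c_b is pulled back to one of c_b, which closedness places in the
  domain of \<open>\<pi>\<close>.\<close>

lemma cond_image:
  assumes c: "coi y \<pi> (succ_card \<kappa>)" and x: "x \<subseteq> y" and p: "cond x K"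
  shows "cond (\<pi> ` x) (map_prod \<pi> \<pi> ` K)"
proof (rule condI)
  have K: "K \<subseteq> y \<times> y" using condD(3,4)[OF p] x by auto
  note sec = sec_image[OF coiD(6)[OF c] K]
  show "\<pi> ` x \<subseteq> {..<succ_card \<kappa>}" using coiD(7)[OF c] x by blast
  show "\<pi> ` x \<prec> {..<\<kappa>}" using condD(2)[OF p] by (rule small_image)
  show "a \<in> \<pi> ` x \<and> b \<in> \<pi> ` x \<and> a \<le> b" if ab: "(a, b) \<in> map_prod \<pi> \<pi> ` K" for a b
  proof -
    obtain a' b' where *: "(a', b') \<in> K" "a = \<pi> a'" "b = \<pi> b'" using ab by auto
    then show ?thesis using condD(3-5)[OF p *(1)] coiD(4)[OF c, of a' b'] x by auto
  qed
  show "limit_pt (\<pi> ` x) b" if b: "(b, b) \<in> map_prod \<pi> \<pi> ` K" for b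
  proof -
    obtain a' b' where *: "(a', b') \<in> K" "b = \<pi> a'" "b = \<pi> b'" using b by auto
    then have "a' = b'" using coiD(5)[OF c, of a' b'] K by auto
    then show ?thesis using coi_limit_pt[OF c x, of b'] condD(4,6)[OF p] * x by blast
  qed
  show "(\<delta>, b) \<in> map_prod \<pi> \<pi> ` K \<and>
      sec (map_prod \<pi> \<pi> ` K) \<delta> = sec (map_prod \<pi> \<pi> ` K) b \<inter> {..\<delta>}"
    if b: "b \<in> \<pi> ` x" "\<delta> \<le> b" "limit_pt (sec (map_prod \<pi> \<pi> ` K) b) \<delta>" for b \<delta>
  proof -
    obtain b' where b': "b = \<pi> b'" "b' \<in> x" using b(1) by blast
    have b'y: "b' \<in> y" using b'(2) x by blast
    have sub: "sec K b' \<subseteq> y" using K by auto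
    have lim: "limit_pt (\<pi> ` sec K b') \<delta>" using b(3) sec[OF b'y] b'(1) by simp
    obtain d where d: "d \<le> b'" "limit_pt (sec K b') d" "d \<in> y \<longrightarrow> \<pi> d = \<delta>"
      using coi_limit_pt_image[OF c sub b'y _ lim] b(2) b'(1) by blast
    note D = condD(7-9)[OF p d(1,2)]
    have dy: "d \<in> y" using condD(3)[OF p D(1)] x by blast
    then have \<delta>: "\<delta> = \<pi> d" using d(3) by simp
    have "\<pi> ` (sec K b' \<inter> {..d}) = \<pi> ` sec K b' \<inter> {..\<pi> d}"
      using coiD(4)[OF c _ dy] sub by auto
    then have "sec (map_prod \<pi> \<pi> ` K) \<delta> = sec (map_prod \<pi> \<pi> ` K) b \<inter> {..\<delta>}"
      using sec[OF b'y] sec[OF dy] D(2) unfolding \<delta> b'(1) by simp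
    moreover have "(\<delta>, b) \<in> map_prod \<pi> \<pi> ` K" using D(1) unfolding \<delta> b'(1) by force
    ultimately show ?thesis by blast
  qed
qed

lemma tight_image:
  assumes c: "coi y \<pi> (succ_card \<kappa>)" and x: "x \<subseteq> y" and p: "cond x K" and t: "tight x K"
  shows "tight (\<pi> ` x) (map_prod \<pi> \<pi> ` K)"
  unfolding tight_def closed_in_sup_iff[OF condD(1)[OF cond_image[OF c x p]]]
proof (intro conjI ballI allI impI)
  fix b \<delta> assume b: "b \<in> \<pi> ` x" "\<delta> \<le> b" "limit_pt (\<pi> ` x) \<delta>"
  then obtain b' where b': "b = \<pi> b'" "b' \<in> x" by blast
  then obtain d where d: "d \<le> b'" "limit_pt x d" "d \<in> y \<longrightarrow> \<pi> d = \<delta>"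
    using coi_limit_pt_image[OF c x _ _ b(3)] b(2) x by blast
  then have "d \<in> x" using tight_closed[OF t p b'(2)] by blast
  then show "\<delta> \<in> \<pi> ` x" using d(3) x by blast
next
  fix b assume b: "b \<in> \<pi> ` x" "\<exists>a\<in>\<pi> ` x. a < b"
  then obtain b' a' where b': "b = \<pi> b'" "b' \<in> x" "a' \<in> x" "\<pi> a' < \<pi> b'" by blast
  then have "a' < b'" using coiD(3)[OF c, of a' b'] x by blast
  then obtain m where m: "(m, b') \<in> K" "\<forall>a\<in>x. a < b' \<longrightarrow> a \<le> m"
    using t b' unfolding tight_def by blast
  have y: "m \<in> y" "b' \<in> y" using condD(3)[OF p m(1)] b'(2) x by auto
  have "\<pi> a \<le> \<pi> m" if a: "a \<in> x" "\<pi> a < \<pi> b'" for a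
  proof -
    have "a \<in> y" using a(1) x by blast
    then show ?thesis using a m(2) coiD(3)[OF c _ y(2), of a] coiD(4)[OF c _ y(1), of a] by simp
  qed
  then have "\<forall>a\<in>\<pi> ` x. a < b \<longrightarrow> a \<le> \<pi> m" using b'(1) by blast
  moreover have "(\<pi> m, b) \<in> map_prod \<pi> \<pi> ` K" using m(1) b'(1) map_prod_imageI[OF m(1)] by simp
  ultimately show "\<exists>m. (m, b) \<in> map_prod \<pi> \<pi> ` K \<and> (\<forall>a\<in>\<pi> ` x. a < b \<longrightarrow> a \<le> m)"
    by (intro exI conjI)
qed

lemma extends_image:
  assumes c: "coi y \<pi> \<mu>" and x: "x \<subseteq> y" "x' \<subseteq> y" and K: "K \<subseteq> x \<times> x" "K' \<subseteq> x' \<times> x'"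
  shows "extends (\<pi> ` x') (map_prod \<pi> \<pi> ` K') (\<pi> ` x) (map_prod \<pi> \<pi> ` K) \<longleftrightarrow> extends x' K' x K"
proof -
  have inj: "inj_on (map_prod \<pi> \<pi>) (y \<times> y)" using coiD(6)[OF c] by (simp add: map_prod_inj_on)
  have mem: "(\<pi> a, \<pi> b) \<in> map_prod \<pi> \<pi> ` N \<longleftrightarrow> (a, b) \<in> N"
    if "N \<subseteq> y \<times> y" "a \<in> y" "b \<in> y" for N a b
    using inj_on_image_mem_iff[OF inj _ that(1), of "(a, b)"] that by simp
  note inj
  moreover have Ky: "K \<subseteq> y \<times> y" "K' \<subseteq> y \<times> y" using K x by auto
  ultimately have "map_prod \<pi> \<pi> ` K \<subseteq> map_prod \<pi> \<pi> ` K' \<longleftrightarrow> K \<subseteq> K'"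
    by (metis image_mono inj_on_image_Int inf.absorb_iff1 inj_on_image_eq_iff le_infI1)
  moreover have "\<pi> ` x \<subseteq> \<pi> ` x' \<longleftrightarrow> x \<subseteq> x'"
    using coiD(6)[OF c] x
    by (metis image_mono inj_on_image_Int inf.absorb_iff1 inj_on_image_eq_iff le_infI1)
  moreover have "(\<forall>a a' b. b \<in> \<pi> ` x \<longrightarrow> (a, b) \<in> map_prod \<pi> \<pi> ` K' \<longrightarrow>
      (a', b) \<in> map_prod \<pi> \<pi> ` K \<longrightarrow> a \<le> a' \<longrightarrow> (a, b) \<in> map_prod \<pi> \<pi> ` K) \<longleftrightarrow>
    (\<forall>a a' b. b \<in> x \<longrightarrow> (a, b) \<in> K' \<longrightarrow> (a', b) \<in> K \<longrightarrow> a \<le> a' \<longrightarrow> (a, b) \<in> K)"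
    (is "?l \<longleftrightarrow> ?r")
  proof
    assume l: ?l
    show ?r
    proof (intro allI impI)
      fix a a' b assume *: "b \<in> x" "(a, b) \<in> K'" "(a', b) \<in> K" "a \<le> a'"
      then have y: "a \<in> y" "a' \<in> y" "b \<in> y" using Ky by auto
      show "(a, b) \<in> K"
        using l[rule_format, of "\<pi> b" "\<pi> a" "\<pi> a'"] * y mem[OF Ky(1)] mem[OF Ky(2)] coiD(4)[OF c]
        by auto
    qed
  next
    assume r: ?r
    show ?l
    proof (intro allI impI)
      fix a a' b assume *: "b \<in> \<pi> ` x" "(a, b) \<in> map_prod \<pi> \<pi> ` K'" "(a', b) \<in> map_prod \<pi> \<pi> ` K" "a \<le> a'"
      obtain u v where uv: "a = \<pi> u" "b = \<pi> v" "(u, v) \<in> K'" using *(2) by auto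
      obtain u' v' where uv': "a' = \<pi> u'" "b = \<pi> v'" "(u', v') \<in> K" using *(3) by auto
      have y: "u \<in> y" "v \<in> y" "u' \<in> y" "v' \<in> y" using uv uv' Ky by auto
      have "v = v'" "u \<le> u'" using uv uv' *(4) y coiD(4,5)[OF c] by auto
      moreover have "v' \<in> x" using uv'(3) K(1) by auto
      ultimately have "(u, v) \<in> K" using r uv uv' by blast
      then show "(a, b) \<in> map_prod \<pi> \<pi> ` K" using uv by force
    qed
  qed
  ultimately show ?thesis unfolding extends_def by simp
qed

end

section \<open>Lower bounds of decreasing sequences\<close>

text \<open>The data of \<open>Q_lower_bound\<close>: a decreasing sequence of tight conditions
  \<open>(X i, L i)\<close> and a lower bound \<open>(z, R)\<close> of their restrictions to
  \<open>\<alpha>\<close>. The lower bound of the whole sequence will be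
  \<open>(w, K)\<close>.\<close>

locale lower_bound_construction = regular_uncountable_cardinal \<kappa> for \<kappa> :: "'o::wellorder" +
  fixes I :: "'o set" and X :: "'o \<Rightarrow> 'o set" and L :: "'o \<Rightarrow> ('o \<times> 'o) set"
    and \<alpha> :: 'o and z :: "'o set" and R :: "('o \<times> 'o) set"
  assumes I: "I \<prec> {..<\<kappa>}"
    and c: "i \<in> I \<Longrightarrow> cond (X i) (L i)"
    and t: "i \<in> I \<Longrightarrow> tight (X i) (L i)"
    and dec: "i \<in> I \<Longrightarrow> j \<in> I \<Longrightarrow> i < j \<Longrightarrow> extends (X j) (L j) (X i) (L i)"
    and cz: "cond z R" and tz: "tight z R"
    and z_sub: "z \<subseteq> {..<ssup ((\<Union>i\<in>I. X i) \<inter> {..<\<alpha>})}"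
    and z_ext: "i \<in> I \<Longrightarrow> extends z R (X i \<inter> {..<\<alpha>}) (below (L i) \<alpha>)"
begin

definition x :: "'o set" where "x = (\<Union>i\<in>I. X i)"
definition \<sigma> :: 'o where "\<sigma> = ssup (x \<inter> {..<\<alpha>})"
definition w :: "'o set" where "w = cl (z \<union> x)"
text \<open>Equals \<open>b\<close> on \<open>x\<close>, so that one formula in \<open>K\<close>
  covers old and new points.\<close>

definition next_pt :: "'o \<Rightarrow> 'o" where "next_pt b = (LEAST n. n \<in> x \<and> b \<le> n)"
text \<open>The union of the approximations at \<open>b\<close>, closed off by the supremum of the
  old points below \<open>b\<close>. Without that element the union might omit its own limit, and
  tightness could fail.\<close>

definition S :: "'o \<Rightarrow> 'o set" where
  "S b = {a. (\<exists>i\<in>I. (a, b) \<in> L i) \<or> (\<exists>e\<in>x. e < b) \<and> a = sup_below x b}"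
text \<open>
  Above \<open>\<sigma>\<close>, a new limit point \<open>b\<close> receives the same set as the least old point above it: by
  tightness \<open>b\<close> is the supremum of the approximations at that point.
\<close>

definition K :: "('o \<times> 'o) set" where
  "K = R \<union> {(a, b). b \<in> w \<and> \<sigma> \<le> b \<and> a \<in> S (next_pt b)}"

lemma x_bounded: "x \<subseteq> {..<succ_card \<kappa>}"
  unfolding x_def using condD(1)[OF c] by blast

lemma zx_bounded: "z \<union> x \<subseteq> {..<succ_card \<kappa>}"
  using x_bounded condD(1)[OF cz] by blast

lemma x_below: "x \<inter> {..<\<sigma>} = x \<inter> {..<\<alpha>}"
  unfolding \<sigma>_def by (rule ssup_Int_less[OF x_bounded])

lemma less_\<sigma>: "a < \<sigma> \<longleftrightarrow> (\<exists>e\<in>x. e < \<sigma> \<and> a \<le> e)"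
proof -
  have "x \<inter> {..<\<alpha>} \<subseteq> {..<succ_card \<kappa>}" using x_bounded by auto
  from less_ssup_iff[OF this] have "a < \<sigma> \<longleftrightarrow> (\<exists>e\<in>x \<inter> {..<\<alpha>}. a \<le> e)" unfolding \<sigma>_def .
  then show ?thesis unfolding x_below[symmetric] by auto
qed

lemma z_less: "a \<in> z \<Longrightarrow> a < \<sigma>"
  using z_sub unfolding \<sigma>_def x_def by auto

lemma x_z: "a \<in> x \<Longrightarrow> a < \<sigma> \<Longrightarrow> a \<in> z"
proof -
  assume "a \<in> x" "a < \<sigma>"
  then have "a \<in> x \<inter> {..<\<alpha>}" using x_below by auto
  then show "a \<in> z" unfolding x_def using extendsD(1)[OF z_ext] by blast
qed

lemma mono: "i \<in> I \<Longrightarrow> j \<in> I \<Longrightarrow> i \<le> j \<Longrightarrow> extends (X j) (L j) (X i) (L i)"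
  using dec extends_refl by (cases "i = j") auto

lemma w_iff: "a \<in> w \<longleftrightarrow> a \<in> z \<union> x \<or> limit_pt (z \<union> x) a \<and> (\<exists>b\<in>z \<union> x. a < b)"
  unfolding w_def by (rule cl_iff[OF zx_bounded])

text \<open>From \<open>\<sigma>\<close> on, points of \<open>z\<close> do not affect suprema: each
  is dominated by an old point below \<open>\<sigma>\<close>.\<close>

lemma zx_below: "e \<in> z \<union> x \<Longrightarrow> e < b \<Longrightarrow> \<sigma> \<le> b \<Longrightarrow> \<exists>a\<in>x. a < b \<and> e \<le> a"
proof -
  assume e: "e \<in> z \<union> x" "e < b" and b: "\<sigma> \<le> b"
  show "\<exists>a\<in>x. a < b \<and> e \<le> a"
  proof (cases "e \<in> x")
    case False
    then obtain a where "a \<in> x" "a < \<sigma>" "e \<le> a" using e z_less[of e] less_\<sigma>[of e] by auto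
    then show ?thesis using b less_le_trans by blast
  qed (use e in blast)
qed

text \<open>A limit point below \<open>\<sigma>\<close> is a limit of \<open>z\<close> and lies at
  or below an old point, which is in \<open>z\<close>; since \<open>z\<close> is closed, nothing is
  added there. This makes the result restrict to the prescribed condition.\<close>

lemma w_below: "w \<inter> {..<\<sigma>} = z"
proof (intro subset_antisym subsetI)
  fix a assume a: "a \<in> w \<inter> {..<\<sigma>}"
  show "a \<in> z"
  proof (cases "a \<in> z \<union> x")
    case True then show ?thesis using x_z a by auto
  next
    case False
    then have "limit_pt (z \<union> x) a" using a w_iff by auto
    then have lim: "limit_pt z a" by (rule limit_pt_mono) (use x_z a in auto)
    obtain e where "e \<in> x" "e < \<sigma>" "a \<le> e" using less_\<sigma>[of a] a by auto
    then show ?thesis using tight_closed[OF tz cz x_z _ lim] by blast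
  qed
next
  show "a \<in> w \<inter> {..<\<sigma>}" if "a \<in> z" for a using that z_less w_iff by auto
qed

lemma w_sub: "a \<in> w \<Longrightarrow> e < a \<Longrightarrow> \<exists>b\<in>z \<union> x. e < b \<and> b \<le> a"
  unfolding w_iff using limit_ptD less_imp_le order_refl by metis

text \<open>By the third rule no old point lies at or above \<open>b\<close> and below
  \<open>next_pt b\<close>, so the two have the same old predecessors.\<close>

lemma next_pt:
  assumes "b \<in> w" "\<sigma> \<le> b"
  shows "next_pt b \<in> x" "b \<le> next_pt b" "e \<in> x \<Longrightarrow> e < next_pt b \<Longrightarrow> e < b"
proof -
  have "b \<notin> z" using z_less assms(2) by (meson leD)
  moreover have "e \<in> x" if "e \<in> z \<union> x" "b < e" for e using that z_less assms(2) by force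
  ultimately have "\<exists>n. n \<in> x \<and> b \<le> n" using assms(1) unfolding w_iff by force
  then have "next_pt b \<in> x \<and> b \<le> next_pt b" unfolding next_pt_def by (rule LeastI_ex)
  then show "next_pt b \<in> x" "b \<le> next_pt b" by auto
  show "e < b" if e: "e \<in> x" "e < next_pt b"
    using not_less_Least[OF e(2)[unfolded next_pt_def]] e(1) by auto
qed

lemma next_pt_eq: "b \<in> x \<Longrightarrow> next_pt b = b"
  unfolding next_pt_def by (rule Least_equality) auto

section \<open>The limit sets along the sequence\<close>

lemma S_le:
  assumes "a \<in> S b"
  shows "a \<le> sup_below x b" "\<exists>e\<in>x. e < b"
proof -
  have "a \<le> sup_below x b \<and> (\<exists>e\<in>x. e < b)" if i: "i \<in> I" "(a, b) \<in> L i" for i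
  proof (cases "a = b")
    case True
    then have "limit_pt (X i) b" using condD(6)[OF c[OF i(1)]] i(2) by simp
    then have "limit_pt x b" by (rule limit_pt_mono) (use i(1) x_def in auto)
    then have "sup_below x b = b" "\<exists>e\<in>x. e < b"
      using limit_pt_sup_below unfolding limit_pt_iff by blast+
    then show ?thesis using True by simp
  next
    case False
    then have "a < b" "a \<in> x" using condD(3,5)[OF c[OF i(1)] i(2)] i(1) unfolding x_def by auto
    then show ?thesis using le_sup_below by blast
  qed
  then show "a \<le> sup_below x b" "\<exists>e\<in>x. e < b" using assms unfolding S_def by auto
qed

lemma L_S: "i \<in> I \<Longrightarrow> (a, b) \<in> L i \<Longrightarrow> a \<in> S b"
  unfolding S_def by blast

text \<open>End-extension of each stage by \<open>S b\<close>. Elements from later stages are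
  handled by the order, those from earlier stages by inclusion, and the added supremum is at most
  \<open>m\<close> only if it equals \<open>m\<close>.\<close>

lemma S_L:
  assumes i: "i \<in> I" "b \<in> X i" "(m, b) \<in> L i" and a: "a \<in> S b" "a \<le> m"
  shows "(a, b) \<in> L i"
proof -
  consider j where "j \<in> I" "(a, b) \<in> L j" | "a = sup_below x b" using a(1) unfolding S_def by blast
  then show ?thesis
  proof cases
    case 1
    show ?thesis
    proof (cases "i \<le> j")
      case True
      show ?thesis using extendsD(3)[OF mono[OF i(1) 1(1) True] i(2) 1(2) i(3) a(2)] .
    next
      case False
      then show ?thesis using extendsD(2)[OF mono[OF 1(1) i(1)]] 1(2) by (meson linear subsetD)
    qed
  next
    case 2
    then have "a = m" using a(2) S_le(1)[OF L_S[OF i(1,3)]] by simp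
    then show ?thesis using i(3) by simp
  qed
qed

text \<open>Since the stages are linearly ordered, one of them contains both \<open>b\<close> and
  \<open>e\<close>; its tightness provides \<open>m\<close>.\<close>

lemma S_unbounded:
  assumes "b \<in> x" "e \<in> x" "e < b"
  shows "\<exists>i\<in>I. b \<in> X i \<and> (\<exists>m. (m, b) \<in> L i \<and> e \<le> m)"
proof -
  obtain i j where ij: "i \<in> I" "j \<in> I" "b \<in> X i" "e \<in> X j" using assms unfolding x_def by blast
  obtain k where k: "k \<in> I" "b \<in> X k" "e \<in> X k"
  proof (cases "i \<le> j")
    case True
    then show ?thesis using that[OF ij(2)] extendsD(1)[OF mono[OF ij(1,2)]] ij by blast
  next
    case False
    then have "j \<le> i" by simp
    then show ?thesis using that[OF ij(1)] extendsD(1)[OF mono[OF ij(2,1)]] ij by blast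
  qed
  then show ?thesis using t[OF k(1)] assms(3) unfolding tight_def by blast
qed

text \<open>The decisive dichotomy. If some old \<open>e < b\<close> is at or above
  \<open>\<delta>\<close>, then at some stage c_b reaches \<open>e\<close>, hence agrees with
  \<open>S b\<close> up to \<open>\<delta>\<close>, and coherence of that stage settles
  \<open>\<delta>\<close>. Otherwise \<open>\<delta>\<close> is the supremum of the old points below
  \<open>b\<close>, and it is new or \<open>b\<close> itself.\<close>

lemma S_limit:
  assumes b: "b \<in> x" and lim: "limit_pt (S b) \<delta>"
  shows "\<delta> \<in> S b" "\<delta> \<le> sup_below x b"
    "(\<exists>i\<in>I. b \<in> X i \<and> (\<delta>, \<delta>) \<in> L i \<and> \<delta> \<in> X i \<and> sec (L i) \<delta> = S b \<inter> {..\<delta>}) \<or>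
      \<delta> = sup_below x b \<and> (\<delta> \<notin> x \<or> \<delta> = b)"
proof -
  show le: "\<delta> \<le> sup_below x b"
  proof (rule leI, rule notI)
    assume "sup_below x b < \<delta>"
    from limit_ptD[OF lim this] show False using S_le(1) by (auto simp: not_less[symmetric])
  qed
  have ne: "\<exists>e\<in>x. e < b"
  proof -
    obtain a where "a \<in> S b" using lim unfolding limit_pt_iff by blast
    then show ?thesis by (rule S_le(2))
  qed
  have *: "\<delta> \<in> S b \<and> (\<exists>i\<in>I. b \<in> X i \<and> (\<delta>, \<delta>) \<in> L i \<and> \<delta> \<in> X i \<and> sec (L i) \<delta> = S b \<inter> {..\<delta>})"
    if e: "e \<in> x" "e < b" "\<delta> \<le> e" for e
  proof -
    obtain i m where i: "i \<in> I" "b \<in> X i" "(m, b) \<in> L i" "e \<le> m"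
      using S_unbounded[OF b e(1,2)] by blast
    have L_eq: "(a, b) \<in> L i \<longleftrightarrow> a \<in> S b" if "a \<le> \<delta>" for a
      using S_L[OF i(1-3), of a] L_S[OF i(1)] that e(3) i(4) by (meson order_trans)
    have lim': "limit_pt (sec (L i) b) \<delta>"
      using lim by (rule limit_pt_mono) (use L_eq in auto)
    have "\<delta> \<le> b" using e by auto
    note d = condD(7-9)[OF c[OF i(1)] this lim']
    have "\<delta> \<in> X i" using condD(4)[OF c[OF i(1)] d(3)] .
    moreover have "sec (L i) \<delta> = S b \<inter> {..\<delta>}" using d(2) L_eq by auto
    moreover have "\<delta> \<in> S b" using L_S[OF i(1) d(1)] .
    ultimately show ?thesis using i d(3) by blast
  qed
  consider "\<delta> < sup_below x b" | "\<delta> = sup_below x b" "\<delta> \<in> x" "\<delta> < b" |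
    "\<delta> = sup_below x b" "\<delta> \<notin> x \<or> \<delta> = b"
    using le sup_below_le[of x b] by force
  then have "\<delta> \<in> S b \<and> ((\<exists>i\<in>I. b \<in> X i \<and> (\<delta>, \<delta>) \<in> L i \<and> \<delta> \<in> X i \<and> sec (L i) \<delta> = S b \<inter> {..\<delta>}) \<or>
      \<delta> = sup_below x b \<and> (\<delta> \<notin> x \<or> \<delta> = b))"
  proof cases
    case 1
    then obtain e where "e \<in> x" "e < b" "\<delta> < e" using less_sup_below by blast
    then show ?thesis using *[of e] by auto
  next
    case 2
    then show ?thesis using *[of \<delta>] by auto
  next
    case 3
    then show ?thesis using ne unfolding S_def by blast
  qed
  then show "\<delta> \<in> S b"
    "(\<exists>i\<in>I. b \<in> X i \<and> (\<delta>, \<delta>) \<in> L i \<and> \<delta> \<in> X i \<and> sec (L i) \<delta> = S b \<inter> {..\<delta>}) \<or>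
      \<delta> = sup_below x b \<and> (\<delta> \<notin> x \<or> \<delta> = b)" by auto
qed

section \<open>The lower bound as a tight condition\<close>

lemma K_low: "b < \<sigma> \<Longrightarrow> (a, b) \<in> K \<longleftrightarrow> (a, b) \<in> R"
  unfolding K_def by auto

lemma K_high: "\<sigma> \<le> b \<Longrightarrow> (a, b) \<in> K \<longleftrightarrow> b \<in> w \<and> a \<in> S (next_pt b)"
  using condD(4)[OF cz] z_less unfolding K_def by (auto simp: not_less[symmetric])

lemma S_next_le:
  assumes "b \<in> w" "\<sigma> \<le> b"
  shows "sup_below x (next_pt b) \<le> b"
  unfolding sup_below_le_iff using next_pt(3)[OF assms] less_imp_le by blast

lemma S_sub_w:
  assumes b: "b \<in> x" and a: "a \<in> S b"
  shows "a \<in> w"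
proof -
  from a consider i where "i \<in> I" "(a, b) \<in> L i" | "\<exists>e\<in>x. e < b" "a = sup_below x b"
    unfolding S_def by blast
  then show ?thesis
  proof cases
    case 1
    then have "a \<in> x" using condD(3)[OF c] unfolding x_def by blast
    then show ?thesis using w_iff by blast
  next
    case 2
    from sup_below_cases[OF 2(1)] show ?thesis
    proof
      assume "limit_pt x (sup_below x b)"
      then have "limit_pt (z \<union> x) a" unfolding 2(2) by (rule limit_pt_mono) auto
      moreover have "a = b \<or> a < b" using sup_below_le[of x b] 2(2) by auto
      ultimately show ?thesis using b w_iff by auto
    qed (use 2 w_iff in auto)
  qed
qed

lemma K_le: "(a, b) \<in> K \<Longrightarrow> a \<le> b"
  using K_low[of b a] K_high[of b a] condD(5)[OF cz, of a b] S_le(1)[of a "next_pt b"]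
    S_next_le[of b] by (meson not_less order_trans)

lemma K_sub: "(a, b) \<in> K \<Longrightarrow> a \<in> w \<and> b \<in> w"
proof (cases "b < \<sigma>")
  case True
  assume "(a, b) \<in> K"
  then have "(a, b) \<in> R" using K_low True by blast
  then show ?thesis using condD(3,4)[OF cz, of a b] w_below by blast
next
  case False
  assume "(a, b) \<in> K"
  then have "b \<in> w" "a \<in> S (next_pt b)" using K_high False by auto
  then show ?thesis using S_sub_w next_pt(1) False by (meson not_less)
qed

text \<open>Below \<open>\<sigma>\<close> this is the choice of \<open>(z, R)\<close>; from
  \<open>\<sigma>\<close> on, an old point is its own \<open>next_pt\<close> and \<open>S_L\<close>
  applies.\<close>

lemma K_extends:
  assumes i: "i \<in> I"
  shows "extends w K (X i) (L i)"
  unfolding extends_def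
proof (intro conjI allI impI subsetI)
  have Xx: "X i \<subseteq> x" unfolding x_def using i by auto
  have low: "b < \<alpha>" if "b \<in> X i" "b < \<sigma>" for b using that Xx x_below by blast
  show "b \<in> w" if "b \<in> X i" for b using that Xx w_iff by blast
  show "ab \<in> K" if "ab \<in> L i" for ab
  proof (cases ab)
    case (Pair a b)
    have b: "b \<in> X i" using condD(4)[OF c[OF i]] that Pair by blast
    show ?thesis
    proof (cases "b < \<sigma>")
      case True
      then have "(a, b) \<in> below (L i) \<alpha>" using that Pair low b by simp
      then show ?thesis using extendsD(2)[OF z_ext[OF i]] K_low True Pair by blast
    next
      case False
      have "b \<in> w" using b Xx w_iff by blast
      moreover have "a \<in> S (next_pt b)" using next_pt_eq[of b] b Xx L_S[OF i, of a b] that Pair by auto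
      ultimately show ?thesis using K_high[of b a] False Pair by simp
    qed
  qed
  fix a a' b assume *: "b \<in> X i" "(a, b) \<in> K" "(a', b) \<in> L i" "a \<le> a'"
  show "(a, b) \<in> L i"
  proof (cases "b < \<sigma>")
    case True
    then show ?thesis using extendsD(3)[OF z_ext[OF i], of b a a'] * low K_low by simp
  next
    case False
    then have "a \<in> S b" using K_high[of b a] *(1,2) next_pt_eq[of b] Xx by auto
    then show ?thesis using S_L[OF i *(1,3) _ *(4)] by blast
  qed
qed

lemma cond_K: "cond w K"
proof (rule condI)
  show "w \<subseteq> {..<succ_card \<kappa>}" unfolding w_def by (rule cl_subset[OF zx_bounded])
  have "x \<prec> {..<\<kappa>}" unfolding x_def using I condD(2)[OF c] by (rule small_UN)
  then show "w \<prec> {..<\<kappa>}"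
    unfolding w_def using zx_bounded condD(2)[OF cz] by (intro small_cl small_Un)
  show "a \<in> w \<and> b \<in> w \<and> a \<le> b" if "(a, b) \<in> K" for a b using that K_le K_sub by blast
  show "limit_pt w b" if b: "(b, b) \<in> K" for b
  proof -
    have "limit_pt z b \<or> limit_pt (z \<union> x) b"
    proof (cases "b < \<sigma>")
      case True
      then show ?thesis using condD(6)[OF cz] K_low b by blast
    next
      case False
      then have bw: "b \<in> w" "b \<in> S (next_pt b)" using K_high b by auto
      show ?thesis
      proof (cases "b \<in> x")
        case True
        then have "b \<in> S b" using bw next_pt_eq by simp
        from S_le[OF this] have "b = sup_below x b" "\<exists>e\<in>x. e < b"
          using sup_below_le by (auto intro: antisym)
        then have "limit_pt x b" using sup_below_cases[of x b] by auto
        then have "limit_pt (z \<union> x) b" by (rule limit_pt_mono) simp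
        then show ?thesis ..
      next
        \<comment> \<open>A point of \<open>w\<close> outside \<open>x\<close> and at or above
          \<open>\<sigma>\<close> is not in \<open>z\<close> either, so it entered as a limit
          point.\<close>
        case 2: False
        then show ?thesis using bw(1) False z_less w_iff by auto
      qed
    qed
    then show ?thesis using w_iff by (auto elim!: limit_pt_mono)
  qed
  show "(\<delta>, b) \<in> K \<and> sec K \<delta> = sec K b \<inter> {..\<delta>}"
    if b: "b \<in> w" "\<delta> \<le> b" "limit_pt (sec K b) \<delta>" for b \<delta>
  proof (cases "b < \<sigma>")
    case True
    then have "\<delta> < \<sigma>" using b(2) by auto
    then have "sec K b = sec R b" "sec K \<delta> = sec R \<delta>" using True K_low by auto
    then show ?thesis using condD(7,8)[OF cz b(2)] b(3) by auto
  next
    case False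
    then have \<sigma>b: "\<sigma> \<le> b" by simp
    define n where "n = next_pt b"
    note n = next_pt[OF b(1) \<sigma>b, folded n_def]
    have sec: "sec K b = S n"
      by (rule set_eqI) (simp add: K_high[OF \<sigma>b] b(1) n_def)
    note lim = S_limit[OF n(1) b(3)[unfolded sec]]
    have "sec K \<delta> = S n \<inter> {..\<delta>}"
      using lim(3)
    proof
      \<comment> \<open>Here \<open>\<delta>\<close> was completed at a stage, so its set is final
        and coherence carries over.\<close>
      assume "\<exists>i\<in>I. n \<in> X i \<and> (\<delta>, \<delta>) \<in> L i \<and> \<delta> \<in> X i \<and> sec (L i) \<delta> = S n \<inter> {..\<delta>}"
      then obtain i where i: "i \<in> I" "(\<delta>, \<delta>) \<in> L i" "\<delta> \<in> X i" "sec (L i) \<delta> = S n \<inter> {..\<delta>}" by blast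
      then show ?thesis using complete_sec[OF K_extends[OF i(1)] i(2,3)] K_le by simp
    next
      \<comment> \<open>Now \<open>S n\<close> ends at \<open>\<delta>\<close>, so
        \<open>\<delta>\<close> must carry all of \<open>S n\<close>. If \<open>\<delta>\<close> is
        not \<open>b\<close>, it is a new point with no old point between it and \<open>n\<close>,
        and hence was given \<open>S n\<close> as well.\<close>
      assume *: "\<delta> = sup_below x n \<and> (\<delta> \<notin> x \<or> \<delta> = n)"
      have all: "S n \<inter> {..\<delta>} = S n" using * S_le(1) by blast
      show ?thesis
      proof (cases "\<delta> = b")
        case True
        then show ?thesis using sec all by simp
      next
        case False
        then have \<delta>: "\<delta> \<notin> x" "\<delta> < n" using * n(2) b(2) by auto
        have ub: "e < \<delta>" if "e \<in> x" "e < n" for e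
          using le_sup_below[OF that] * \<delta>(1) that(1) by (metis le_less)
        have \<sigma>\<delta>: "\<sigma> \<le> \<delta>"
        proof (rule leI, rule notI)
          assume "\<delta> < \<sigma>"
          then obtain e where e: "e \<in> x" "e < \<sigma>" "\<delta> \<le> e" using less_\<sigma>[of \<delta>] by blast
          then show False using ub[of e] \<sigma>b n(2) by (meson leD less_le_trans order_trans)
        qed
        have "next_pt \<delta> = n"
          unfolding next_pt_def using n(1) \<delta>(2) ub
          by (intro Least_equality) (auto simp: not_less[symmetric])
        moreover have "\<delta> \<in> w" using S_sub_w[OF n(1) lim(1)] .
        ultimately have "sec K \<delta> = S n" by (intro set_eqI) (simp add: K_high[OF \<sigma>\<delta>])
        then show ?thesis using all by simp
      qed
    qed
    then show ?thesis using lim(1) sec by auto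
  qed
qed

text \<open>From \<open>\<sigma>\<close> on, the supremum of the old points below
  \<open>next_pt b\<close> also bounds the points of \<open>z\<close> and the added limit points
  below \<open>b\<close>.\<close>

lemma tight_K: "tight w K"
  unfolding tight_def
proof (intro conjI ballI impI)
  show "closed_in_sup w" unfolding w_def by (rule cl_closed[OF zx_bounded])
  fix b assume b: "b \<in> w" "\<exists>a\<in>w. a < b"
  show "\<exists>m. (m, b) \<in> K \<and> (\<forall>a\<in>w. a < b \<longrightarrow> a \<le> m)"
  proof (cases "b < \<sigma>")
    case True
    have wz: "a \<in> z" if a: "a \<in> w" "a \<le> b" for a
    proof -
      have "a \<in> w \<inter> {..<\<sigma>}" using a le_less_trans[OF a(2) True] by simp
      then show ?thesis unfolding w_below .
    qed
    then have "b \<in> z" "\<exists>a\<in>z. a < b" using b by (auto simp: less_imp_le)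
    then obtain m where "(m, b) \<in> R" "\<forall>a\<in>z. a < b \<longrightarrow> a \<le> m" using tz unfolding tight_def by blast
    then show ?thesis using K_low[OF True] wz less_imp_le by metis
  next
    case False
    then have \<sigma>b: "\<sigma> \<le> b" by simp
    note n = next_pt[OF b(1) \<sigma>b]
    define m where "m = sup_below x (next_pt b)"
    have le_m: "e \<le> m" if e: "e \<in> z \<union> x" "e < b" for e
    proof -
      obtain a where "a \<in> x" "a < b" "e \<le> a" using zx_below[OF e \<sigma>b] by blast
      then show ?thesis
        using le_sup_below[of a x "next_pt b"] n(2) unfolding m_def by (meson less_le_trans order_trans)
    qed
    have le_w: "a \<le> m" if a: "a \<in> w" "a < b" for a
    proof (rule leI, rule notI)
      assume "m < a"
      then obtain e where "e \<in> z \<union> x" "m < e" "e \<le> a" using w_sub[OF a(1)] by blast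
      then show False using le_m[of e] a(2) by (meson leD le_less_trans)
    qed
    obtain a where a: "a \<in> w" "a < b" using b(2) by blast
    have "\<exists>e\<in>z \<union> x. e < b"
      using a unfolding w_iff limit_pt_iff by (meson less_trans)
    then obtain e where "e \<in> x" "e < b" using zx_below[OF _ _ \<sigma>b] by blast
    then have "m \<in> S (next_pt b)" unfolding S_def m_def using n(2) by force
    then have "(m, b) \<in> K" using K_high[OF \<sigma>b] b(1) by blast
    then show ?thesis using le_w by blast
  qed
qed

lemma below_K: "below K \<sigma> = R"
  using K_low condD(4)[OF cz] z_less unfolding below_def by auto

end

section \<open>The forcing notion\<close>

context regular_uncountable_cardinal
begin

text \<open>Arbitrary off the range of \<open>code\<close>, which contains all conditions.\<close>

definition decode :: "'o vset \<Rightarrow> 'o set \<times> ('o \<times> 'o) set" where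
  "decode = inv code"

definition conds :: "'o vset set" where
  "conds = {code (x, K) |x K. cond x K}"

definition tight_conds :: "'o vset set" where
  "tight_conds = {code (x, K) |x K. cond x K \<and> tight x K}"

definition cond_le :: "'o vset \<Rightarrow> 'o vset \<Rightarrow> bool" where
  "cond_le q p = extends (fst (decode q)) (snd (decode q)) (fst (decode p)) (snd (decode p))"

definition cond_one :: "'o vset" where
  "cond_one = code ({}, {})"

definition cond_supp :: "'o vset \<Rightarrow> 'o set" where
  "cond_supp p = fst (decode p)"

definition cond_act :: "'o set \<Rightarrow> ('o \<Rightarrow> 'o) \<Rightarrow> 'o vset \<Rightarrow> 'o vset" where
  "cond_act y \<pi> p = code (\<pi> ` fst (decode p), map_prod \<pi> \<pi> ` snd (decode p))"

lemma decode_code [simp]: "decode (code p) = p"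
  unfolding decode_def using inj_code by (rule inv_f_f)

lemma code_eq_iff [simp]: "code p = code q \<longleftrightarrow> p = q" for p q :: "'o set \<times> ('o \<times> 'o) set"
  using inj_code by (rule inj_eq)

lemma cond_le_code [simp]: "cond_le (code (y, L)) (code (x, K)) \<longleftrightarrow> extends y L x K"
  by (simp add: cond_le_def)

lemma cond_supp_code [simp]: "cond_supp (code (x, K)) = x"
  by (simp add: cond_supp_def)

lemma cond_act_code [simp]: "cond_act y \<pi> (code (x, K)) = code (\<pi> ` x, map_prod \<pi> \<pi> ` K)"
  by (simp add: cond_act_def)

lemma code_in_conds [simp]: "code (x, K) \<in> conds \<longleftrightarrow> cond x K"
  unfolding conds_def by auto

lemma code_in_tight_conds [simp]: "code (x, K) \<in> tight_conds \<longleftrightarrow> cond x K \<and> tight x K"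
  unfolding tight_conds_def by auto

lemma condsE:
  assumes "p \<in> conds" obtains x K where "p = code (x, K)" "cond x K"
  using assms unfolding conds_def by blast

lemma tight_condsE:
  assumes "p \<in> tight_conds" obtains x K where "p = code (x, K)" "cond x K" "tight x K"
  using assms unfolding tight_conds_def by blast

interpretation F: forcing_data \<kappa> conds cond_le cond_one tight_conds cond_supp cond_act .

text \<open>Uniqueness: two strongest conditions extend each other, and \<open>extends\<close> is
  antisymmetric.\<close>

lemma is_restr_code:
  assumes p: "cond x K"
  shows "F.is_restr (code (x, K)) \<alpha> r \<longleftrightarrow> r = code (x \<inter> {..<\<alpha>}, below K \<alpha>)"
proof
  assume "r = code (x \<inter> {..<\<alpha>}, below K \<alpha>)"
  then show "F.is_restr (code (x, K)) \<alpha> r"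
    unfolding F.is_restr_def using cond_below[OF p] extends_below below_strongest
    by (auto elim!: condsE)
next
  assume r: "F.is_restr (code (x, K)) \<alpha> r"
  then obtain L where L: "r = code (x \<inter> {..<\<alpha>}, L)" "cond (x \<inter> {..<\<alpha>}) L" "extends x K (x \<inter> {..<\<alpha>}) L"
    unfolding F.is_restr_def by (auto elim!: condsE)
  have "\<forall>s\<in>conds. cond_supp s = x \<inter> {..<\<alpha>} \<and> cond_le (code (x, K)) s \<longrightarrow> cond_le r s"
    using r unfolding F.is_restr_def by simp
  from bspec[OF this, of "code (x \<inter> {..<\<alpha>}, below K \<alpha>)"]
  have "cond_le r (code (x \<inter> {..<\<alpha>}, below K \<alpha>))"
    using cond_below[OF p] extends_below[of x K \<alpha>] by simp
  then have "extends (x \<inter> {..<\<alpha>}) L (x \<inter> {..<\<alpha>}) (below K \<alpha>)" unfolding L(1) by simp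
  then show "r = code (x \<inter> {..<\<alpha>}, below K \<alpha>)"
    using below_strongest[OF L(3,2)] extends_antisym L(1) by auto
qed

lemma restr_code: "cond x K \<Longrightarrow> F.restr (code (x, K)) \<alpha> = code (x \<inter> {..<\<alpha>}, below K \<alpha>)"
  unfolding F.restr_def by (rule the_equality) (simp_all add: is_restr_code)

lemma ssup_supp: "cond x K \<Longrightarrow> b \<in> x \<Longrightarrow> b < ssup x"
  using less_ssup_iff[OF condD(1)] by blast

lemma forcing_class_conds:
  "forcing_class \<kappa> conds cond_le cond_one tight_conds cond_supp cond_act"
proof unfold_locales
  show "cond_le p p" if "p \<in> conds" for p
    using that extends_refl by (auto elim!: condsE)
  show "cond_le p r" if "p \<in> conds" "q \<in> conds" "r \<in> conds" "cond_le p q" "cond_le q r" for p q r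
    using that extends_trans unfolding cond_le_def by blast
  show "cond_le p cond_one" if "p \<in> conds" for p
    using that unfolding cond_one_def by (auto elim!: condsE simp: extends_def)
  have c0: "cond {} {}" by (simp add: cond_empty)
  have t0: "tight {} {}" by (simp add: tight_def closed_in_sup_iff)
  show "cond_one \<in> tight_conds" unfolding cond_one_def using c0 t0 by simp
  show "tight_conds \<subseteq> conds" by (auto elim!: tight_condsE)
  show "cond_supp p \<in> small_subsets (succ_card \<kappa>) \<kappa>" if "p \<in> conds" for p
    using that by (auto elim!: condsE simp: cond_def)
  show "cond_supp cond_one = {}" by (simp add: cond_one_def)
  show "cond_supp p \<subseteq> cond_supp q" if "cond_le q p" for p q
    using that extendsD(1) unfolding cond_le_def cond_supp_def by blast
  show "\<exists>q\<in>conds. cond_le q p \<and> cond_supp q = x"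
    if p: "p \<in> conds" and x: "x \<in> small_subsets (succ_card \<kappa>) \<kappa>" "cond_supp p \<subseteq> x" for p x
  proof -
    obtain y K where y: "p = code (y, K)" "cond y K" using p by (rule condsE)
    have "cond x K" using cond_weaken[OF y(2) _ x(1)] x(2) y(1) by simp
    moreover have "extends x K y K" using x(2) y(1) by (auto simp: extends_def)
    ultimately show ?thesis using y(1) by (intro bexI[of _ "code (x, K)"]) auto
  qed
  show "F.P_on {} = {cond_one}"
    unfolding F.P_on_def cond_one_def using c0 by (auto elim!: condsE simp: cond_empty)
  show "F.P_on {..<\<kappa>} \<subseteq> Hset \<kappa>"
  proof
    fix p assume "p \<in> F.P_on {..<\<kappa>}"
    then obtain x K where "p = code (x, K)" "cond x K" "x \<subseteq> {..<\<kappa>}"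
      unfolding F.P_on_def by (auto elim!: condsE)
    moreover have "x \<prec> {..<\<kappa>}" "K \<subseteq> x \<times> x"
      using \<open>cond x K\<close> unfolding cond_def small_subsets_def by simp_all
    ultimately show "p \<in> Hset \<kappa>" using code_in_Hset by simp
  qed
  have P_onE: thesis
    if "p \<in> F.P_on y" "\<And>x K. p = code (x, K) \<Longrightarrow> cond x K \<Longrightarrow> x \<subseteq> y \<Longrightarrow> K \<subseteq> x \<times> x \<Longrightarrow> thesis"
    for p y thesis
    using that unfolding F.P_on_def cond_def by (auto elim!: condsE simp: cond_def)
  show "cond_act y \<pi> p \<in> conds"
    if "y \<subseteq> {..<succ_card \<kappa>}" "coi y \<pi> (succ_card \<kappa>)" "p \<in> F.P_on y" for y \<pi> p
    using that(3) cond_image[OF that(2)] by (auto elim!: P_onE)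
  show "cond_supp (cond_act y \<pi> p) = \<pi> ` cond_supp p"
    if "y \<subseteq> {..<succ_card \<kappa>}" "coi y \<pi> (succ_card \<kappa>)" "p \<in> F.P_on y" for y \<pi> p
    using that(3) by (auto elim!: P_onE)
  show "cond_act y \<pi> p \<in> tight_conds"
    if "y \<subseteq> {..<succ_card \<kappa>}" and c: "coi y \<pi> (succ_card \<kappa>)" and p: "p \<in> F.Q_on y" for y \<pi> p
  proof -
    obtain x K where x: "p = code (x, K)" "cond x K" "x \<subseteq> y" "tight x K"
      using p unfolding F.Q_on_def F.P_on_def by (auto elim!: tight_condsE)
    then show ?thesis using cond_image[OF c] tight_image[OF c] by simp
  qed
  show "cond_le (cond_act y \<pi> q) (cond_act y \<pi> p) \<longleftrightarrow> cond_le q p"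
    if "y \<subseteq> {..<succ_card \<kappa>}" "coi y \<pi> (succ_card \<kappa>)" "p \<in> F.P_on y" "q \<in> F.P_on y" for y \<pi> p q
    using that(3,4) extends_image[OF that(2)] by (auto elim!: P_onE)
  show "cond_act y id p = p" if "p \<in> F.P_on y" for y p
    using that by (auto elim!: P_onE simp: map_prod.id)
  show "cond_act y' \<pi>' (cond_act y \<pi> p) = cond_act y (\<pi>' \<circ> \<pi>) p" if "p \<in> F.P_on y" for y y' \<pi> \<pi>' p
    using that by (rule P_onE) (simp add: image_comp map_prod_compose)
  show "cond_act y \<pi> p = cond_act y' \<pi>' p"
    if "p \<in> F.P_on y" and eq: "\<And>\<alpha>. \<alpha> \<in> cond_supp p \<Longrightarrow> \<pi> \<alpha> = \<pi>' \<alpha>" for y \<pi> y' \<pi>' p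
    using that(1)
  proof (rule P_onE)
    fix x K assume p: "p = code (x, K)" and K: "K \<subseteq> x \<times> x"
    have "\<pi> ` x = \<pi>' ` x" using eq p by (intro image_cong) auto
    moreover have "map_prod \<pi> \<pi> ` K = map_prod \<pi>' \<pi>' ` K"
      using eq p K by (intro image_cong) auto
    ultimately show ?thesis using p by simp
  qed
  show "\<exists>!r. F.is_restr p \<alpha> r" if "p \<in> conds" for p \<alpha>
    using that by (auto elim!: condsE simp: is_restr_code)
  show "F.restr p \<alpha> \<in> tight_conds" if "p \<in> tight_conds" for p \<alpha>
    using that cond_below tight_below by (auto elim!: tight_condsE simp: restr_code)
  show "cond_le (F.restr q \<alpha>) (F.restr p \<alpha>)" if "p \<in> conds" "q \<in> conds" "cond_le q p" for p q \<alpha>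
    using that extends_below_mono by (auto elim!: condsE simp: restr_code)
  \<comment> \<open>Total projections turn a sequence of conditions into sequences of supports and
    relations, the form taken by \<open>amalgam\<close> and
    \<open>lower_bound_construction\<close>.\<close>
  define X where "X p = fst (decode p)" for p :: "'o vset"
  define L where "L p = snd (decode p)" for p :: "'o vset"
  have XL: "p = code (X p, L p)" "cond (X p) (L p)" if "p \<in> conds" for p
    using that unfolding X_def L_def by (auto elim!: condsE)
  have suppX: "cond_supp p = X p" for p unfolding X_def cond_supp_def ..
  have tightD: "p \<in> conds" "tight (X p) (L p)" if "p \<in> tight_conds" for p
    using that unfolding X_def L_def by (auto elim!: tight_condsE)
  have amalg: "cond (\<Union>\<eta><\<xi>. X (ps \<eta>)) (\<Union>\<eta><\<xi>. L (ps \<eta>))"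
    "\<And>\<eta>. \<eta> < \<xi> \<Longrightarrow> (\<Union>\<eta><\<xi>. X (ps \<eta>)) \<inter> {..<ssup (X (ps \<eta>))} = X (ps \<eta>) \<and>
      below (\<Union>\<eta><\<xi>. L (ps \<eta>)) (ssup (X (ps \<eta>))) = L (ps \<eta>)"
    "(\<And>\<eta>. \<eta> < \<xi> \<Longrightarrow> tight (X (ps \<eta>)) (L (ps \<eta>))) \<Longrightarrow>
      tight (\<Union>\<eta><\<xi>. X (ps \<eta>)) (\<Union>\<eta><\<xi>. L (ps \<eta>))"
    if \<xi>: "\<xi> < \<kappa>" and ps: "\<And>\<eta>. \<eta> < \<xi> \<Longrightarrow> ps \<eta> \<in> conds"
      and coh: "\<And>\<eta> \<eta>'. \<eta> < \<eta>' \<Longrightarrow> \<eta>' < \<xi> \<Longrightarrow>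
        ps \<eta> = F.restr (ps \<eta>') (ssup (cond_supp (ps \<eta>)))" for \<xi> and ps :: "'o \<Rightarrow> 'o vset"
  proof -
    have c: "cond (X (ps i)) (L (ps i))" if "i \<in> {..<\<xi>}" for i using XL(2)[OF ps] that by simp
    have coh': "X (ps i) = X (ps j) \<inter> {..<ssup (X (ps i))} \<and> L (ps i) = below (L (ps j)) (ssup (X (ps i)))"
      if ij: "i \<in> {..<\<xi>}" "j \<in> {..<\<xi>}" "i < j" for i j
    proof -
      have "code (X (ps i), L (ps i)) = F.restr (code (X (ps j), L (ps j))) (ssup (X (ps i)))"
        using coh[OF ij(3)] ij XL(1)[OF ps] suppX by (metis lessThan_iff)
      then show ?thesis unfolding restr_code[OF c[OF ij(2)]] by simp
    qed
    note A = amalgam[OF c lessThan_small[OF \<xi>] coh']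
    show "cond (\<Union>\<eta><\<xi>. X (ps \<eta>)) (\<Union>\<eta><\<xi>. L (ps \<eta>))" by (rule A(1))
    show "(\<Union>\<eta><\<xi>. X (ps \<eta>)) \<inter> {..<ssup (X (ps \<eta>))} = X (ps \<eta>) \<and>
      below (\<Union>\<eta><\<xi>. L (ps \<eta>)) (ssup (X (ps \<eta>))) = L (ps \<eta>)" if "\<eta> < \<xi>" for \<eta>
      by (rule A(2)) (use that in auto)
    show "tight (\<Union>\<eta><\<xi>. X (ps \<eta>)) (\<Union>\<eta><\<xi>. L (ps \<eta>))"
      if "\<And>\<eta>. \<eta> < \<xi> \<Longrightarrow> tight (X (ps \<eta>)) (L (ps \<eta>))"
      by (rule A(3)) (use that in auto)
  qed
  \<comment> \<open>Each index in the support of \<open>p\<close> lies in some stage, so every pair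
    of \<open>p\<close> survives in the restriction to that stage; this determines
    \<open>p\<close>.\<close>
  have amalg_eq: "p = code (\<Union>\<eta><\<xi>. X (ps \<eta>), \<Union>\<eta><\<xi>. L (ps \<eta>))"
    if ps: "\<And>\<eta>. \<eta> < \<xi> \<Longrightarrow> ps \<eta> \<in> conds"
      and p: "p \<in> conds" "cond_supp p = (\<Union>\<eta>\<in>{..<\<xi>}. cond_supp (ps \<eta>))"
        "\<And>\<eta>. \<eta> < \<xi> \<Longrightarrow> ps \<eta> = F.restr p (ssup (cond_supp (ps \<eta>)))" for \<xi> p and ps :: "'o \<Rightarrow> 'o vset"
  proof -
    have Xp: "X p = (\<Union>\<eta><\<xi>. X (ps \<eta>))" using p(2) suppX by simp
    have Lp: "L (ps \<eta>) = below (L p) (ssup (X (ps \<eta>)))" if "\<eta> < \<xi>" for \<eta>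
    proof -
      have "code (X (ps \<eta>), L (ps \<eta>)) = F.restr (code (X p, L p)) (ssup (X (ps \<eta>)))"
        using p(3)[OF that] XL(1)[OF ps[OF that]] XL(1)[OF p(1)] suppX by metis
      then show ?thesis unfolding restr_code[OF XL(2)[OF p(1)]] by simp
    qed
    have "L p = (\<Union>\<eta><\<xi>. L (ps \<eta>))"
    proof (intro subset_antisym subsetI)
      fix ab assume ab: "ab \<in> L p"
      obtain a b where [simp]: "ab = (a, b)" by (cases ab)
      have "b \<in> X p" using condD(4)[OF XL(2)[OF p(1)]] ab by simp
      then obtain \<eta> where \<eta>: "\<eta> < \<xi>" "b \<in> X (ps \<eta>)" unfolding Xp by auto
      then have "ab \<in> L (ps \<eta>)" using Lp[OF \<eta>(1)] ab ssup_supp[OF XL(2)[OF ps[OF \<eta>(1)]] \<eta>(2)] by simp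
      then show "ab \<in> (\<Union>\<eta><\<xi>. L (ps \<eta>))" using \<eta>(1) by blast
    next
      show "ab \<in> L p" if "ab \<in> (\<Union>\<eta><\<xi>. L (ps \<eta>))" for ab
        using that Lp by (auto simp: below_def)
    qed
    then show ?thesis using XL(1)[OF p(1)] Xp by simp
  qed
  show "\<exists>!p. p \<in> conds \<and> cond_supp p = (\<Union>\<eta>\<in>{..<\<xi>}. cond_supp (ps \<eta>)) \<and>
      (\<forall>\<eta><\<xi>. ps \<eta> = F.restr p (ssup (cond_supp (ps \<eta>))))"
    if \<xi>: "\<xi> < \<kappa>" and ps: "\<And>\<eta>. \<eta> < \<xi> \<Longrightarrow> ps \<eta> \<in> conds"
      and coh: "\<And>\<eta> \<eta>'. \<eta> < \<eta>' \<Longrightarrow> \<eta>' < \<xi> \<Longrightarrow>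
        ps \<eta> = F.restr (ps \<eta>') (ssup (cond_supp (ps \<eta>)))" for \<xi> ps
  proof (rule ex1I, intro conjI allI impI)
    have A: "cond (\<Union>\<eta><\<xi>. X (ps \<eta>)) (\<Union>\<eta><\<xi>. L (ps \<eta>))" by (rule amalg(1)[OF \<xi> ps coh])
    let ?p = "code (\<Union>\<eta><\<xi>. X (ps \<eta>), \<Union>\<eta><\<xi>. L (ps \<eta>))"
    show "?p \<in> conds" using A by simp
    show "cond_supp ?p = (\<Union>\<eta>\<in>{..<\<xi>}. cond_supp (ps \<eta>))"
      unfolding suppX by (simp add: X_def)
    show "ps \<eta> = F.restr ?p (ssup (cond_supp (ps \<eta>)))" if \<eta>: "\<eta> < \<xi>" for \<eta>
    proof -
      have "(\<Union>\<eta><\<xi>. X (ps \<eta>)) \<inter> {..<ssup (X (ps \<eta>))} = X (ps \<eta>) \<and>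
        below (\<Union>\<eta><\<xi>. L (ps \<eta>)) (ssup (X (ps \<eta>))) = L (ps \<eta>)"
        by (rule amalg(2)[OF \<xi> ps coh \<eta>])
      then show ?thesis
        unfolding suppX[of "ps \<eta>"] restr_code[OF A] using XL(1)[OF ps[OF \<eta>]] by simp
    qed
    show "p = ?p" if "p \<in> conds \<and> cond_supp p = (\<Union>\<eta>\<in>{..<\<xi>}. cond_supp (ps \<eta>)) \<and>
      (\<forall>\<eta><\<xi>. ps \<eta> = F.restr p (ssup (cond_supp (ps \<eta>))))" for p
      by (rule amalg_eq[OF ps]) (use that in simp_all)
  qed
  show "p \<in> tight_conds"
    if \<xi>: "\<xi> < \<kappa>" and ps: "\<And>\<eta>. \<eta> < \<xi> \<Longrightarrow> ps \<eta> \<in> tight_conds"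
      and coh: "\<And>\<eta> \<eta>'. \<eta> < \<eta>' \<Longrightarrow> \<eta>' < \<xi> \<Longrightarrow>
        ps \<eta> = F.restr (ps \<eta>') (ssup (cond_supp (ps \<eta>)))"
      and p: "p \<in> conds" "cond_supp p = (\<Union>\<eta>\<in>{..<\<xi>}. cond_supp (ps \<eta>))"
        "\<And>\<eta>. \<eta> < \<xi> \<Longrightarrow> ps \<eta> = F.restr p (ssup (cond_supp (ps \<eta>)))" for \<xi> ps p
  proof -
    note ps' = tightD(1)[OF ps]
    have A: "cond (\<Union>\<eta><\<xi>. X (ps \<eta>)) (\<Union>\<eta><\<xi>. L (ps \<eta>))" by (rule amalg(1)[OF \<xi> ps' coh])
    have B: "tight (\<Union>\<eta><\<xi>. X (ps \<eta>)) (\<Union>\<eta><\<xi>. L (ps \<eta>))"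
      by (rule amalg(3)[OF \<xi> ps' coh tightD(2)[OF ps]])
    have "p = code (\<Union>\<eta><\<xi>. X (ps \<eta>), \<Union>\<eta><\<xi>. L (ps \<eta>))" by (rule amalg_eq[OF ps' p])
    then show ?thesis using A B by simp
  qed
  show "closed_in_sup (cond_supp q)" if "q \<in> tight_conds" for q
    using that by (auto elim!: tight_condsE simp: tight_def)
  show "\<exists>q\<in>tight_conds. cond_le q p \<and> cond_supp q = cl (cond_supp p)" if "p \<in> conds" for p
  proof -
    obtain x K where x: "p = code (x, K)" "cond x K" using \<open>p \<in> conds\<close> by (rule condsE)
    obtain M where "cond (cl x) M" "tight (cl x) M" "extends (cl x) M x K"
      using tight_extension[OF x(2)] by blast
    then show ?thesis using x(1) by (intro bexI[of _ "code (cl x, M)"]) auto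
  qed
  show "\<exists>q\<in>tight_conds. (\<forall>\<eta><\<xi>. cond_le q (qs \<eta>)) \<and>
      F.restr q (ssup (x \<inter> {..<\<alpha>})) = r \<and> cond_supp q = cl (cond_supp r \<union> x)"
    if \<xi>: "\<xi> < \<kappa>" and qs: "\<And>\<eta>. \<eta> < \<xi> \<Longrightarrow> qs \<eta> \<in> tight_conds"
      and dec: "\<And>\<eta> \<eta>'. \<eta> < \<eta>' \<Longrightarrow> \<eta>' < \<xi> \<Longrightarrow> cond_le (qs \<eta>') (qs \<eta>)"
      and x: "x = (\<Union>\<eta>\<in>{..<\<xi>}. cond_supp (qs \<eta>))"
      and r: "r \<in> F.Q_on {..<ssup (x \<inter> {..<\<alpha>})}"
      and le: "\<And>\<eta>. \<eta> < \<xi> \<Longrightarrow> cond_le r (F.restr (qs \<eta>) \<alpha>)" for \<xi> qs x \<alpha> r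
  proof -
    note q = tightD[OF qs]
    have r': "r \<in> tight_conds" "X r \<subseteq> {..<ssup (x \<inter> {..<\<alpha>})}"
      using r suppX unfolding F.Q_on_def F.P_on_def by auto
    have xX: "x = (\<Union>\<eta><\<xi>. X (qs \<eta>))" using x suppX by simp
    interpret B: lower_bound_construction \<kappa> "{..<\<xi>}" "\<lambda>\<eta>. X (qs \<eta>)" "\<lambda>\<eta>. L (qs \<eta>)"
        \<alpha> "X r" "L r"
    proof unfold_locales
      show "{..<\<xi>} \<prec> {..<\<kappa>}" by (rule lessThan_small[OF \<xi>])
      show "cond (X (qs i)) (L (qs i))" if "i \<in> {..<\<xi>}" for i using XL(2) q(1) that by simp
      show "tight (X (qs i)) (L (qs i))" if "i \<in> {..<\<xi>}" for i using q(2) that by simp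
      show "extends (X (qs j)) (L (qs j)) (X (qs i)) (L (qs i))"
        if "i \<in> {..<\<xi>}" "j \<in> {..<\<xi>}" "i < j" for i j
        using dec that unfolding cond_le_def X_def L_def by simp
      show "cond (X r) (L r)" "tight (X r) (L r)" using tightD[OF r'(1)] XL(2) by auto
      show "X r \<subseteq> {..<ssup ((\<Union>\<eta><\<xi>. X (qs \<eta>)) \<inter> {..<\<alpha>})}" using r'(2) xX by simp
      show "extends (X r) (L r) (X (qs i) \<inter> {..<\<alpha>}) (below (L (qs i)) \<alpha>)" if "i \<in> {..<\<xi>}" for i
      proof -
        have i: "qs i \<in> conds" using q(1) that by simp
        have "cond_le (code (X r, L r)) (F.restr (code (X (qs i), L (qs i))) \<alpha>)"
          using le[of i] that XL(1)[OF i] XL(1)[OF tightD(1)[OF r'(1)]] by simp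
        then show ?thesis unfolding restr_code[OF XL(2)[OF i]] by simp
      qed
    qed
    have Bx: "B.x = x" unfolding B.x_def xX ..
    have B\<sigma>: "B.\<sigma> = ssup (x \<inter> {..<\<alpha>})" unfolding B.\<sigma>_def Bx ..
    have Bw: "B.w = cl (cond_supp r \<union> x)" unfolding B.w_def Bx suppX ..
    show ?thesis
    proof (intro bexI[of _ "code (B.w, B.K)"] conjI allI impI)
      show "code (B.w, B.K) \<in> tight_conds" using B.cond_K B.tight_K by simp
      show "cond_le (code (B.w, B.K)) (qs \<eta>)" if \<eta>: "\<eta> < \<xi>" for \<eta>
        using B.K_extends[of \<eta>] \<eta> unfolding cond_le_def X_def L_def by simp
      show "F.restr (code (B.w, B.K)) (ssup (x \<inter> {..<\<alpha>})) = r"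
        unfolding restr_code[OF B.cond_K] B\<sigma>[symmetric] B.w_below B.below_K
        using XL(1)[OF tightD(1)[OF r'(1)]] by simp
      show "cond_supp (code (B.w, B.K)) = cl (cond_supp r \<union> x)" using Bw by simp
    qed
  qed
  show "\<exists>r. F.is_glb p q r \<and> (\<forall>r'. F.is_glb p q r' \<longrightarrow> r' = r) \<and>
      cond_supp r = cond_supp q \<union> cond_supp p \<and> F.restr r \<alpha> = q"
    if p: "p \<in> tight_conds" and "\<alpha> < ssup (cond_supp p)" and q: "q \<in> F.P_on {..<\<alpha>}"
      and le: "cond_le q (F.restr p \<alpha>)" for p \<alpha> q
  proof -
    obtain x K where x: "p = code (x, K)" "cond x K" using p by (rule tight_condsE)
    obtain y M where y: "q = code (y, M)" "cond y M" "y \<subseteq> {..<\<alpha>}" using q by (rule P_onE)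
    have "extends y M (x \<inter> {..<\<alpha>}) (below K \<alpha>)" using le unfolding x(1) y(1) restr_code[OF x(2)] by simp
    note G = glb_below[OF x(2) y(2,3) this]
    define N where "N = M \<union> {(a, b) \<in> K. \<alpha> \<le> b}"
    note G = G[folded N_def]
    have glb: "F.is_glb p q (code (x \<union> y, N))"
      unfolding F.is_glb_def x(1) y(1) using G by (auto elim!: condsE)
    moreover have "r' = code (x \<union> y, N)" if r': "F.is_glb p q r'" for r'
    proof -
      have "r' \<in> conds" using r' unfolding F.is_glb_def by blast
      then obtain z M' where z: "r' = code (z, M')" by (rule condsE)
      have "cond_le r' (code (x \<union> y, N))" "cond_le (code (x \<union> y, N)) r'"
        using glb r' unfolding F.is_glb_def by blast+
      then show ?thesis unfolding z using extends_antisym[of z M' "x \<union> y" N] by simp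
    qed
    moreover have "cond_supp (code (x \<union> y, N)) = cond_supp q \<union> cond_supp p"
      unfolding x(1) y(1) by (simp add: Un_commute)
    moreover have "F.restr (code (x \<union> y, N)) \<alpha> = q"
      unfolding restr_code[OF G(1)] G(5,6) y(1) ..
    ultimately show ?thesis by blast
  qed
qed

end

section \<open>The square sequence\<close>

text \<open>The ordinal 2 as a set. A c.o.i. on it is the choice of a pair, so it indexes the dense
  sets; the premises ensure that the successors exist.\<close>

lemma lessThan_two:
  fixes a :: "'o::wellorder"
  assumes "ozero < a" "osucc ozero < a"
  shows "{..<osucc (osucc (ozero :: 'o))} = {ozero, osucc ozero}" "ozero < osucc (ozero :: 'o)"
proof -
  have 1: "c < osucc ozero \<longleftrightarrow> c = ozero" for c :: 'o
    using less_osucc_iff[OF assms(1), of c] ozero_le[of c] by auto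
  then have "c \<le> osucc ozero \<longleftrightarrow> c = ozero \<or> c = osucc ozero" for c :: 'o
    by (auto simp: le_less)
  then show "{..<osucc (osucc (ozero :: 'o))} = {ozero, osucc ozero}"
    using less_osucc_iff[OF assms(2)] by auto
  show "ozero < osucc (ozero :: 'o)" using 1 by blast
qed

lemma coi_images_finite:
  "finite {..<\<theta>} \<Longrightarrow> x \<in> coi_images \<mu> \<theta> \<Longrightarrow> finite x \<and> x \<subseteq> {..<\<mu>}"
  unfolding coi_images_def coi_def by auto

text \<open>A finite domain has no limit points, which makes closedness and continuity
  vacuous.\<close>

lemma pair_in_coi_images:
  fixes a b :: "'o::wellorder"
  assumes \<theta>: "{..<\<theta>} = {a, b}" "a < b" and gh: "g < h" "h < \<mu>"
  shows "{g, h} \<in> coi_images \<mu> \<theta>"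
proof -
  define \<pi> where "\<pi> c = (if c = a then g else h)" for c
  have fin: "finite {..<\<theta>}" using \<theta> by simp
  have "coi {..<\<theta>} \<pi> \<mu>"
    unfolding coi_def closed_in_sup_def
    using finite_no_limit_pt[OF fin] \<theta> gh by (auto simp: \<pi>_def intro!: strict_mono_onI)
  moreover have "\<pi> ` {..<\<theta>} = {g, h}" using \<theta> by (auto simp: \<pi>_def)
  ultimately show ?thesis unfolding coi_images_def by blast
qed

context regular_uncountable_cardinal
begin

text \<open>Phrased through the order on an arbitrary \<open>x\<close>, so that the family is
  uniform in \<open>x\<close> and compatible with c.o.i.'s. The inclusion
  \<open>x \<subseteq> y\<close> keeps \<open>x\<close> inside the intersection of the
  supports.\<close>

definition reaching :: "'o set \<Rightarrow> 'o vset set" where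
  "reaching x = {code (y, K) |y K. cond y K \<and> x \<subseteq> y \<and>
     (\<forall>g\<in>x. \<forall>b\<in>x. g < b \<longrightarrow> (\<exists>m. g \<le> m \<and> (m, b) \<in> K))}"

lemma code_in_reaching: "code (y, K) \<in> reaching x \<longleftrightarrow> cond y K \<and> x \<subseteq> y \<and>
    (\<forall>g\<in>x. \<forall>b\<in>x. g < b \<longrightarrow> (\<exists>m. g \<le> m \<and> (m, b) \<in> K))"
  unfolding reaching_def by auto

text \<open>Put \<open>x\<close> into the support first, then make the condition tight: with
  \<open>g\<close> in the support below \<open>b\<close>, tightness forces c_b to reach
  \<open>g\<close>.\<close>

lemma reaching_dense:
  assumes p: "cond y K" and x: "x \<subseteq> {..<succ_card \<kappa>}" "x \<prec> {..<\<kappa>}"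
  shows "\<exists>L. code (cl (y \<union> x), L) \<in> reaching x \<and> extends (cl (y \<union> x)) L y K"
proof -
  have yx: "y \<union> x \<subseteq> {..<succ_card \<kappa>}" "y \<union> x \<prec> {..<\<kappa>}"
    using condD(1,2)[OF p] x by (auto intro: small_Un)
  then have "cond (y \<union> x) K"
    using cond_weaken[OF p] unfolding small_subsets_def by simp
  then obtain L where L: "cond (cl (y \<union> x)) L" "tight (cl (y \<union> x)) L" "extends (cl (y \<union> x)) L (y \<union> x) K"
    using tight_extension by blast
  have sub: "y \<union> x \<subseteq> cl (y \<union> x)" using cl_iff[OF yx(1)] by blast
  have "\<exists>m. g \<le> m \<and> (m, b) \<in> L" if "g \<in> x" "b \<in> x" "g < b" for g b
    using L(2) that sub unfolding tight_def by (meson UnI2 subsetD)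
  then have "code (cl (y \<union> x), L) \<in> reaching x" using L(1) sub unfolding code_in_reaching by blast
  moreover have "extends (cl (y \<union> x)) L y K"
    using L(3) unfolding extends_def by auto
  ultimately show ?thesis by blast
qed

text \<open>A finite \<open>x\<close> is its own closure, so extending the trivial condition yields
  a member with support exactly \<open>x\<close>. Invariance holds because c.o.i.'s preserve and
  reflect order.\<close>

lemma reaching_system:
  assumes \<theta>: "\<theta> < \<kappa>" "finite {..<\<theta>}"
  shows "forcing_data.sharply_dense_system \<kappa> conds cond_le cond_supp cond_act \<theta> reaching"
proof -
  interpret F: forcing_data \<kappa> conds cond_le cond_one tight_conds cond_supp cond_act .
  have supp: "F.supp_of (reaching x) = x" if x: "finite x" "x \<subseteq> {..<succ_card \<kappa>}" for x
  proof (intro subset_antisym)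
    have "cond {} {}" by (simp add: cond_empty)
    from reaching_dense[OF this x(2) small_finite[OF x(1)]]
    obtain L where L: "code (cl x, L) \<in> reaching x" by auto
    have "cl x = x" using cl_iff[OF x(2)] finite_no_limit_pt[OF x(1)] by blast
    then show "F.supp_of (reaching x) \<subseteq> x"
      unfolding F.supp_of_def using INF_lower[OF L, of cond_supp] by simp
    show "x \<subseteq> F.supp_of (reaching x)" unfolding F.supp_of_def reaching_def by auto
  qed
  show ?thesis
    unfolding F.sharply_dense_system_def
  proof (intro conjI ballI allI impI)
    fix x assume "x \<in> coi_images (succ_card \<kappa>) \<theta>"
    then have x: "finite x" "x \<subseteq> {..<succ_card \<kappa>}"
      using coi_images_finite[OF \<theta>(2)] by auto
    note dense = reaching_dense[OF _ x(2) small_finite[OF x(1)]]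
    show "F.supp_of (reaching x) = x" by (rule supp[OF x])
    show "F.sharply_dense (reaching x)"
      unfolding F.sharply_dense_def supp[OF x]
    proof (intro conjI ballI)
      have "cond {} {}" by (simp add: cond_empty)
      from dense[OF this] show "reaching x \<noteq> {}" by blast
      show "reaching x \<subseteq> conds" unfolding reaching_def by auto
      fix p assume "p \<in> conds"
      then obtain y K where p: "p = code (y, K)" "cond y K" by (rule condsE)
      obtain L where "code (cl (y \<union> x), L) \<in> reaching x" "extends (cl (y \<union> x)) L y K"
        using dense[OF p(2)] by blast
      then show "\<exists>q\<in>reaching x. cond_le q p \<and> cond_supp q = cl (cond_supp p \<union> x)"
        unfolding p(1) by (intro bexI[of _ "code (cl (y \<union> x), L)"]) auto
    qed
    fix y \<pi> p
    assume *: "y \<subseteq> {..<succ_card \<kappa>} \<and> coi y \<pi> (succ_card \<kappa>) \<and> p \<in> conds \<and>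
      x \<subseteq> cond_supp p \<and> cond_supp p \<subseteq> y"
    then obtain z K where p: "p = code (z, K)" "cond z K" by (blast elim: condsE)
    have c: "coi y \<pi> (succ_card \<kappa>)" and xz: "x \<subseteq> z" and zy: "z \<subseteq> y" using * p by auto
    have "(\<exists>m. g \<le> m \<and> (m, b) \<in> K) \<longleftrightarrow> (\<exists>m. \<pi> g \<le> m \<and> (m, \<pi> b) \<in> map_prod \<pi> \<pi> ` K)"
      if gb: "g \<in> x" "b \<in> x" for g b
    proof
      assume "\<exists>m. g \<le> m \<and> (m, b) \<in> K"
      then obtain m where m: "g \<le> m" "(m, b) \<in> K" by blast
      have "m \<in> y" using condD(3)[OF p(2) m(2)] zy by blast
      then have "\<pi> g \<le> \<pi> m" using coiD(4)[OF c, of g m] m(1) gb xz zy by blast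
      then show "\<exists>m. \<pi> g \<le> m \<and> (m, \<pi> b) \<in> map_prod \<pi> \<pi> ` K"
        using map_prod_imageI[OF m(2), of \<pi> \<pi>] by (intro exI conjI)
    next
      assume "\<exists>m. \<pi> g \<le> m \<and> (m, \<pi> b) \<in> map_prod \<pi> \<pi> ` K"
      then obtain m b' where m: "\<pi> g \<le> \<pi> m" "\<pi> b = \<pi> b'" "(m, b') \<in> K" by auto
      have "m \<in> y" "b' \<in> y" using condD(3,4)[OF p(2) m(3)] zy by auto
      then have "b = b'" "g \<le> m"
        using m(1,2) coiD(5)[OF c, of b b'] coiD(4)[OF c, of g m] gb xz zy by auto
      then show "\<exists>m. g \<le> m \<and> (m, b) \<in> K" using m(3) by blast
    qed
    moreover have "\<pi> g < \<pi> b \<longleftrightarrow> g < b" if "g \<in> x" "b \<in> x" for g b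
      using coiD(3)[OF c, of g b] that xz zy by blast
    ultimately have "(\<forall>g\<in>x. \<forall>b\<in>x. g < b \<longrightarrow> (\<exists>m. g \<le> m \<and> (m, b) \<in> K)) \<longleftrightarrow>
      (\<forall>g\<in>\<pi> ` x. \<forall>b\<in>\<pi> ` x. g < b \<longrightarrow> (\<exists>m. g \<le> m \<and> (m, b) \<in> map_prod \<pi> \<pi> ` K))"
      by simp
    then show "p \<in> reaching x \<longleftrightarrow> cond_act y \<pi> p \<in> reaching (\<pi> ` x)"
      unfolding p(1) cond_act_code code_in_reaching
      using p(2) cond_image[OF c zy p(2)] xz by auto
  qed (rule \<theta>(1))
qed

lemma square_from_filter:
  assumes filt: "forcing_data.is_filter conds cond_le G"
    and meets: "\<And>g b. g < b \<Longrightarrow> b < succ_card \<kappa> \<Longrightarrow> G \<inter> reaching {g, b} \<noteq> {}"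
  shows "square_B \<kappa>"
proof -
  \<comment> \<open>\<open>b\<close> is left out: in its own approximation it only marks
    completeness.\<close>
  define C where "C b = {a. a < b \<and> (\<exists>x K. code (x, K) \<in> G \<and> (a, b) \<in> K)}" for b
  have GP: "cond x K" if "code (x, K) \<in> G" for x K
    using filt that unfolding forcing_data.is_filter_def by auto
  have dir: "\<exists>z M. extends z M x K \<and> extends z M y L"
    if "code (x, K) \<in> G" "code (y, L) \<in> G" for x K y L
  proof -
    obtain r where r: "r \<in> G" "cond_le r (code (x, K))" "cond_le r (code (y, L))"
      using filt \<open>code (x, K) \<in> G\<close> \<open>code (y, L) \<in> G\<close> unfolding forcing_data.is_filter_def by blast
    then have "r \<in> conds" using filt unfolding forcing_data.is_filter_def by blast
    then obtain z M where "r = code (z, M)" by (rule condsE)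
    then have "extends z M x K \<and> extends z M y L" using r(2,3) by simp
    then show ?thesis by (intro exI)
  qed
  \<comment> \<open>By directedness and end-extension, one condition of \<open>G\<close> with
    \<open>m\<close> in its c_b decides \<open>C b\<close> up to \<open>m\<close>.\<close>
  have C_iff: "a \<in> C b \<longleftrightarrow> (a, b) \<in> K"
    if x: "code (x, K) \<in> G" "(m, b) \<in> K" and a: "a \<le> m" "a < b" for x K m a b
  proof
    assume "a \<in> C b"
    then obtain y L where y: "code (y, L) \<in> G" "(a, b) \<in> L" unfolding C_def by blast
    obtain z M where z: "extends z M x K" "extends z M y L" using dir[OF x(1) y(1)] by blast
    have "(a, b) \<in> M" using extendsD(2)[OF z(2)] y(2) by blast
    then show "(a, b) \<in> K"
      using extendsD(3)[OF z(1) condD(4)[OF GP[OF x(1)] x(2)] _ x(2) a(1)] by blast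
  next
    show "a \<in> C b" if "(a, b) \<in> K" using that a x(1) unfolding C_def by blast
  qed
  have reach: "\<exists>x K m. code (x, K) \<in> G \<and> (m, b) \<in> K \<and> g \<le> m"
    if gb: "g < b" "b < succ_card \<kappa>" for g b
  proof -
    obtain p where p: "p \<in> G" "p \<in> reaching {g, b}" using meets[OF gb] by blast
    then obtain x K where "p = code (x, K)" "\<exists>m. g \<le> m \<and> (m, b) \<in> K"
      using gb(1) unfolding reaching_def by blast
    then show ?thesis using p(1) by blast
  qed
  \<comment> \<open>One condition of \<open>G\<close> whose set at \<open>\<beta>\<close> reaches
    \<open>\<alpha>\<close> decides \<open>C \<beta>\<close> up to \<open>\<alpha>\<close> and, as
    \<open>\<alpha>\<close> is complete there, all of \<open>C \<alpha>\<close>; its coherence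
    passes to \<open>C\<close>.\<close>
  have C_limit: "\<alpha> \<in> C \<beta> \<and> C \<alpha> = C \<beta> \<inter> {..<\<alpha>}"
    if \<alpha>: "\<alpha> < \<beta>" "\<beta> < succ_card \<kappa>" "limit_pt (C \<beta>) \<alpha>" for \<alpha> \<beta>
  proof -
    obtain x K m where x: "code (x, K) \<in> G" "(m, \<beta>) \<in> K" "\<alpha> \<le> m" using reach[OF \<alpha>(1,2)] by blast
    have iff: "a \<in> C \<beta> \<longleftrightarrow> (a, \<beta>) \<in> K" if "a \<le> \<alpha>" for a
      using C_iff[OF x(1,2)] that x(3) \<alpha>(1) by auto
    have "limit_pt (sec K \<beta>) \<alpha>" using \<alpha>(3) by (rule limit_pt_mono) (use iff in auto)
    note k = condD(7-9)[OF GP[OF x(1)] less_imp_le[OF \<alpha>(1)] this]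
    have "a \<in> C \<alpha> \<longleftrightarrow> a \<in> C \<beta>" if a: "a < \<alpha>" for a
    proof -
      have "a \<in> C \<alpha> \<longleftrightarrow> a \<in> sec K \<alpha>" using C_iff[OF x(1) k(3)] a by simp
      also have "\<dots> \<longleftrightarrow> (a, \<beta>) \<in> K" unfolding k(2) using a by (simp add: less_imp_le)
      finally show ?thesis using iff a by simp
    qed
    moreover have "\<alpha> \<in> C \<beta>" using iff k(1) by simp
    moreover have "C \<alpha> \<subseteq> {..<\<alpha>}" unfolding C_def by auto
    ultimately show ?thesis by auto
  qed
  have C_top: "limit_pt (C \<beta>) \<beta>" if \<beta>: "\<beta> < succ_card \<kappa>" "cof \<beta> = \<kappa>" for \<beta>
    unfolding limit_pt_iff
  proof (intro conjI allI impI)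
    show "\<exists>\<gamma>. \<gamma> < \<beta>" using small_bounded[OF \<beta>(2) empty_subsetI small_finite] by blast
    fix \<gamma> assume "\<gamma> < \<beta>"
    \<comment> \<open>Reaching gives only a weak inequality; an intermediate
      \<open>\<gamma>'\<close> makes it strict.\<close>
    then obtain \<gamma>' where \<gamma>': "\<gamma>' < \<beta>" "\<gamma> < \<gamma>'"
      using small_bounded[OF \<beta>(2) _ small_finite, of "{\<gamma>}"] by auto
    obtain x K m where x: "code (x, K) \<in> G" "(m, \<beta>) \<in> K" "\<gamma>' \<le> m" using reach[OF \<gamma>'(1) \<beta>(1)] by blast
    note c = GP[OF x(1)]
    \<comment> \<open>Cofinality \<open>\<kappa>\<close> enters here: completion would make
      \<open>\<beta>\<close> a limit point of a support that is bounded below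
      \<open>\<beta>\<close>.\<close>
    have "m \<noteq> \<beta>"
    proof
      assume "m = \<beta>"
      then have lim: "limit_pt x \<beta>" using condD(6)[OF c] x(2) by simp
      have "x \<inter> {..<\<beta>} \<prec> {..<\<kappa>}" using condD(2)[OF c] by (rule small_subset) auto
      then obtain \<delta> where "\<delta> < \<beta>" "\<forall>a\<in>x \<inter> {..<\<beta>}. a < \<delta>"
        using small_bounded[OF \<beta>(2), of "x \<inter> {..<\<beta>}"] by auto
      then show False using limit_ptD[OF lim, of \<delta>] by (meson IntI lessThan_iff less_asym)
    qed
    then have "m < \<beta>" using condD(5)[OF c x(2)] by simp
    then have "m \<in> C \<beta>" using x unfolding C_def by blast
    then show "\<exists>a\<in>C \<beta>. \<gamma> < a \<and> a < \<beta>" using \<open>m < \<beta>\<close> \<gamma>'(2) x(3) less_le_trans by blast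
  qed
  have C_small: "C \<beta> \<inter> {..<\<delta>} \<prec> {..<\<kappa>}" if "\<delta> < \<beta>" "\<beta> < succ_card \<kappa>" for \<beta> \<delta>
  proof -
    obtain x K m where x: "code (x, K) \<in> G" "(m, \<beta>) \<in> K" "\<delta> \<le> m"
      using reach[OF \<open>\<delta> < \<beta>\<close> \<open>\<beta> < succ_card \<kappa>\<close>] by blast
    have "C \<beta> \<inter> {..<\<delta>} \<subseteq> x"
    proof
      fix a assume a: "a \<in> C \<beta> \<inter> {..<\<delta>}"
      then have "a \<le> m" "a < \<beta>" using x(3) that(1) by auto
      then have "(a, \<beta>) \<in> K" using C_iff[OF x(1,2)] a by blast
      then show "a \<in> x" by (rule condD(3)[OF GP[OF x(1)]])
    qed
    then show ?thesis using small_subset condD(2)[OF GP[OF x(1)]] by blast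
  qed
  define T where "T = {\<beta>. \<beta> < succ_card \<kappa> \<and> cof \<beta> = \<kappa>}"
  \<comment> \<open>At other ordinals \<open>C\<close> may be bounded. For \<open>\<gamma>\<close>
    in \<open>\<Gamma>\<close>, \<open>C \<gamma>\<close> is an initial segment of some
    \<open>C \<beta>\<close> that is cofinal in \<open>\<gamma>\<close>; the case
    \<open>\<gamma> = \<beta>\<close> is included by \<open>C_top\<close>.\<close>
  define \<Gamma> where "\<Gamma> = {\<gamma>. \<exists>\<beta>\<in>T. \<gamma> \<le> \<beta> \<and> limit_pt (C \<beta>) \<gamma>}"
  have CG: "C \<gamma> = C \<beta> \<inter> {..<\<gamma>}" if "\<beta> \<in> T" "\<gamma> \<le> \<beta>" "limit_pt (C \<beta>) \<gamma>" for \<gamma> \<beta>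
  proof (cases "\<gamma> = \<beta>")
    case True
    then show ?thesis unfolding C_def by auto
  next
    case False
    then have "\<gamma> < \<beta>" "\<beta> < succ_card \<kappa>" using that unfolding T_def by auto
    then show ?thesis using C_limit that(3) by blast
  qed
  have coh: "\<alpha> \<in> \<Gamma> \<and> \<alpha> \<in> C \<gamma> \<and> C \<alpha> = C \<gamma> \<inter> {..<\<alpha>}"
    if \<gamma>: "\<gamma> \<in> \<Gamma>" "\<alpha> < \<gamma>" "limit_pt (C \<gamma>) \<alpha>" for \<alpha> \<gamma>
  proof -
    obtain \<beta> where \<beta>: "\<beta> \<in> T" "\<gamma> \<le> \<beta>" "limit_pt (C \<beta>) \<gamma>" using \<gamma>(1) unfolding \<Gamma>_def by blast
    note eq = CG[OF \<beta>]
    have lim: "limit_pt (C \<beta>) \<alpha>" using \<gamma>(3) by (rule limit_pt_mono) (simp add: eq)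
    have lt: "\<alpha> < \<beta>" "\<beta> < succ_card \<kappa>" using \<gamma>(2) \<beta> unfolding T_def by auto
    have "\<alpha> \<in> \<Gamma>" unfolding \<Gamma>_def using \<beta>(1) lt(1) lim less_imp_le by blast
    then show ?thesis using C_limit[OF lt lim] eq \<gamma>(2) by auto
  qed
  have "club_in (C \<gamma>) \<gamma> \<and> otp (C \<gamma>) \<le> \<kappa> \<and> \<gamma> < succ_card \<kappa> \<and> limit_ordinal \<gamma>" if \<gamma>: "\<gamma> \<in> \<Gamma>" for \<gamma>
  proof -
    obtain \<beta> where \<beta>: "\<beta> \<in> T" "\<gamma> \<le> \<beta>" "limit_pt (C \<beta>) \<gamma>" using \<gamma> unfolding \<Gamma>_def by blast
    have lt: "\<beta> < succ_card \<kappa>" using \<beta>(1) unfolding T_def by simp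
    note eq = CG[OF \<beta>]
    have sub: "C \<gamma> \<subseteq> {..<\<gamma>}" unfolding eq by simp
    have lim: "limit_pt (C \<gamma>) \<gamma>" using \<beta>(3) by (rule limit_pt_mono) (simp add: eq)
    have "C \<gamma> \<inter> {..<\<delta>} \<prec> {..<\<kappa>}" if "\<delta> \<in> C \<gamma>" for \<delta>
    proof (rule small_subset)
      show "C \<beta> \<inter> {..<\<delta>} \<prec> {..<\<kappa>}" using C_small[OF _ lt, of \<delta>] that sub \<beta>(2) by auto
      show "C \<gamma> \<inter> {..<\<delta>} \<subseteq> C \<beta> \<inter> {..<\<delta>}" unfolding eq by auto
    qed
    then have "otp (C \<gamma>) \<le> \<kappa>" by (rule otp_le_kappa[OF sub])
    moreover have "club_in (C \<gamma>) \<gamma>"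
      unfolding club_in_def using sub limit_ptD[OF lim] coh[OF \<gamma>] by blast
    moreover have "limit_ordinal \<gamma>"
      unfolding limit_ordinal_def using lim by (rule limit_pt_mono) simp
    ultimately show ?thesis using \<beta>(2) lt by auto
  qed
  moreover have "T \<subseteq> \<Gamma>" unfolding \<Gamma>_def using C_top unfolding T_def by blast
  moreover have "\<alpha> < \<gamma>" if "\<alpha> \<in> C \<gamma>" for \<alpha> \<gamma> using that unfolding C_def by simp
  ultimately show ?thesis
    unfolding square_B_def T_def[symmetric]
    using coh by (intro exI[of _ \<Gamma>] exI[of _ C]) blast
qed

end

theorem theorem3p11:
  fixes \<kappa> :: "'o::wellorder"
  assumes "\<exists>\<mu>::'o. {..<\<kappa>} \<prec> {..<\<mu>}"
    and "regular_uncountable \<kappa>"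
    and "FA \<kappa>"
  shows "square_B \<kappa>"
proof -
  interpret regular_uncountable_cardinal \<kappa> by unfold_locales (rule assms(2))
  \<comment> \<open>Places the ordinals 0, 1 and 2 below \<open>\<kappa>\<close>, as is required of
    \<open>\<theta>\<close> and for the successors to be meaningful.\<close>
  have fin: "finite {..<b} \<Longrightarrow> b < \<kappa>" for b
    using infinite_kappa by (metis finite_subset lessThan_subset_iff not_less)
  have osucc_fin: "{..<osucc b} = insert b {..<b}" "osucc b < \<kappa>" if b: "b < \<kappa>" "finite {..<b}" for b
  proof -
    show eq: "{..<osucc b} = insert b {..<b}" using less_osucc_iff[OF b(1)] by (auto simp: le_less)
    show "osucc b < \<kappa>" by (rule fin) (simp add: eq b(2))
  qed
  have "{..<ozero} = ({} :: 'o set)" using ozero_le by (auto simp: not_less[symmetric])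
  then have z: "finite {..<ozero :: 'o}" by simp
  have s: "finite {..<osucc ozero :: 'o}" using osucc_fin(1)[OF fin[OF z] z] z by simp
  define \<theta> :: 'o where "\<theta> = osucc (osucc ozero)"
  have \<theta>: "{..<\<theta>} = {ozero, osucc ozero}" "ozero < osucc (ozero :: 'o)"
    unfolding \<theta>_def using lessThan_two[OF fin[OF z] fin[OF s]] by auto
  have \<theta>\<kappa>: "\<theta> < \<kappa>" using fin[of \<theta>] \<theta>(1) by simp
  have "forcing_data.sharply_dense_system \<kappa> conds cond_le cond_supp cond_act \<theta> reaching"
    by (rule reaching_system[OF \<theta>\<kappa>]) (simp add: \<theta>(1))
  \<comment> \<open>\<open>FA\<close> takes \<open>\<kappa>\<close> many systems; the same one is
    supplied at every index.\<close>
  then have "\<exists>G. forcing_data.is_filter conds cond_le G \<and>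
      (\<forall>i<\<kappa>. \<forall>x\<in>coi_images (succ_card \<kappa>) \<theta>. G \<inter> reaching x \<noteq> {})"
    using assms(3)[unfolded FA_def, rule_format, OF forcing_class_conds, of "\<lambda>_. \<theta>" "\<lambda>_. reaching"]
    by blast
  then obtain G where G: "forcing_data.is_filter conds cond_le G"
    "\<And>x. x \<in> coi_images (succ_card \<kappa>) \<theta> \<Longrightarrow> G \<inter> reaching x \<noteq> {}"
    using \<theta>\<kappa> by blast
  show ?thesis
    using G(1) G(2)[OF pair_in_coi_images[OF \<theta>]] by (rule square_from_filter)
qed

end
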